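(* Assume $c_1\in(1,30/29)$ and $\varphi_1\simeq\varphi_2$. Let $B$ be either of the sets $B_+$, $B_-$, and define, for $f\colon\mathbb{Z}\to\mathbb{C}$ and $x\in\mathbb{Z}$, \[ \mathcal{M}_{B}f(x)=\sup_{N\in\mathbb{N}}\frac{1}{|B\cap[1,N]|}\sum_{n\in B\cap[1,N]}|f(x-n)|. \] Then $\mathcal{M}_{B}$ is of weak type $(1,1)$: there exists a constant $C>0$ such that for all $f\in\ell^1(\mathbb{Z})$ and all $\lambda>0$, \[ |\{x\in\mathbb{Z}:\ |\mathcal{M}_{B}f(x)|>\lambda\}|\le C\lambda^{-1}\|f\|_{\ell^1(\mathbb{Z})}. \] Moreover, for every $p\in(1,\infty]$ there exists a constant $C_p>0$ such that for all $f\in\ell^p(\mathbb{Z})$, \[ \|\mathcal{M}_{B}f\|_{\ell^p(\mathbb{Z})}\le C_p\|f\|_{\ell^p(\mathbb{Z})}. \]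
   Context: Notation: $\mathbb{N}=\{1,2,\dots\}$; $\{x\}=x-\lfloor x\rfloor$; $f\sim g$ means $f(x)/g(x)\to1$ as $x\to\infty$; $f\lesssim g$ (for non-negative functions) means $f\le Cg$ for some constant $C>0$, and $f\simeq g$ means $f\lesssim g$ and $g\lesssim f$ (on the common domain). Class $\mathcal{L}$: fix $x_0\ge1$; $\mathcal{L}$ is the set of all $\ell\colon[x_0,\infty)\to[1,\infty)$ of the form $\ell(x)=\exp\big(\int_{x_0}^x\frac{\vartheta(t)}{t}dt\big)$ with $\vartheta\in\mathcal{C}^2([x_0,\infty))$ real-valued and $\vartheta(x)\to0$, $x\vartheta'(x)\to0$, $x^2\vartheta''(x)\to0$ as $x\to\infty$. Class $\mathcal{L}_0$: the set of all $\ell\colon[x_0,\infty)\to[1,\infty)$ of the same form, where $\vartheta\in\mathcal{C}^2([x_0,\infty))$ is positive and decreasing, $\vartheta(x)\to0$, $\frac{x\vartheta'(x)}{\vartheta(x)}\to0$, $\frac{x^2\vartheta''(x)}{\vartheta(x)}\to0$ as $x\to\infty$, for every $\varepsilon>0$ one has $\vartheta(x)\gtrsim_\varepsilon x^{-\varepsilon}$, and $\lim_{x\to\infty}\ell(x)=\infty$. Class $\mathcal{R}_c$: for $c\in(1,\infty)$, $\mathcal{R}_c$ is the set of all strictly increasing convex $h\colon[x_0,\infty)\to[1,\infty)$ of the form $h(x)=x^c\ell(x)$ with $\ell\in\mathcal{L}$; $\mathcal{R}_1$ is the set of all strictly increasing convex $h\colon[x_0,\infty)\to[1,\infty)$ of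 the form $h(x)=x\ell(x)$ with $\ell\in\mathcal{L}_0$. Sets $B_\pm$: let $c_1,c_2\in[1,2)$, fix $h_1\in\mathcal{R}_{c_1}$, $h_2\in\mathcal{R}_{c_2}$, and let $\varphi_1,\varphi_2$ be the compositional inverses of $h_1,h_2$. Fix $\psi\in\mathcal{C}^2([1,\infty))$, $\psi\colon[1,\infty)\to(0,1/2]$, with $\psi(x)\sim\varphi_2'(x)$, $\psi'(x)\sim\varphi_2''(x)$, $\psi''(x)\sim\varphi_2'''(x)$ as $x\to\infty$. Then \[ B_+=\{n\in\mathbb{N}:\{\varphi_1(n)\}<\psi(n)\},\qquad B_-=\{n\in\mathbb{N}:\{-\varphi_1(n)\}<\psi(n)\}, \] where only those $n$ in the domain of $\varphi_1$ are considered. The supremum in $\mathcal{M}_B$ is over those $N$ with $B\cap[1,N]\neq\emptyset$. *)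

theory Defs
  imports "HOL-Analysis.Analysis"
begin

text \<open>
  Functions on a half-line \<open>[a,\<infinity>)\<close> are total functions on the reals of which only the
  values on \<open>{a..}\<close> are constrained.  The predicate below says that \<open>f\<close> is
  \<open>\<C>\<^sup>2\<close> on \<open>[a,\<infinity>)\<close> with derivatives \<open>f'\<close>, \<open>f''\<close>
  (one-sided at \<open>a\<close>).
\<close>

definition C2_from :: "real \<Rightarrow> (real \<Rightarrow> real) \<Rightarrow> (real \<Rightarrow> real) \<Rightarrow> (real \<Rightarrow> real) \<Rightarrow> bool" where
  "C2_from a f f' f'' \<longleftrightarrow>
     (\<forall>x\<ge>a. (f has_real_derivative f' x) (at x within {a..})) \<and>
     (\<forall>x\<ge>a. (f' has_real_derivative f'' x) (at x within {a..})) \<and>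
     continuous_on {a..} f''"

definition class_L :: "real \<Rightarrow> (real \<Rightarrow> real) set" where
  "class_L x0 = {l. (\<forall>x\<ge>x0. l x \<ge> 1) \<and>
     (\<exists>\<theta> \<theta>' \<theta>''. C2_from x0 \<theta> \<theta>' \<theta>'' \<and>
        (\<forall>x\<ge>x0. l x = exp (integral {x0..x} (\<lambda>t. \<theta> t / t))) \<and>
        (\<theta> \<longlongrightarrow> 0) at_top \<and>
        ((\<lambda>x. x * \<theta>' x) \<longlongrightarrow> 0) at_top \<and>
        ((\<lambda>x. x\<^sup>2 * \<theta>'' x) \<longlongrightarrow> 0) at_top)}"

definition class_L0 :: "real \<Rightarrow> (real \<Rightarrow> real) set" where
  "class_L0 x0 = {l. (\<forall>x\<ge>x0. l x \<ge> 1) \<and>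
     (\<exists>\<theta> \<theta>' \<theta>''. C2_from x0 \<theta> \<theta>' \<theta>'' \<and>
        (\<forall>x\<ge>x0. l x = exp (integral {x0..x} (\<lambda>t. \<theta> t / t))) \<and>
        (\<forall>x\<ge>x0. \<theta> x > 0) \<and>
        antimono_on {x0..} \<theta> \<and>
        (\<theta> \<longlongrightarrow> 0) at_top \<and>
        ((\<lambda>x. x * \<theta>' x / \<theta> x) \<longlongrightarrow> 0) at_top \<and>
        ((\<lambda>x. x\<^sup>2 * \<theta>'' x / \<theta> x) \<longlongrightarrow> 0) at_top \<and>
        (\<forall>\<epsilon>>0. \<exists>C>0. \<forall>x\<ge>x0. x powr (-\<epsilon>) \<le> C * \<theta> x)) \<and>
     filterlim l at_top at_top}"

definition class_R :: "real \<Rightarrow> real \<Rightarrow> (real \<Rightarrow> real) set" where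
  "class_R x0 c = {h. (\<forall>x\<ge>x0. h x \<ge> 1) \<and> strict_mono_on {x0..} h \<and> convex_on {x0..} h \<and>
     (\<exists>l \<in> (if c = 1 then class_L0 x0 else class_L x0). \<forall>x\<ge>x0. h x = x powr c * l x)}"

definition comparable_on :: "real set \<Rightarrow> (real \<Rightarrow> real) \<Rightarrow> (real \<Rightarrow> real) \<Rightarrow> bool" where
  "comparable_on D f g \<longleftrightarrow>
     (\<exists>C>0. \<forall>x\<in>D. f x \<le> C * g x) \<and> (\<exists>C>0. \<forall>x\<in>D. g x \<le> C * f x)"

text \<open>
  In the next two sets \<open>D\<close> is the domain of \<open>\<phi>\<close>.
\<close>

definition B_plus :: "real set \<Rightarrow> (real \<Rightarrow> real) \<Rightarrow> (real \<Rightarrow> real) \<Rightarrow> nat set" where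
  "B_plus D \<phi> \<psi> = {n. n \<ge> 1 \<and> real n \<in> D \<and> frac (\<phi> (real n)) < \<psi> (real n)}"

definition B_minus :: "real set \<Rightarrow> (real \<Rightarrow> real) \<Rightarrow> (real \<Rightarrow> real) \<Rightarrow> nat set" where
  "B_minus D \<phi> \<psi> = {n. n \<ge> 1 \<and> real n \<in> D \<and> frac (- \<phi> (real n)) < \<psi> (real n)}"

text \<open>
  The maximal function takes values in \<open>[0,\<infinity>]\<close>, since the supremum may be infinite for
  an arbitrary \<open>f\<close>.
\<close>

definition maximal_fun :: "nat set \<Rightarrow> (int \<Rightarrow> complex) \<Rightarrow> int \<Rightarrow> ennreal" where
  "maximal_fun B f x =
     (SUP N \<in> {N. N \<ge> 1 \<and> B \<inter> {1..N} \<noteq> {}}.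
        ennreal ((1 / real (card (B \<inter> {1..N}))) * (\<Sum>n\<in>B \<inter> {1..N}. cmod (f (x - int n)))))"

definition ennreal_powr :: "ennreal \<Rightarrow> real \<Rightarrow> ennreal" where
  "ennreal_powr a s = (if a = \<infinity> then \<infinity> else ennreal (enn2real a powr s))"

text \<open>
  The \<open>\<ell>\<^sup>p(\<int>)\<close> norm, for \<open>1 \<le> p \<le> \<infinity>\<close>, of a function with values in
  \<open>[0,\<infinity>]\<close>; a complex function enters through its modulus.
\<close>

definition lp_norm :: "ennreal \<Rightarrow> (int \<Rightarrow> ennreal) \<Rightarrow> ennreal" where
  "lp_norm p g =
     (if p = \<infinity> then (SUP x. g x)
      else ennreal_powr (\<integral>\<^sup>+ x. ennreal_powr (g x) (enn2real p) \<partial>count_space UNIV) (1 / enn2real p))"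

abbreviation lp_norm_complex :: "ennreal \<Rightarrow> (int \<Rightarrow> complex) \<Rightarrow> ennreal" where
  "lp_norm_complex p f \<equiv> lp_norm p (\<lambda>x. ennreal (cmod (f x)))"

definition lp_space :: "ennreal \<Rightarrow> (int \<Rightarrow> complex) set" where
  "lp_space p = {f. lp_norm_complex p f < \<infinity>}"

end

theory Submission
  imports Defs
begin

text \<open>
  Up to bounded shifts, \<open>B\<close> is a subset of positive relative density of the set of all \<open>\<lfloor>h m\<rfloor>\<close>, where
  \<open>h = h1\<close>; hence the maximal function is dominated by the supremum over \<open>k\<close> of the averages of
  \<open>f (x - \<lfloor>h p\<rfloor>)\<close> over the dyadic blocks \<open>2\<^sup>k \<le> p < 2\<^sup>k\<^sup>+\<^sup>1\<close>.  For the weak type bound at height \<open>\<alpha>\<close>, take a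
  Calderon-Zygmund decomposition, where at the scale \<open>M = 2\<^sup>k\<close> the function is truncated at \<open>\<alpha> M\<close>;
  what has to be estimated is the sum over \<open>k\<close> of the squared \<open>\<ell>\<^sup>2\<close> norms of the averages of the bad parts.
  After averaging over a shift \<open>\<tau>\<close> in \<open>\<lfloor>h p + \<tau>\<rfloor>\<close>, this is a quadratic form whose kernel \<open>K z\<close> counts the pairs
  \<open>p, q\<close> in the block with \<open>\<bar>h p - h q - z\<bar> < 1\<close>.  The kernel is a point mass \<open>1 / M\<close> at the origin, plus a
  function that is Lipschitz at the scale \<open>h M\<close>, against which the mean zero bad parts are small, plus a
  small error.  The error is the discrepancy of lattice points near the curve \<open>h p - h q = z\<close>, whose curvature
  is governed by the monotone function \<open>h'' / h'\<^sup>2\<close>; it is estimated with Dirichlet's approximation theorem,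
  without exponential sums.  The bounds on \<open>\<ell>\<^sup>p\<close> follow by interpolation.
\<close>

section \<open>Sums of the sawtooth function\<close>

text \<open>The diagonal of \<open>K\<close> has mass 1/M, so it contributes the square sum of the
  bad part divided by M. For values f x at most \<alpha> M, summing over the scales M = 2^k gives a
  geometric series with total at most 2 \<alpha> f x, which is why the truncation sits exactly
  there; the larger values reach only about M points n each at scale M, and these exceptional points
  add up to O(f x / \<alpha>). The Lipschitz part costs the ratio of an interval length to h M,
  summable over the scales where h M exceeds that length; longer intervals influence only a fixed
  dilate of themselves. The band |z| < M of the error costs M / h M, summable because c1 > 1.

  The obstacle is the rest of the error: it must beat 1 / h M by a power of M, with only three
  derivatives of h under control. A sawtooth bound M^(9/10) gives an error M^(9/10) / M^2, and h M
  being at most of order M^(21/20) turns this into a gain of M^(-1/20), since 9/10 - 2 + 21/20 =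
  -1/20. A shift by \<tau> in [0,1] changes a floor by at most 1, so averaging over \<tau> costs
  only a neighbouring point.\<close>

lemma card_spread_le:
  fixes S :: "'a set" and g :: "'a \<Rightarrow> int" and d :: real
  assumes "inj_on g S" "0 \<le> d" "\<And>p q. p \<in> S \<Longrightarrow> q \<in> S \<Longrightarrow> real_of_int (g p) - real_of_int (g q) \<le> d"
  shows "finite S \<and> real (card S) \<le> d + 1"
proof (cases "S = {}")
  case False
  then obtain p where p: "p \<in> S" by blast
  define T where "T = g ` S"
  \<comment> \<open>This window around an arbitrary value is twice too long. It only yields
    finiteness, so that \<open>Min T\<close> exists and the sharp window can start there.\<close>
  have T: "T \<subseteq> {g p - \<lfloor>d\<rfloor> .. g p + \<lfloor>d\<rfloor>}"
  proof
    fix x assume "x \<in> T"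
    then obtain q where q: "q \<in> S" "x = g q" by (auto simp: T_def)
    have "g p - g q \<le> \<lfloor>d\<rfloor>" "g q - g p \<le> \<lfloor>d\<rfloor>"
      using assms(3)[OF p q(1)] assms(3)[OF q(1) p] by (simp_all add: le_floor_iff)
    then show "x \<in> {g p - \<lfloor>d\<rfloor> .. g p + \<lfloor>d\<rfloor>}" using q by auto
  qed
  then have fT: "finite T" using finite_subset by blast
  have neT: "T \<noteq> {}" using False by (auto simp: T_def)
  have "T \<subseteq> {Min T .. Min T + \<lfloor>d\<rfloor>}"
  proof
    fix x assume x: "x \<in> T"
    then obtain q where q: "q \<in> S" "x = g q" by (auto simp: T_def)
    have "Min T \<in> T" using fT neT by simp
    then obtain r where r: "r \<in> S" "Min T = g r" by (auto simp: T_def)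
    have "g q - g r \<le> \<lfloor>d\<rfloor>" using assms(3)[OF q(1) r(1)] by (simp add: le_floor_iff)
    moreover have "Min T \<le> x" using x fT by simp
    ultimately show "x \<in> {Min T .. Min T + \<lfloor>d\<rfloor>}" using q r by simp
  qed
  then have "card T \<le> card {Min T .. Min T + \<lfloor>d\<rfloor>}" by (intro card_mono) auto
  also have "\<dots> = nat (\<lfloor>d\<rfloor> + 1)" by simp
  finally have "real (card T) \<le> real (nat (\<lfloor>d\<rfloor> + 1))" by simp
  also have "\<dots> = real_of_int \<lfloor>d\<rfloor> + 1" using assms(2) by simp
  also have "\<dots> \<le> d + 1" by simp
  finally have "real (card T) \<le> d + 1" .
  moreover have "card T = card S" unfolding T_def by (rule card_image[OF assms(1)])
  moreover have "finite S" using fT assms(1) unfolding T_def by (rule finite_imageD)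
  ultimately show ?thesis by simp
qed (use assms in auto)

lemma card_nat_spread_le:
  fixes S :: "nat set" and d :: real
  assumes "0 \<le> d" "\<And>p q. p \<in> S \<Longrightarrow> q \<in> S \<Longrightarrow> real p - real q \<le> d"
  shows "finite S" "real (card S) \<le> d + 1"
  using card_spread_le[of int S d] assms by auto

lemma card_int_spread_le:
  fixes S :: "int set" and d :: real
  assumes "0 \<le> d" "\<And>p q. p \<in> S \<Longrightarrow> q \<in> S \<Longrightarrow> real_of_int p - real_of_int q \<le> d"
  shows "finite S" "real (card S) \<le> d + 1"
  using card_spread_le[of id S d] assms by auto

text \<open>The value at integers is -1/2 and not the symmetric 0. This makes
  \<open>ceiling_eq_saw\<close> and \<open>of_bool_frac_less_eq_saw\<close> exact
  identities.\<close>

definition saw :: "real \<Rightarrow> real" where "saw t = frac t - 1/2"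

lemma abs_saw_le: "\<bar>saw t\<bar> \<le> 1/2"
  unfolding saw_def using frac_ge_0[of t] frac_lt_1[of t] by linarith

text \<open>As long as \<open>w\<close> stays in the unit interval, \<open>frac w = w\<close>. The
  indicator pays for a wrap-around, which can occur only within \<epsilon> of an end point.\<close>

lemma frac_perturb:
  fixes v w \<epsilon> :: real
  assumes "0 \<le> v" "v < 1" "\<bar>w - v\<bar> \<le> \<epsilon>"
  shows "\<bar>frac w - v\<bar> \<le> \<epsilon> + of_bool (v < \<epsilon> \<or> 1 - \<epsilon> \<le> v)"
proof (cases "v < \<epsilon> \<or> 1 - \<epsilon> \<le> v")
  case True
  then have "of_bool (v < \<epsilon> \<or> 1 - \<epsilon> \<le> v) = (1::real)" by simp
  then show ?thesis using frac_ge_0[of w] frac_lt_1[of w] assms by linarith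
next
  case False
  then have "0 \<le> w" "w < 1" using assms by (auto simp: abs_le_iff)
  then have "frac w = w" by (simp add: frac_eq)
  then show ?thesis using assms False by simp
qed

lemma bij_betw_linear_mod:
  fixes a i :: int and b :: nat
  assumes "b > 0" "coprime a (int b)"
  shows "bij_betw (\<lambda>l. nat ((i + a * int l) mod int b)) {..<b} {..<b}"
proof -
  let ?f = "\<lambda>l. nat ((i + a * int l) mod int b)"
  have "inj_on ?f {..<b}"
  proof (rule inj_onI)
    fix l m assume lm: "l \<in> {..<b}" "m \<in> {..<b}" "?f l = ?f m"
    have "(i + a * int l) mod int b = (i + a * int m) mod int b"
      using lm(3) assms(1) by (simp add: nat_eq_iff)
    then have "int b dvd (i + a * int l) - (i + a * int m)" by (rule mod_eq_dvd_iff[THEN iffD1])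
    then have "int b dvd a * (int l - int m)" by (simp add: algebra_simps)
    then have dv: "int b dvd (int l - int m)"
      using assms(2) by (simp add: coprime_commute coprime_dvd_mult_right_iff)
    show "l = m"
    proof (rule ccontr)
      assume "l \<noteq> m"
      then have "int b \<le> \<bar>int l - int m\<bar>" using dv dvd_imp_le_int[of "int l - int m" "int b"] by simp
      then show False using lm(1,2) by auto
    qed
  qed
  moreover have "?f ` {..<b} \<subseteq> {..<b}" using assms(1) by (auto simp: nat_less_iff)
  ultimately show ?thesis
    by (simp add: bij_betw_def endo_inj_surj)
qed

text \<open>Over a full period the rotation by a/b visits, modulo 1, each of the equally spaced
  points (s + i)/b once, and on these the sawtooth sums to s - 1/2. A perturbation costs \<epsilon>
  per point, plus a jump of size 1 at the at most 2 (b \<epsilon> + 1) points near an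
  integer.\<close>

lemma sum_saw_rotation:
  fixes t \<epsilon> :: real and a :: int and b :: nat and x :: "nat \<Rightarrow> real"
  assumes "b > 0" "coprime a (int b)" "\<epsilon> \<ge> 0"
    and x: "\<And>l. l < b \<Longrightarrow> \<bar>x l - (t + real_of_int a * real l / real b)\<bar> \<le> \<epsilon>"
  shows "\<bar>\<Sum>l<b. saw (x l)\<bar> \<le> 5 + 3 * real b * \<epsilon>"
proof -
  \<comment> \<open>Splitting b t into integer part \<open>i0\<close> and remainder \<open>s\<close>
    turns t + a l / b into (s + i)/b modulo 1, where i is the residue of i0 + a l.\<close>
  define i0 where "i0 = \<lfloor>real b * t\<rfloor>"
  define s where "s = real b * t - i0"
  have s: "0 \<le> s" "s < 1" unfolding s_def i0_def by linarith+
  define \<pi> where "\<pi> = (\<lambda>l. nat ((i0 + a * int l) mod int b))"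
  have bij: "bij_betw \<pi> {..<b} {..<b}" unfolding \<pi>_def by (rule bij_betw_linear_mod[OF assms(1,2)])
  define v where "v = (\<lambda>i. (s + real i) / real b)"
  have v01: "0 \<le> v i" "i < b \<Longrightarrow> v i < 1" for i
    unfolding v_def using s assms(1) by (auto simp: field_simps)
  define bad where "bad = (\<lambda>i. v i < \<epsilon> \<or> 1 - \<epsilon> \<le> v i)"
  have pt: "\<bar>saw (x l) - (v (\<pi> l) - 1/2)\<bar> \<le> \<epsilon> + of_bool (bad (\<pi> l))" if l: "l < b" for l
  proof -
    define k where "k = (i0 + a * int l) div int b"
    have "int b * k + int (\<pi> l) = i0 + a * int l"
      unfolding k_def \<pi>_def using assms(1) by simp
    then have "real_of_int (int b * k + int (\<pi> l)) = real_of_int (i0 + a * int l)" by (rule arg_cong)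
    then have "real b * k + real (\<pi> l) = i0 + a * real l" by simp
    then have eq: "t + real_of_int a * real l / real b = v (\<pi> l) + k"
      unfolding v_def s_def using assms(1) by (simp add: field_simps)
    have pl: "\<pi> l < b" using bij l by (auto simp: bij_betw_def)
    have "\<bar>(x l - of_int k) - v (\<pi> l)\<bar> \<le> \<epsilon>" using x[OF l] eq by simp
    moreover have "frac (x l - of_int k) = frac (x l)" by (simp add: frac_def)
    ultimately show ?thesis
      using frac_perturb[OF v01(1) v01(2)[OF pl], of "x l - of_int k" \<epsilon>]
      unfolding saw_def bad_def by simp
  qed
  have "\<bar>(\<Sum>l<b. saw (x l)) - (\<Sum>l<b. v (\<pi> l) - 1/2)\<bar> \<le> (\<Sum>l<b. \<bar>saw (x l) - (v (\<pi> l) - 1/2)\<bar>)"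
    by (simp only: sum_subtractf[symmetric] sum_abs)
  also have "\<dots> \<le> (\<Sum>l<b. \<epsilon> + of_bool (bad (\<pi> l)))" by (intro sum_mono pt) auto
  also have "\<dots> = real b * \<epsilon> + (\<Sum>l<b. of_bool (bad (\<pi> l)))" by (simp add: sum.distrib)
  also have "(\<Sum>l<b. of_bool (bad (\<pi> l)) :: real) = (\<Sum>i<b. of_bool (bad i))"
    by (rule sum.reindex_bij_betw[OF bij])
  also have "(\<Sum>i<b. of_bool (bad i) :: real) = real (card {i. i < b \<and> bad i})"
    by (simp add: lessThan_def Collect_conj_eq Int_commute)
  also have "\<dots> \<le> 2 * (real b * \<epsilon> + 1)"
  proof -
    let ?A = "{i. i < b \<and> v i < \<epsilon>}" and ?B = "{i. i < b \<and> 1 - \<epsilon> \<le> v i}"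
    have "real (card ?A) \<le> real b * \<epsilon> + 1"
    proof (rule card_nat_spread_le(2))
      fix p q assume "p \<in> ?A" "q \<in> ?A"
      then have "s + real p < \<epsilon> * real b" using assms(1) by (simp add: v_def pos_divide_less_eq)
      then show "real p - real q \<le> real b * \<epsilon>" using s by (simp add: mult.commute)
    qed (use assms in auto)
    moreover have "real (card ?B) \<le> real b * \<epsilon> + 1"
    proof (rule card_nat_spread_le(2))
      fix p q assume pq: "p \<in> ?B" "q \<in> ?B"
      then have "(1 - \<epsilon>) * real b \<le> s + real q" using assms(1) by (simp add: v_def pos_le_divide_eq)
      moreover have "real p + 1 \<le> real b" using pq by auto
      ultimately show "real p - real q \<le> real b * \<epsilon>" using s by (simp add: algebra_simps)
    qed (use assms in auto)
    moreover have "card {i. i < b \<and> bad i} \<le> card ?A + card ?B"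
      by (rule order_trans[OF card_mono card_Un_le]) (auto simp: bad_def)
    then have "real (card {i. i < b \<and> bad i}) \<le> real (card ?A) + real (card ?B)"
      unfolding of_nat_add[symmetric] by (rule of_nat_mono)
    moreover have "w \<le> 2 * (z + 1)" if "w \<le> x + y" "x \<le> z + 1" "y \<le> z + 1" for w x y z :: real
      using that by simp
    ultimately show ?thesis by blast
  qed
  finally have A: "\<bar>(\<Sum>l<b. saw (x l)) - (\<Sum>l<b. v (\<pi> l) - 1/2)\<bar> \<le> 3 * real b * \<epsilon> + 2" by (simp add: mult.commute)
  have "(\<Sum>l<b. v (\<pi> l) - 1/2) = (\<Sum>i<b. v i - 1/2)"
    by (rule sum.reindex_bij_betw[OF bij])
  also have "\<dots> = (\<Sum>i<b. s + real i) / real b - real b / 2"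
    unfolding v_def by (simp add: sum_subtractf sum_divide_distrib)
  also have "(\<Sum>i<b. s + real i) = real b * s + real b * (real b - 1) / 2"
    by (induction b) (simp_all add: field_simps)
  also have "(real b * s + real b * (real b - 1) / 2) / real b - real b / 2 = s - 1/2"
    using assms(1) by (simp add: field_simps)
  finally have "\<bar>\<Sum>l<b. v (\<pi> l) - 1/2\<bar> \<le> 1/2" using s by linarith
  with A show ?thesis by linarith
qed


text \<open>The points are grouped by the numerator \<open>a\<close>. The upper bound
  \<open>hi\<close> limits the range of b g and hence the number of numerators; the lower bound
  \<open>lo\<close> confines the points of one numerator to a stretch of length 2 / (b Q
  lo).\<close>

lemma card_near_fractions:
  fixes g :: "nat \<Rightarrow> real" and lo hi :: real and m n b Q :: nat
  assumes incr: "\<And>p q. m \<le> p \<Longrightarrow> p \<le> q \<Longrightarrow> q < n \<Longrightarrow>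
      lo * (real q - real p) \<le> \<bar>g q - g p\<bar> \<and> \<bar>g q - g p\<bar> \<le> hi * (real q - real p)"
    and "lo > 0" "hi \<ge> 0" "b > 0" "Q > 0" "m \<le> n"
  shows "real (card {p \<in> {m..<n}. \<exists>a::int. \<bar>real b * g p - a\<bar> \<le> 1 / real Q})
      \<le> (hi * (real n - real m) + 3) * (real b + 2 / (real Q * lo))"
proof -
  have inc: "lo * \<bar>real q - real p\<bar> \<le> \<bar>g q - g p\<bar>" "\<bar>g q - g p\<bar> \<le> hi * \<bar>real q - real p\<bar>"
    if "p \<in> {m..<n}" "q \<in> {m..<n}" for p q
    using incr[of p q] incr[of q p] that by (cases "p \<le> q"; simp add: abs_minus_commute)+
  define A where "A = {a::int. \<exists>p \<in> {m..<n}. \<bar>real b * g p - a\<bar> \<le> 1 / real Q}"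
  define S where "S = (\<lambda>a::int. {p \<in> {m..<n}. \<bar>real b * g p - a\<bar> \<le> 1 / real Q})"
  have Q1: "1 / real Q \<le> 1" using \<open>Q > 0\<close> by simp
  have A: "finite A" "real (card A) \<le> (real b * (hi * (real n - real m)) + 2) + 1"
  proof -
    have nn: "0 \<le> real b * (hi * (real n - real m)) + 2" using assms by simp
    have sp: "real_of_int a - real_of_int a' \<le> real b * (hi * (real n - real m)) + 2"
      if aa: "a \<in> A" "a' \<in> A" for a a'
    proof -
      obtain p q where p: "p \<in> {m..<n}" "\<bar>real b * g p - a\<bar> \<le> 1 / real Q"
        and q: "q \<in> {m..<n}" "\<bar>real b * g q - a'\<bar> \<le> 1 / real Q"
        using aa unfolding A_def by blast
      have "\<bar>g p - g q\<bar> \<le> hi * (real n - real m)"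
      proof (rule order_trans[OF inc(2)[OF q(1) p(1)]])
        show "hi * \<bar>real p - real q\<bar> \<le> hi * (real n - real m)"
          using p(1) q(1) assms by (intro mult_left_mono) auto
      qed
      then have "real b * (g p - g q) \<le> real b * (hi * (real n - real m))"
        by (intro mult_left_mono) auto
      then show ?thesis using p(2) q(2) Q1 by (simp add: abs_le_iff algebra_simps)
    qed
    show "finite A" "real (card A) \<le> (real b * (hi * (real n - real m)) + 2) + 1"
      using card_int_spread_le[OF nn sp] by auto
  qed
  have S: "real (card (S a)) \<le> 2 / (real b * real Q * lo) + 1" for a
  proof (rule card_nat_spread_le(2))
    fix p q assume pq: "p \<in> S a" "q \<in> S a"
    then have pq': "p \<in> {m..<n}" "q \<in> {m..<n}" by (auto simp: S_def)
    have "real b * (g p - g q) \<le> 2 / real Q" "real b * (g q - g p) \<le> 2 / real Q"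
      using pq by (auto simp: S_def abs_le_iff algebra_simps add_divide_distrib)
    then have "real b * \<bar>g p - g q\<bar> \<le> 2 / real Q" by (simp add: abs_if)
    moreover have "real b * (lo * \<bar>real p - real q\<bar>) \<le> real b * \<bar>g p - g q\<bar>"
      using inc(1)[OF pq'(2,1)] by (intro mult_left_mono) auto
    ultimately have "real b * (lo * \<bar>real p - real q\<bar>) \<le> 2 / real Q" by linarith
    then have "\<bar>real p - real q\<bar> \<le> 2 / (real b * real Q * lo)"
      using assms by (simp add: field_simps)
    then show "real p - real q \<le> 2 / (real b * real Q * lo)" by linarith
  qed (use assms in auto)
  have "{p \<in> {m..<n}. \<exists>a::int. \<bar>real b * g p - a\<bar> \<le> 1 / real Q} = (\<Union>a\<in>A. S a)"
    unfolding A_def S_def by blast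
  then have "card {p \<in> {m..<n}. \<exists>a::int. \<bar>real b * g p - a\<bar> \<le> 1 / real Q} \<le> (\<Sum>a\<in>A. card (S a))"
    using card_UN_le[OF A(1)] by simp
  then have "real (card {p \<in> {m..<n}. \<exists>a::int. \<bar>real b * g p - a\<bar> \<le> 1 / real Q}) \<le> (\<Sum>a\<in>A. real (card (S a)))"
    unfolding of_nat_sum[symmetric] by (rule of_nat_mono)
  also have "\<dots> \<le> (\<Sum>a\<in>A. 2 / (real b * real Q * lo) + 1)" by (intro sum_mono S)
  also have "\<dots> = real (card A) * (2 / (real b * real Q * lo) + 1)" by simp
  also have "\<dots> \<le> (real b * (hi * (real n - real m) + 3)) * (2 / (real b * real Q * lo) + 1)"
  proof (rule mult_right_mono)
    have "real b \<ge> 1" using assms by simp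
    then show "real (card A) \<le> real b * (hi * (real n - real m) + 3)"
      using A(2) by (simp add: algebra_simps)
  qed (use assms in auto)
  also have "\<dots> = (hi * (real n - real m) + 3) * (real b + 2 / (real Q * lo))"
    using assms by (simp add: field_simps)
  finally show ?thesis .
qed

text \<open>On a block of length b the function is linearised at its left end: the slope is within
  1/(b Q) of a/b and the second order error is at most hi b^2, so the points follow a rotation by
  a/b. The hypotheses reach only up to p + b - 1, the last integer of the block.\<close>

lemma sum_saw_block:
  fixes f f' :: "real \<Rightarrow> real" and hi :: real and p b Q :: nat and a :: int
  assumes deriv: "\<And>t. real p \<le> t \<Longrightarrow> t + 1 \<le> real (p + b) \<Longrightarrow> (f has_real_derivative f' t) (at t)"
    and incr: "\<And>t. real p \<le> t \<Longrightarrow> t + 1 \<le> real (p + b) \<Longrightarrow> \<bar>f' t - f' (real p)\<bar> \<le> hi * (t - real p)"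
    and "hi \<ge> 0" "b > 0" "b \<le> Q" "coprime a (int b)" "\<bar>real b * f' p - a\<bar> \<le> 1 / real Q"
  shows "\<bar>\<Sum>q\<in>{p..<p+b}. saw (f q)\<bar> \<le> 8 + 3 * hi * real Q ^ 3"
proof -
  define \<epsilon> where "\<epsilon> = hi * (real b)\<^sup>2 + 1 / real Q"
  have near: "\<bar>f (real (p + l)) - (f p + real_of_int a * real l / real b)\<bar> \<le> \<epsilon>" if l: "l < b" for l
  proof -
    have lb: "real l + 1 \<le> real b" using l by linarith
    have "\<bar>f (real (p + l)) - f p - real l * f' p\<bar> \<le> hi * (real b)\<^sup>2"
    proof (cases "l = 0")
      case False
      then have "\<exists>z>real p. z < real (p + l) \<and> f (real (p + l)) - f (real p) = (real (p + l) - real p) * f' z"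
        by (intro MVT2) (use deriv lb in auto)
      then obtain z where z: "real p < z" "z < real (p + l)" "f (real (p + l)) - f (real p) = real l * f' z"
        by auto
      have "\<bar>f' z - f' p\<bar> \<le> hi * (z - real p)" using incr[of z] z lb by auto
      also have "\<dots> \<le> hi * real b" using z lb assms(3) by (intro mult_left_mono) auto
      finally have d: "\<bar>f' z - f' p\<bar> \<le> hi * real b" .
      have "\<bar>f (real (p + l)) - f p - real l * f' p\<bar> = real l * \<bar>f' z - f' p\<bar>"
        using z(3) by (simp add: abs_mult flip: right_diff_distrib)
      also have "\<dots> \<le> real b * (hi * real b)" using d lb by (intro mult_mono) auto
      finally show ?thesis by (simp add: power2_eq_square mult_ac)
    qed (use assms in auto)
    moreover have "\<bar>real l * f' p - real_of_int a * real l / real b\<bar> \<le> 1 / real Q"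
    proof -
      have "real l * f' p - real_of_int a * real l / real b = (real l / real b) * (real b * f' p - a)"
        using assms(4) by (simp add: field_simps)
      then have "\<bar>real l * f' p - real_of_int a * real l / real b\<bar> = (real l / real b) * \<bar>real b * f' p - a\<bar>"
        by (simp add: abs_mult)
      also have "\<dots> \<le> 1 * (1 / real Q)" using assms(7) lb by (intro mult_mono) auto
      finally show ?thesis by simp
    qed
    ultimately show ?thesis unfolding \<epsilon>_def by linarith
  qed
  have "\<bar>\<Sum>l<b. saw (f (real (p + l)))\<bar> \<le> 5 + 3 * real b * \<epsilon>"
    by (rule sum_saw_rotation[OF assms(4,6) _ near]) (use assms in \<open>auto simp: \<epsilon>_def\<close>)
  also have "\<dots> \<le> 5 + 3 * (hi * real Q ^ 3 + 1)"
  proof -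
    have "hi * real b ^ 3 \<le> hi * real Q ^ 3" using assms by (intro mult_left_mono power_mono) auto
    moreover have "real b / real Q \<le> 1" using assms by simp
    moreover have "3 * real b * \<epsilon> = 3 * (hi * real b ^ 3) + 3 * (real b / real Q)"
      unfolding \<epsilon>_def by (simp add: algebra_simps power2_eq_square power3_eq_cube)
    ultimately show ?thesis by argo
  qed
  also have "(\<Sum>l<b. saw (f (real (p + l)))) = (\<Sum>q\<in>{p..<p+b}. saw (f q))"
    by (rule sum.reindex_bij_witness[of _ "\<lambda>q. q - p" "\<lambda>l. p + l"]) auto
  finally show ?thesis by (simp add: algebra_simps)
qed

text \<open>Cut the range greedily into blocks whose length is a Dirichlet denominator of \<open>f'\<close> at the left
  end. A block costs a bounded amount, and a short block can only start where \<open>f'\<close> is close to a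
  fraction with small denominator.\<close>

lemma sum_saw_le:
  fixes f f' :: "real \<Rightarrow> real" and lo hi :: real and m n B Q :: nat
  assumes deriv: "\<And>t. real m \<le> t \<Longrightarrow> t + 1 \<le> real n \<Longrightarrow> (f has_real_derivative f' t) (at t)"
    and incr: "\<And>s t. real m \<le> s \<Longrightarrow> s \<le> t \<Longrightarrow> t + 1 \<le> real n \<Longrightarrow>
      lo * (t - s) \<le> \<bar>f' t - f' s\<bar> \<and> \<bar>f' t - f' s\<bar> \<le> hi * (t - s)"
    and pos: "lo > 0" "hi \<ge> 0" "B > 0" "Q > 0" and "m \<le> n"
  shows "\<bar>\<Sum>p\<in>{m..<n}. saw (f p)\<bar> \<le> (8 + 3 * hi * real Q ^ 3) *
    ((real n - real m) / real B + (hi * (real n - real m) + 3) * real B * (real B + 2 / (real Q * lo))) + real Q"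
proof -
  define C where "C = 8 + 3 * hi * real Q ^ 3"
  have C: "C \<ge> 0" unfolding C_def using pos by simp
  define bad where "bad = (\<lambda>p::nat. \<exists>b\<in>{1..B}. \<exists>a::int. \<bar>real b * f' p - a\<bar> \<le> 1 / real Q)"
  have main: "m \<le> p \<Longrightarrow> p \<le> n \<Longrightarrow> \<bar>\<Sum>q\<in>{p..<n}. saw (f q)\<bar> \<le>
      C * ((real n - real p) / real B + real (card {q \<in> {p..<n}. bad q})) + real Q" for p
  proof (induction "n - p" arbitrary: p rule: less_induct)
    case less
    obtain a k where ak: "coprime a k" "0 < k" "k \<le> int Q" "\<bar>of_int k * f' p - of_int a\<bar> < 1 / real Q"
      using Dirichlet_approx_coprime[OF pos(4)] by blast
    define b where "b = nat k"
    have b: "b > 0" "b \<le> Q" "coprime a (int b)" "\<bar>real b * f' p - a\<bar> \<le> 1 / real Q"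
      using ak unfolding b_def by auto
    show ?case
    proof (cases "p + b \<le> n")
      \<comment> \<open>The last block may be incomplete. It has fewer than Q terms, which accounts
        for the final summand \<open>real Q\<close>.\<close>
      case False
      have "\<bar>\<Sum>q\<in>{p..<n}. saw (f q)\<bar> \<le> (\<Sum>q\<in>{p..<n}. \<bar>saw (f q)\<bar>)" by (rule sum_abs)
      also have "\<dots> \<le> (\<Sum>q\<in>{p..<n}. 1/2)" by (intro sum_mono abs_saw_le)
      also have "\<dots> \<le> real Q" using False b(2) by simp
      also have "\<dots> \<le> C * ((real n - real p) / real B + real (card {q \<in> {p..<n}. bad q})) + real Q"
        using C less.prems by simp
      finally show ?thesis .
    next
      case True
      have blk: "\<bar>\<Sum>q\<in>{p..<p+b}. saw (f q)\<bar> \<le> C" unfolding C_def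
      proof (rule sum_saw_block[where f' = f' and a = a])
        fix t assume t: "real p \<le> t" "t + 1 \<le> real (p + b)"
        have tn: "real m \<le> t" "real m \<le> real p" "t + 1 \<le> real n" using t True less.prems by linarith+
        show "(f has_real_derivative f' t) (at t)" using deriv tn by simp
        show "\<bar>f' t - f' (real p)\<bar> \<le> hi * (t - real p)" using incr[of "real p" t] tn t by simp
      qed (use b pos in auto)
      have IH: "\<bar>\<Sum>q\<in>{p+b..<n}. saw (f q)\<bar> \<le>
          C * ((real n - real (p+b)) / real B + real (card {q \<in> {p+b..<n}. bad q})) + real Q"
        by (rule less.hyps) (use True b less.prems in auto)
      have split: "(\<Sum>q\<in>{p..<n}. saw (f q)) = (\<Sum>q\<in>{p..<p+b}. saw (f q)) + (\<Sum>q\<in>{p+b..<n}. saw (f q))"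
        by (rule sum.atLeastLessThan_concat[symmetric]) (use True in auto)
      \<comment> \<open>Every block is paid for by one unit: a block with b at most B starts at a
        bad point that is not counted again, and a longer block reduces (n - p)/B by more than
        1.\<close>
      have "1 + ((real n - real (p+b)) / real B + real (card {q \<in> {p+b..<n}. bad q})) \<le>
          (real n - real p) / real B + real (card {q \<in> {p..<n}. bad q})"
      proof (cases "b \<le> B")
        case True
        then have "bad p" unfolding bad_def using b by force
        then have "insert p {q \<in> {p+b..<n}. bad q} \<subseteq> {q \<in> {p..<n}. bad q}"
          using \<open>p + b \<le> n\<close> b(1) by auto
        then have "card (insert p {q \<in> {p+b..<n}. bad q}) \<le> card {q \<in> {p..<n}. bad q}"
          by (intro card_mono) auto
        then have "1 + card {q \<in> {p+b..<n}. bad q} \<le> card {q \<in> {p..<n}. bad q}" using b(1) by simp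
        then have "1 + real (card {q \<in> {p+b..<n}. bad q}) \<le> real (card {q \<in> {p..<n}. bad q})" by linarith
        moreover have "(real n - real (p+b)) / real B \<le> (real n - real p) / real B"
          by (intro divide_right_mono) auto
        ultimately show ?thesis by linarith
      next
        case False
        then have "1 \<le> real b / real B" using pos(3) by simp
        moreover have "(real n - real (p+b)) / real B = (real n - real p) / real B - real b / real B"
          by (simp add: diff_divide_distrib add_divide_distrib)
        moreover have "card {q \<in> {p+b..<n}. bad q} \<le> card {q \<in> {p..<n}. bad q}"
          by (intro card_mono) auto
        ultimately show ?thesis by linarith
      qed
      then have "C * (1 + ((real n - real (p+b)) / real B + real (card {q \<in> {p+b..<n}. bad q}))) \<le>
          C * ((real n - real p) / real B + real (card {q \<in> {p..<n}. bad q}))"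
        using C by (rule mult_left_mono)
      moreover have "C * (1 + ((real n - real (p+b)) / real B + real (card {q \<in> {p+b..<n}. bad q}))) =
          C + C * ((real n - real (p+b)) / real B + real (card {q \<in> {p+b..<n}. bad q}))"
        by (simp only: distrib_left mult_1_right)
      ultimately show ?thesis using blk IH split by linarith
    qed
  qed
  have "real (card {q \<in> {m..<n}. bad q}) \<le>
      (hi * (real n - real m) + 3) * real B * (real B + 2 / (real Q * lo))"
  proof -
    let ?S = "\<lambda>b. {p \<in> {m..<n}. \<exists>a::int. \<bar>real b * f' p - a\<bar> \<le> 1 / real Q}"
    have "{q \<in> {m..<n}. bad q} = (\<Union>b\<in>{1..B}. ?S b)" unfolding bad_def by blast
    then have "card {q \<in> {m..<n}. bad q} \<le> (\<Sum>b\<in>{1..B}. card (?S b))"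
      using card_UN_le[of "{1..B}"] by simp
    then have "real (card {q \<in> {m..<n}. bad q}) \<le> (\<Sum>b\<in>{1..B}. real (card (?S b)))"
      unfolding of_nat_sum[symmetric] by (rule of_nat_mono)
    also have "\<dots> \<le> (\<Sum>b\<in>{1..B}. (hi * (real n - real m) + 3) * (real B + 2 / (real Q * lo)))"
    proof (rule sum_mono)
      fix b assume b: "b \<in> {1..B}"
      have "real (card (?S b)) \<le> (hi * (real n - real m) + 3) * (real b + 2 / (real Q * lo))"
      proof (rule card_near_fractions)
        fix p q assume "m \<le> p" "p \<le> q" "q < n"
        then show "lo * (real q - real p) \<le> \<bar>f' q - f' p\<bar> \<and> \<bar>f' q - f' p\<bar> \<le> hi * (real q - real p)"
          by (intro incr) auto
      qed (use pos b assms in auto)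
      also have "\<dots> \<le> (hi * (real n - real m) + 3) * (real B + 2 / (real Q * lo))"
        using b pos assms by (intro mult_left_mono) auto
      finally show "real (card (?S b)) \<le> \<dots>" .
    qed
    finally show ?thesis by (simp add: mult_ac)
  qed
  then have "C * ((real n - real m) / real B + real (card {q \<in> {m..<n}. bad q})) \<le>
      C * ((real n - real m) / real B + (hi * (real n - real m) + 3) * real B * (real B + 2 / (real Q * lo)))"
    using C by (intro mult_left_mono add_left_mono)
  then show ?thesis using main[of m] assms(7) unfolding C_def by linarith
qed

text \<open>The window for the curvature is wide enough for two different uses: the level curves in
  \<open>R_le\<close>, with curvature between 1/h M and 1/M up to constants, and h itself in
  \<open>frac_count\<close>, with curvature about h M / M^2. Both fit since h M lies between M and
  C0 M^(21/20).\<close>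

definition saw_sum_bound :: "real \<Rightarrow> real \<Rightarrow> real \<Rightarrow> bool" where
  "saw_sum_bound e M K \<longleftrightarrow> (\<forall>(f :: real \<Rightarrow> real) (f' :: real \<Rightarrow> real) (lo :: real) (hi :: real) (m :: nat) (n :: nat).
    m \<le> n \<longrightarrow> real n - real m \<le> M \<longrightarrow>
    (\<forall>t::real. real m \<le> t \<and> t + 1 \<le> real n \<longrightarrow> (f has_real_derivative f' t) (at t)) \<longrightarrow>
    (\<forall>(s::real) (t::real). real m \<le> s \<and> s \<le> t \<and> t + 1 \<le> real n \<longrightarrow>
      lo * (t - s) \<le> \<bar>f' t - f' s\<bar> \<and> \<bar>f' t - f' s\<bar> \<le> hi * (t - s)) \<longrightarrow>
    e * M powr (-21/20) \<le> lo \<longrightarrow> 0 \<le> hi \<longrightarrow> hi \<le> M powr (-19/20) / e \<longrightarrow>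
    \<bar>\<Sum>p\<in>{m..<n}. saw (f p)\<bar> \<le> K)"

lemma saw_sum_boundD:
  fixes f f' :: "real \<Rightarrow> real" and m n :: nat
  assumes "saw_sum_bound e M K" "m \<le> n" "real n - real m \<le> M"
    "\<forall>t::real. real m \<le> t \<and> t + 1 \<le> real n \<longrightarrow> (f has_real_derivative f' t) (at t)"
    "\<forall>(s::real) (t::real). real m \<le> s \<and> s \<le> t \<and> t + 1 \<le> real n \<longrightarrow>
      lo * (t - s) \<le> \<bar>f' t - f' s\<bar> \<and> \<bar>f' t - f' s\<bar> \<le> hi * (t - s)"
    "e * M powr (-21/20) \<le> lo" "0 \<le> hi" "hi \<le> M powr (-19/20) / e"
  shows "\<bar>\<Sum>p\<in>{m..<n}. saw (f (real p))\<bar> \<le> K"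
  using assms(1)[unfolded saw_sum_bound_def, rule_format, OF assms(2,3) _ _ assms(6-8), of f f'] assms(4,5) by blast

text \<open>The parameters of \<open>sum_saw_le\<close> are B = L and Q = L^3 with L about M^(1/10).
  Then hi Q^3 stays bounded, M/B is about M^(9/10), and the short blocks cost M^(1/20) for the
  factor hi M + 3 times M^(17/20) for B (B + 2 / (Q lo)), again M^(9/10).\<close>

lemma saw_sum_bound_powr:
  fixes e :: real
  assumes "0 < e"
  shows "\<exists>C>0. \<forall>M\<ge>1. saw_sum_bound e M (C * M powr (9/10))"
proof -
  define C where "C = (8 + 3 / e) * (2 + (1 / e + 3) * (1 + 8 / e)) + 1"
  show ?thesis
    unfolding saw_sum_bound_def
  proof (intro exI[of _ C] conjI allI impI)
    show "C > 0" unfolding C_def using assms by (auto intro!: add_nonneg_pos mult_nonneg_nonneg add_nonneg_nonneg)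
  next
    fix M :: real and f f' :: "real \<Rightarrow> real" and lo hi :: real and m n :: nat
    assume M: "1 \<le> M" and mn: "m \<le> n" "real n - real m \<le> M"
      and deriv: "\<forall>t. real m \<le> t \<and> t + 1 \<le> real n \<longrightarrow> (f has_real_derivative f' t) (at t)"
      and incr: "\<forall>(s::real) (t::real). real m \<le> s \<and> s \<le> t \<and> t + 1 \<le> real n \<longrightarrow>
        lo * (t - s) \<le> \<bar>f' t - f' s\<bar> \<and> \<bar>f' t - f' s\<bar> \<le> hi * (t - s)"
      and lo: "e * M powr (-21/20) \<le> lo" and hi: "0 \<le> hi" "hi \<le> M powr (-19/20) / e"
    define N where "N = M powr (1/10)"
    have N1: "N \<ge> 1" unfolding N_def using M by (simp add: ge_one_powr_ge_zero)
    define L where "L = nat \<lfloor>N\<rfloor>"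
    have L: "L > 0" "real L \<le> N" "N \<le> 2 * real L"
    proof -
      have "\<lfloor>N\<rfloor> \<ge> 1" using N1 by simp
      then have "real L = real_of_int \<lfloor>N\<rfloor>" "L > 0" unfolding L_def by auto
      moreover have "N < real_of_int \<lfloor>N\<rfloor> + 1" by linarith
      ultimately show "L > 0" "real L \<le> N" "N \<le> 2 * real L" using \<open>\<lfloor>N\<rfloor> \<ge> 1\<close> by linarith+
    qed
    have lo0: "lo > 0" using lo assms M by (smt (verit) mult_pos_pos powr_gt_zero)
    have pw: "M powr (k/10) = N ^ k'" if "k = real k'" for k k'
      unfolding N_def that using M by (simp add: powr_powr flip: powr_realpow)
    define D where "D = real n - real m"
    have D: "0 \<le> D" "D \<le> M" unfolding D_def using mn by auto
    have MN: "M = N ^ 10" using pw[of 10 10] M by simp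
    have T1: "hi * real (L^3) ^ 3 \<le> 1 / e"
    proof -
      have "real (L^3) ^ 3 = real L ^ 9" by simp
      also have "\<dots> \<le> N ^ 9" using L by (intro power_mono) auto
      also have "\<dots> = M powr (9/10)" using pw[of 9 9] by simp
      also have "\<dots> \<le> M powr (19/20)" using M by (intro powr_mono) auto
      finally have "hi * real (L^3) ^ 3 \<le> (M powr (-19/20) / e) * M powr (19/20)"
        using hi assms by (intro mult_mono) auto
      also have "\<dots> = M powr (-19/20) * M powr (19/20) / e" by simp
      also have "M powr (-19/20) * M powr (19/20) = 1" using M by (simp only: powr_add[symmetric]) simp
      finally show ?thesis .
    qed
    have T2: "D / real L \<le> 2 * M powr (9/10)"
    proof -
      have "D / real L \<le> N ^ 10 / (N / 2)" using D L MN by (intro frac_le) auto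
      also have "\<dots> = 2 * N ^ 9" using N1 by (simp add: field_simps eval_nat_numeral)
      finally show ?thesis using pw[of 9 9] by simp
    qed
    have M20: "1 \<le> M powr (1/20)" using M by (simp add: ge_one_powr_ge_zero)
    have T3: "hi * D + 3 \<le> (1 / e + 3) * M powr (1/20)"
    proof -
      have "hi * D \<le> (M powr (-19/20) / e) * M" using hi D assms by (intro mult_mono) auto
      also have "M powr (-19/20) / e * M = (M powr (-19/20) * M powr 1) / e" using M by simp
      also have "M powr (-19/20) * M powr 1 = M powr (1/20)" by (simp only: powr_add[symmetric]) simp
      finally show ?thesis using M20 by (simp add: algebra_simps)
    qed
    have T4: "real L * (real L + 2 / (real (L^3) * lo)) \<le> (1 + 8 / e) * M powr (17/20)"
    proof -
      have "real L * real L \<le> N * N" using L by (intro mult_mono) auto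
      also have "\<dots> = M powr (2/10)" using pw[of 2 2] by (simp add: power2_eq_square)
      also have "\<dots> \<le> M powr (17/20)" using M by (intro powr_mono) auto
      finally have a: "real L * real L \<le> M powr (17/20)" .
      have "real L * (2 / (real (L^3) * lo)) = 2 / (real L ^ 2 * lo)"
        using L by (simp add: field_simps eval_nat_numeral)
      also have "\<dots> \<le> 2 / ((N/2)^2 * (e * M powr (-21/20)))"
        using L lo lo0 assms N1 M by (intro divide_left_mono mult_mono power_mono mult_pos_pos) auto
      also have "\<dots> = (8 / e) * (1 / (N^2 * M powr (-21/20)))" by (simp add: field_simps)
      also have "N^2 * M powr (-21/20) = M powr (2/10) * M powr (-21/20)" using pw[of 2 2] by simp
      also have "\<dots> = M powr (-17/20)" by (simp only: powr_add[symmetric]) simp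
      also have "1 / M powr (-17/20) = M powr (17/20)" by (simp add: powr_minus_divide)
      finally have "real L * (2 / (real (L^3) * lo)) \<le> (8 / e) * M powr (17/20)" .
      then show ?thesis using a by (simp add: algebra_simps)
    qed
    have T5: "real (L^3) \<le> M powr (9/10)"
    proof -
      have "real (L^3) \<le> N ^ 3" using L by (simp add: power_mono)
      also have "\<dots> \<le> N ^ 9" using N1 by (intro power_increasing) auto
      finally show ?thesis using pw[of 9 9] by simp
    qed
    have "\<bar>\<Sum>p\<in>{m..<n}. saw (f p)\<bar> \<le> (8 + 3 * hi * real (L^3) ^ 3) *
      (D / real L + (hi * D + 3) * real L * (real L + 2 / (real (L^3) * lo))) + real (L^3)"
      unfolding D_def by (rule sum_saw_le[where f'=f']) (use deriv incr lo0 hi L mn in auto)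
    also have "\<dots> \<le> (8 + 3 / e) * (2 * M powr (9/10) + ((1 / e + 3) * M powr (1/20)) * ((1 + 8 / e) * M powr (17/20)))
        + M powr (9/10)"
    proof (rule add_mono[OF mult_mono T5])
      show "8 + 3 * hi * real (L^3) ^ 3 \<le> 8 + 3 / e" using T1 by (simp add: algebra_simps)
      have "(hi * D + 3) * (real L * (real L + 2 / (real (L^3) * lo))) \<le>
          ((1 / e + 3) * M powr (1/20)) * ((1 + 8 / e) * M powr (17/20))"
        using hi D assms lo0 by (intro mult_mono[OF T3 T4]) (auto intro!: mult_nonneg_nonneg add_nonneg_nonneg)
      then show "D / real L + (hi * D + 3) * real L * (real L + 2 / (real (L^3) * lo)) \<le>
          2 * M powr (9/10) + ((1 / e + 3) * M powr (1/20)) * ((1 + 8 / e) * M powr (17/20))"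
        using T2 by (simp add: mult.assoc)
    qed (use hi D lo0 assms in \<open>auto intro!: add_nonneg_nonneg mult_nonneg_nonneg divide_nonneg_nonneg\<close>)
    also have "\<dots> = C * M powr (9/10)"
    proof -
      have "M powr (1/20) * M powr (17/20) = M powr (9/10)" by (simp only: powr_add[symmetric]) simp
      then have "((1 / e + 3) * M powr (1/20)) * ((1 + 8 / e) * M powr (17/20)) = (1 / e + 3) * (1 + 8 / e) * M powr (9/10)"
        by (metis (no_types, lifting) mult.assoc mult.left_commute)
      then have "(8 + 3 / e) * (2 * M powr (9/10) + ((1 / e + 3) * M powr (1/20)) * ((1 + 8 / e) * M powr (17/20)))
          + M powr (9/10) = (8 + 3 / e) * (2 * M powr (9/10) + (1 / e + 3) * (1 + 8 / e) * M powr (9/10)) + M powr (9/10)"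
        by (simp only:)
      also have "\<dots> = C * M powr (9/10)" unfolding C_def by (simp only: distrib_right distrib_left mult.assoc mult_1_left)
      finally show ?thesis .
    qed
    finally show "\<bar>\<Sum>p\<in>{m..<n}. saw (f p)\<bar> \<le> C * M powr (9/10)" .
  qed
qed

section \<open>Regularly varying functions and their dyadic blocks\<close>

text \<open>Only the interior and the closure of the set are prescribed, so half-open windows can be
  integrated without tracking which end points belong to them.\<close>

lemma has_integral_of_bool_interval:
  fixes a b :: real and P :: "real \<Rightarrow> bool"
  assumes "\<And>x. a < x \<Longrightarrow> x < b \<Longrightarrow> P x" "\<And>x. x \<in> {0..1} \<Longrightarrow> P x \<Longrightarrow> a \<le> x \<and> x \<le> b"
    and "0 \<le> a" "b \<le> 1"
  shows "((\<lambda>x. of_bool (P x)) has_integral (max 0 (b - a) :: real)) {0..1}"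
proof (cases "a \<le> b")
  case True
  have "((\<lambda>x. 1::real) has_integral (b - a)) {a..b}"
    using has_integral_const_real[of "1::real" a b] True by simp
  then have "((\<lambda>x. if x \<in> {a..b} then 1 else 0::real) has_integral (b - a)) {0..1}"
    using assms(3,4) by (subst has_integral_restrict) auto
  then have "((\<lambda>x. of_bool (P x)) has_integral (b - a)) {0..1}"
    by (rule has_integral_spike_finite[of "{a,b}", rotated 2]) (use assms in \<open>auto simp: less_le\<close>)
  then show ?thesis using True by simp
next
  case False
  then have "\<not> P x" if "x \<in> {0..1}" for x using assms(2)[OF that] by linarith
  then have "((\<lambda>x. of_bool (P x) :: real) has_integral 0) {0..1}"
    by (intro has_integral_is_0) auto
  then show ?thesis using False by simp
qed

text \<open>This is the autocorrelation of the indicator of [0,1), and so the proportion of shifts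
  for which two floors differ by a prescribed integer.\<close>

definition tent :: "real \<Rightarrow> real" where "tent t = max 0 (1 - \<bar>t\<bar>)"

lemma tent_nonneg: "0 \<le> tent t" and tent_minus: "tent (- t) = tent t"
  and tent_eq_0: "1 \<le> \<bar>t\<bar> \<Longrightarrow> tent t = 0" and tent_0: "tent 0 = 1"
  by (auto simp: tent_def)

lemma tent_le_of_bool: "tent t \<le> of_bool (\<bar>t\<bar> < 1)"
  by (auto simp: tent_def)

text \<open>Averaging over \<sigma> expresses the tent by sharp windows of length 1. For these
  windows pairs can be counted exactly with ceilings.\<close>

lemma has_integral_tent:
  "((\<lambda>\<sigma>. of_bool (- \<sigma> \<le> d \<and> d < 1 - \<sigma>)) has_integral tent d) {0..1}"
proof -
  have "max 0 (min 1 (1 - d) - max 0 (- d)) = tent d" unfolding tent_def by linarith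
  then show ?thesis
    using has_integral_of_bool_interval[of "max 0 (-d)" "min 1 (1 - d)" "\<lambda>\<sigma>. - \<sigma> \<le> d \<and> d < 1 - \<sigma>"]
    by (simp add: algebra_simps)
qed

text \<open>The exponent \<open>21/20\<close> in the last assumption only has to exceed \<open>30/29\<close> and be small enough for the bound
  \<open>M powr (9/10)\<close> of the sawtooth sums to beat \<open>M\<^sup>2 / h M\<close> by a power of \<open>M\<close>.\<close>

locale regvar =
  fixes h h' h'' \<kappa>' :: "real \<Rightarrow> real" and X e c C0 :: real
  assumes X1: "X \<ge> 1" and e: "0 < e" "e \<le> 1" and c: "c > 1" and C0: "C0 \<ge> 1"
    and dh: "t \<ge> X \<Longrightarrow> (h has_real_derivative h' t) (at t)"
    and dh': "t \<ge> X \<Longrightarrow> (h' has_real_derivative h'' t) (at t)"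
    and d\<kappa>: "t \<ge> X \<Longrightarrow> ((\<lambda>t. h'' t / (h' t)\<^sup>2) has_real_derivative \<kappa>' t) (at t)"
    and h'_lower: "t \<ge> X \<Longrightarrow> h t \<le> t * h' t" and h'_upper: "t \<ge> X \<Longrightarrow> t * h' t \<le> 2 * h t"
    and h''_lower: "t \<ge> X \<Longrightarrow> e * h t \<le> t\<^sup>2 * h'' t" and h''_upper: "t \<ge> X \<Longrightarrow> t\<^sup>2 * h'' t \<le> h t / e"
    and \<kappa>'_lower: "t \<ge> X \<Longrightarrow> e \<le> - \<kappa>' t * (t * h t)" and \<kappa>'_upper: "t \<ge> X \<Longrightarrow> - \<kappa>' t * (t * h t) \<le> 1 / e"
    and h_lower: "t \<ge> X \<Longrightarrow> t powr c \<le> h t" and h_upper: "t \<ge> X \<Longrightarrow> h t \<le> C0 * t powr (21/20)"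
begin

lemma h_ge_self: "t \<ge> X \<Longrightarrow> t \<le> h t"
  using h_lower[of t] powr_mono[of 1 c t] c X1 by simp

lemma h_pos: "t \<ge> X \<Longrightarrow> 0 < h t"
  using h_ge_self[of t] X1 by linarith

lemma h'_ge: "t \<ge> X \<Longrightarrow> h t / t \<le> h' t" and h'_le: "t \<ge> X \<Longrightarrow> h' t \<le> 2 * h t / t"
  using h'_lower[of t] h'_upper[of t] X1 by (auto simp: field_simps)

lemma h'_ge_1: assumes "t \<ge> X" shows "1 \<le> h' t"
proof -
  have "1 \<le> h t / t" using h_ge_self[OF assms] X1 assms by simp
  then show ?thesis using h'_ge[OF assms] by linarith
qed

lemma h''_nonneg: assumes "t \<ge> X" shows "0 \<le> h'' t"
proof -
  have "0 < e * h t" using e h_pos[OF assms] by simp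
  then have "0 < t\<^sup>2 * h'' t" using h''_lower[OF assms] by linarith
  then show ?thesis by (simp add: zero_less_mult_iff)
qed

lemma MVT_h:
  assumes "X \<le> s" "s < t"
  obtains \<xi> where "s < \<xi>" "\<xi> < t" "h t - h s = (t - s) * h' \<xi>"
proof -
  have "\<exists>z>s. z < t \<and> h t - h s = (t - s) * h' z"
    by (rule MVT2) (use assms dh in auto)
  then show ?thesis using that by blast
qed

lemma h_strict_mono: assumes "X \<le> s" "s < t" shows "h s < h t"
proof -
  obtain \<xi> where "s < \<xi>" "\<xi> < t" "h t - h s = (t - s) * h' \<xi>" using MVT_h[OF assms] by blast
  moreover have "1 \<le> h' \<xi>" using h'_ge_1 calculation assms by simp
  moreover have "0 < (t - s) * h' \<xi>" using calculation assms by (intro mult_pos_pos) auto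
  ultimately show ?thesis by linarith
qed

lemma h_less_iff: "X \<le> s \<Longrightarrow> X \<le> t \<Longrightarrow> h s < h t \<longleftrightarrow> s < t"
  using h_strict_mono[of s t] h_strict_mono[of t s] by (cases s t rule: linorder_cases) auto

lemma h_le_iff: "X \<le> s \<Longrightarrow> X \<le> t \<Longrightarrow> h s \<le> h t \<longleftrightarrow> s \<le> t"
  using h_less_iff[of t s] by auto

lemma h'_mono: assumes "X \<le> s" "s \<le> t" shows "h' s \<le> h' t"
  using assms(2)
  by (rule DERIV_nonneg_imp_nondecreasing) (use assms dh' h''_nonneg in \<open>meson order_trans\<close>)

text \<open>The inverse is taken on [X, \<infinity>), where the derivative bounds hold. For
  arguments at least h X it agrees with the inverse on the full domain, as the final theorem
  checks.\<close>

definition \<phi> :: "real \<Rightarrow> real" where "\<phi> = the_inv_into {X..} h"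

lemma inj_h: "inj_on h {X..}"
  by (rule linorder_inj_onI) (use h_strict_mono in force)+

lemma \<phi>_h: "X \<le> t \<Longrightarrow> \<phi> (h t) = t"
  unfolding \<phi>_def by (rule the_inv_into_f_f[OF inj_h]) auto

lemma h_image: "h ` {X..} = {h X..}"
proof
  show "h ` {X..} \<subseteq> {h X..}" using h_le_iff by auto
  show "{h X..} \<subseteq> h ` {X..}"
  proof
    fix b assume b: "b \<in> {h X..}"
    have "X \<le> h X" using h_ge_self by simp
    then have "X \<le> b" "b \<le> h b" using b h_ge_self[of b] by auto
    then have "\<exists>t. X \<le> t \<and> t \<le> b \<and> h t = b"
      by (intro IVT) (use b dh DERIV_isCont in auto)
    then show "b \<in> h ` {X..}" by auto
  qed
qed

lemma \<phi>_props: assumes "h X \<le> b" shows "X \<le> \<phi> b" "h (\<phi> b) = b"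
proof -
  have "b \<in> h ` {X..}" using h_image assms by auto
  then obtain t where "X \<le> t" "b = h t" by auto
  then show "X \<le> \<phi> b" "h (\<phi> b) = b" using \<phi>_h by auto
qed

lemma less_\<phi>_iff: "h X \<le> b \<Longrightarrow> X \<le> t \<Longrightarrow> t < \<phi> b \<longleftrightarrow> h t < b"
  using h_less_iff[of t "\<phi> b"] \<phi>_props[of b] by auto

lemma \<phi>_mono: "h X \<le> b \<Longrightarrow> b \<le> b' \<Longrightarrow> \<phi> b \<le> \<phi> b'"
  using h_le_iff[of "\<phi> b" "\<phi> b'"] \<phi>_props[of b] \<phi>_props[of b'] by auto

lemma h_gap: assumes "X \<le> s" "s \<le> t" shows "(t - s) * h' s \<le> h t - h s" "h t - h s \<le> (t - s) * h' t"
proof -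
  have "(t - s) * h' s \<le> h t - h s \<and> h t - h s \<le> (t - s) * h' t"
  proof (cases "s = t")
    case False
    then obtain \<xi> where \<xi>: "s < \<xi>" "\<xi> < t" "h t - h s = (t - s) * h' \<xi>"
      using MVT_h[of s t] assms by auto
    have "h' s \<le> h' \<xi>" "h' \<xi> \<le> h' t" using h'_mono \<xi> assms by auto
    then show ?thesis using \<xi> assms by (auto intro!: mult_left_mono)
  qed auto
  then show "(t - s) * h' s \<le> h t - h s" "h t - h s \<le> (t - s) * h' t" by auto
qed

lemma \<phi>_gap: assumes "h X \<le> b" "b \<le> b'" 
  shows "\<phi> b' - \<phi> b \<le> (b' - b) / h' (\<phi> b)" "(b' - b) / h' (\<phi> b') \<le> \<phi> b' - \<phi> b"
proof -
  have X: "X \<le> \<phi> b" "\<phi> b \<le> \<phi> b'" "h (\<phi> b) = b" "h (\<phi> b') = b'"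
    using \<phi>_props \<phi>_mono assms by auto
  have p: "0 < h' (\<phi> b)" "0 < h' (\<phi> b')" using h'_ge_1[of "\<phi> b"] h'_ge_1[of "\<phi> b'"] X by auto
  show "\<phi> b' - \<phi> b \<le> (b' - b) / h' (\<phi> b)" "(b' - b) / h' (\<phi> b') \<le> \<phi> b' - \<phi> b"
    using h_gap[OF X(1,2)] p X by (auto simp: field_simps)
qed

lemma \<phi>_lipschitz: assumes "h X \<le> b" "b \<le> b'" shows "\<phi> b' - \<phi> b \<le> b' - b"
proof -
  have "1 \<le> h' (\<phi> b)" using h'_ge_1 \<phi>_props assms by auto
  then have "(b' - b) / h' (\<phi> b) \<le> (b' - b) / 1" using assms by (intro divide_left_mono) auto
  then show ?thesis using \<phi>_gap[OF assms] by simp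
qed

lemma DERIV_\<phi>: assumes "h X < b" shows "(\<phi> has_real_derivative 1 / h' (\<phi> b)) (at b)"
proof -
  have cont: "isCont \<phi> b"
  proof -
    have "continuous_on {h X..} \<phi>"
    proof (rule continuous_onI)
      fix x \<epsilon> :: real assume x: "x \<in> {h X..}" "0 < \<epsilon>"
      show "\<exists>d>0. \<forall>x'\<in>{h X..}. dist x' x < d \<longrightarrow> dist (\<phi> x') (\<phi> x) \<le> \<epsilon>"
      proof (intro exI[of _ \<epsilon>] conjI ballI impI)
        fix x' assume "x' \<in> {h X..}" "dist x' x < \<epsilon>"
        then show "dist (\<phi> x') (\<phi> x) \<le> \<epsilon>"
          using \<phi>_lipschitz[of x x'] \<phi>_lipschitz[of x' x] \<phi>_mono[of x x'] \<phi>_mono[of x' x] x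
          by (cases "x \<le> x'") (auto simp: dist_real_def)
      qed (use x in auto)
    qed
    then show ?thesis using assms
      by (auto intro: continuous_on_interior simp: interior_real_atLeast)
  qed
  have "DERIV \<phi> b :> inverse (h' (\<phi> b))"
    by (rule DERIV_inverse_function[where f = h and a = "h X" and b = "b + 1"])
       (use assms cont \<phi>_props[of b] dh[of "\<phi> b"] h'_ge_1[of "\<phi> b"] \<phi>_props in auto)
  then show ?thesis by (simp add: inverse_eq_divide)
qed

end

section \<open>Sizes of \<open>h\<close> and its derivatives on one dyadic block\<close>

locale regvar_scale = regvar +
  fixes M :: nat
  assumes MX: "X < real M" and M2: "2 \<le> M"
begin

definition D :: real where "D = h (real M)"

lemma M_pos: "0 < real M" using M2 by simp

lemma D_ge_M: "real M \<le> D" unfolding D_def using h_ge_self MX by simp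

lemma D_pos: "0 < D" using D_ge_M M_pos by linarith

text \<open>The bounds h t \<le> t h' t \<le> 2 h t say that h t / t increases and h t / t^2
  decreases, so doubling the argument multiplies h by a factor between 2 and 4.\<close>

lemma h_dyadic: assumes "real M \<le> t" "t \<le> 2 * real M" shows "D \<le> h t" "h t \<le> 4 * D"
    "h t / t \<le> 2 * D / real M" "2 * D \<le> h (2 * real M)"
proof -
  show "D \<le> h t" unfolding D_def using h_le_iff assms MX by simp
  have up: "h b / b\<^sup>2 \<le> h a / a\<^sup>2" "h a / a \<le> h b / b" if "real M \<le> a" "a \<le> b" for a b
  proof -
    have X: "X \<le> x" "0 < x" if "a \<le> x" for x using that \<open>real M \<le> a\<close> MX M_pos by auto
    show "h b / b\<^sup>2 \<le> h a / a\<^sup>2"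
    proof (rule DERIV_nonpos_imp_nonincreasing[OF that(2)])
      fix x assume x: "a \<le> x" "x \<le> b"
      have "((\<lambda>t. h t / t\<^sup>2) has_real_derivative (h' x * x\<^sup>2 - h x * (2 * x)) / (x\<^sup>2 * x\<^sup>2)) (at x)"
        by (rule derivative_eq_intros dh refl | use X[OF x(1)] in simp)+
      moreover have "h' x * x\<^sup>2 - h x * (2 * x) = x * (x * h' x - 2 * h x)"
        by (simp add: algebra_simps power2_eq_square)
      moreover have "x * (x * h' x - 2 * h x) \<le> 0"
        using h'_upper[OF X(1)[OF x(1)]] X(2)[OF x(1)] by (intro mult_nonneg_nonpos) auto
      ultimately show "\<exists>y. ((\<lambda>t. h t / t\<^sup>2) has_real_derivative y) (at x) \<and> y \<le> 0"
        by (metis divide_nonpos_nonneg zero_le_square)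
    qed
    show "h a / a \<le> h b / b"
    proof (rule DERIV_nonneg_imp_nondecreasing[OF that(2)])
      fix x assume x: "a \<le> x" "x \<le> b"
      have "((\<lambda>t. h t / t) has_real_derivative (h' x * x - h x * 1) / (x * x)) (at x)"
        by (rule derivative_eq_intros dh refl | use X[OF x(1)] in simp)+
      moreover have "0 \<le> h' x * x - h x * 1"
        using h'_lower[OF X(1)[OF x(1)]] by (simp add: mult.commute)
      ultimately show "\<exists>y. ((\<lambda>t. h t / t) has_real_derivative y) (at x) \<and> 0 \<le> y"
        by (metis divide_nonneg_nonneg zero_le_square)
    qed
  qed
  have t: "0 < t" using assms M_pos by linarith
  have "h t / t\<^sup>2 \<le> D / (real M)\<^sup>2" unfolding D_def using up(1) assms by simp
  then have "h t \<le> D / (real M)\<^sup>2 * t\<^sup>2" using t by (simp add: pos_divide_le_eq)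
  also have "\<dots> \<le> D / (real M)\<^sup>2 * (2 * real M)\<^sup>2"
    using assms t D_pos by (intro mult_left_mono power_mono) auto
  finally show h4: "h t \<le> 4 * D" using M_pos by (simp add: power2_eq_square)
  have "h t / t\<^sup>2 * t \<le> D / (real M)\<^sup>2 * t" using \<open>h t / t\<^sup>2 \<le> D / (real M)\<^sup>2\<close> t by (intro mult_right_mono) auto
  also have "\<dots> \<le> D / (real M)\<^sup>2 * (2 * real M)" using assms D_pos by (intro mult_left_mono) auto
  finally show "h t / t \<le> 2 * D / real M" using M_pos t by (simp add: power2_eq_square mult.commute)
  have "D / real M \<le> h (2 * real M) / (2 * real M)" unfolding D_def using up(2) M_pos by simp
  then show "2 * D \<le> h (2 * real M)" using M_pos by (simp add: field_simps)
qed

lemma h'_dyadic_lower: assumes "real M \<le> t" shows "D / real M \<le> h' t"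
proof -
  have "D / real M \<le> h' (real M)" unfolding D_def using h'_ge MX by simp
  also have "\<dots> \<le> h' t" using h'_mono assms MX by simp
  finally show ?thesis .
qed

lemma h'_dyadic_upper: assumes "real M \<le> t" "t \<le> 2 * real M" shows "h' t \<le> 4 * D / real M"
proof -
  have "h' t \<le> 2 * (h t / t)" using h'_le assms MX by simp
  also have "\<dots> \<le> 2 * (2 * D / real M)" using h_dyadic[OF assms] by (intro mult_left_mono) auto
  finally show ?thesis by simp
qed

lemma h''_dyadic: assumes "real M \<le> t" "t \<le> 2 * real M"
  shows "e * D / (4 * (real M)\<^sup>2) \<le> h'' t" "h'' t \<le> 4 * D / (e * (real M)\<^sup>2)"
proof -
  have t: "X \<le> t" "0 < t" using assms MX M_pos by auto
  have nn: "0 \<le> h'' t" using h''_nonneg t by simp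
  have "e * D \<le> e * h t" using e h_dyadic[OF assms] by (intro mult_left_mono) auto
  also have "\<dots> \<le> t\<^sup>2 * h'' t" using h''_lower t by simp
  also have "\<dots> \<le> (2 * real M)\<^sup>2 * h'' t" using assms t nn by (intro mult_right_mono power_mono) auto
  finally show "e * D / (4 * (real M)\<^sup>2) \<le> h'' t" using M_pos by (simp add: field_simps)
  have "(real M)\<^sup>2 * h'' t \<le> t\<^sup>2 * h'' t" using assms t nn by (intro mult_right_mono power_mono) auto
  also have "\<dots> \<le> h t / e" using h''_upper t by simp
  also have "\<dots> \<le> 4 * D / e" using h_dyadic[OF assms] e by (intro divide_right_mono) auto
  finally show "h'' t \<le> 4 * D / (e * (real M)\<^sup>2)" using M_pos e by (simp add: field_simps)
qed

lemma \<kappa>'_dyadic: assumes "real M \<le> t" "t \<le> 2 * real M"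
  shows "e / (8 * real M * D) \<le> - \<kappa>' t" "- \<kappa>' t \<le> 1 / (e * real M * D)"
proof -
  have t: "X \<le> t" "0 < t" using assms MX M_pos by auto
  have th: "0 < t * h t" using t h_pos by simp
  have lo: "e \<le> - \<kappa>' t * (t * h t)" using \<kappa>'_lower t by simp
  then have nn: "0 \<le> - \<kappa>' t" using e th by (smt (verit) mult_nonneg_nonneg mult_minus_left mult_nonpos_nonneg)
  have "t * h t \<le> (2 * real M) * (4 * D)" using assms h_dyadic[OF assms] h_pos t by (intro mult_mono) auto
  then have "- \<kappa>' t * (t * h t) \<le> - \<kappa>' t * ((2 * real M) * (4 * D))" using nn by (rule mult_left_mono)
  then have "e \<le> - \<kappa>' t * (8 * real M * D)" using lo by (simp add: mult_ac)
  then show "e / (8 * real M * D) \<le> - \<kappa>' t" using M_pos D_pos by (simp add: pos_divide_le_eq)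
  have "real M * D \<le> t * h t" using assms h_dyadic[OF assms] D_pos t by (intro mult_mono) auto
  then have "- \<kappa>' t * (real M * D) \<le> - \<kappa>' t * (t * h t)" using nn by (rule mult_left_mono)
  also have "\<dots> \<le> 1 / e" using \<kappa>'_upper t by simp
  finally have "- \<kappa>' t * (real M * D) \<le> 1 / e" .
  then have "- \<kappa>' t \<le> (1 / e) / (real M * D)" using M_pos D_pos by (subst pos_le_divide_eq) auto
  then show "- \<kappa>' t \<le> 1 / (e * real M * D)" by (simp add: mult.assoc)
qed

end

section \<open>The kernel of the square function\<close>

context regvar_scale begin

abbreviation P :: "nat set" where "P \<equiv> {M..<2*M}"

text \<open>The weight of a pair is the average over \<tau> of the indicator that \<lfloor>h p +
  \<tau>\<rfloor> - \<lfloor>h q + \<tau>\<rfloor> = z; see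
  \<open>has_integral_floor_difference\<close>.\<close>

definition K :: "int \<Rightarrow> real" where
  "K z = (\<Sum>p\<in>P. \<Sum>q\<in>P. tent (h p - h q - z)) / (real M)\<^sup>2"

text \<open>The cap discards the p beyond the end of the block. The lower end M is respected
  automatically, because the arguments that occur are at least D = h M.\<close>

definition \<Phi> :: "real \<Rightarrow> real" where "\<Phi> b = min (2 * real M) (\<phi> b)"

text \<open>\<open>w y\<close> is the number of pairs with \<open>y \<le> h p - h q < y + 1\<close> when the integer variable \<open>p\<close> is replaced
  by a continuous one.\<close>

definition w :: "real \<Rightarrow> real" where
  "w y = (\<Sum>q\<in>P. \<Phi> (h q + y + 1) - \<Phi> (h q + y))"

text \<open>The modulus exploits the symmetry of \<open>K\<close>: \<open>w\<close> is controlled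
  only for nonnegative arguments, where h q + y stays above D.\<close>

definition G :: "int \<Rightarrow> real" where "G z = w \<bar>real_of_int z\<bar> / (real M)\<^sup>2"

lemma P_bounds: "q \<in> P \<Longrightarrow> real M \<le> real q" "q \<in> P \<Longrightarrow> real q + 1 \<le> 2 * real M"
  by auto

lemma P_X: "q \<in> P \<Longrightarrow> X \<le> real q"
  using P_bounds[of q] MX by linarith

lemma hX_less_D: "h X < D"
  unfolding D_def using h_strict_mono MX by simp

lemma D_le_h: "q \<in> P \<Longrightarrow> D \<le> h q"
  using h_dyadic(1)[of q] P_bounds[of q] by simp

lemma h2M: "h (2 * real M) \<le> 4 * D" using h_dyadic(2)[of "2 * real M"] by simp

lemma M_le_\<phi>: "D \<le> b \<Longrightarrow> real M \<le> \<phi> b"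
  using \<phi>_mono[of D b] \<phi>_h[of M] hX_less_D MX unfolding D_def by simp

lemma \<phi>_le_2M_iff: "D \<le> b \<Longrightarrow> \<phi> b \<le> 2 * real M \<longleftrightarrow> b \<le> h (2 * real M)"
  using less_\<phi>_iff[of b "2 * real M"] hX_less_D MX by (auto simp: not_less[symmetric])

lemma \<phi>_gap_dyadic: assumes "D \<le> b" "b \<le> b'" shows "\<phi> b' - \<phi> b \<le> (b' - b) * real M / D"
proof -
  have "0 < D / real M" "D / real M \<le> h' (\<phi> b)"
    using h'_dyadic_lower M_le_\<phi> assms D_pos M_pos by auto
  then have "(b' - b) / h' (\<phi> b) \<le> (b' - b) / (D / real M)"
    using assms by (intro divide_left_mono mult_pos_pos) auto
  then show ?thesis using \<phi>_gap(1)[of b b'] assms hX_less_D by simp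
qed

lemma \<Phi>_mono: "D \<le> b \<Longrightarrow> b \<le> b' \<Longrightarrow> \<Phi> b \<le> \<Phi> b'"
  unfolding \<Phi>_def using \<phi>_mono[of b b'] hX_less_D by auto

lemma \<Phi>_gap: assumes "D \<le> b" "b \<le> b'" shows "\<Phi> b' - \<Phi> b \<le> (b' - b) * real M / D"
proof -
  have "\<Phi> b' - \<Phi> b \<le> \<phi> b' - \<phi> b"
    unfolding \<Phi>_def using \<phi>_mono[of b b'] hX_less_D assms by auto
  then show ?thesis using \<phi>_gap_dyadic[OF assms] by linarith
qed

lemma \<Phi>_eq_2M: "h (2 * real M) \<le> b \<Longrightarrow> \<Phi> b = 2 * real M"
  unfolding \<Phi>_def using \<phi>_mono[of "h (2 * real M)" b] \<phi>_h[of "2 * real M"] MX h_le_iff[of X "2 * real M"] by auto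

lemma M_le_\<Phi>: "D \<le> b \<Longrightarrow> real M \<le> \<Phi> b"
  unfolding \<Phi>_def using M_le_\<phi> by simp

lemma w_bounds: assumes "0 \<le> y" shows "0 \<le> w y" "w y \<le> (real M)\<^sup>2 / D"
proof -
  have D: "D \<le> h q + y" if "q \<in> P" for q using D_le_h[OF that] assms by simp
  show "0 \<le> w y" unfolding w_def using \<Phi>_mono D by (intro sum_nonneg) auto
  have "\<Phi> (h q + y + 1) - \<Phi> (h q + y) \<le> real M / D" if "q \<in> P" for q
    using \<Phi>_gap[OF D[OF that], of "h q + y + 1"] by simp
  then have "w y \<le> (\<Sum>q\<in>P. real M / D)" unfolding w_def by (intro sum_mono) auto
  then show "w y \<le> (real M)\<^sup>2 / D" by (simp add: power2_eq_square)
qed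

text \<open>This is the Lipschitz bound for the derivative of \<open>\<phi>\<close>: the derivative
  of 1/h' is of size h'' / h'^2, at most 4/(e D), and \<phi> itself has Lipschitz constant
  M/D.\<close>

lemma inverse_slope_gap:
  assumes "D \<le> b" "b \<le> b'" "b' \<le> h (2 * real M)"
  shows "\<bar>1 / h' (\<phi> b) - 1 / h' (\<phi> b')\<bar> \<le> 4 / e * (real M / D\<^sup>2) * (b' - b)"
proof -
  define s t where "s = \<phi> b" and "t = \<phi> b'"
  have st: "real M \<le> s" "s \<le> t" "t \<le> 2 * real M"
    unfolding s_def t_def using assms M_le_\<phi> \<phi>_mono hX_less_D \<phi>_le_2M_iff by auto
  have "\<bar>1 / h' s - 1 / h' t\<bar> \<le> 4 / (e * D) * (t - s)"
  proof (cases "s = t")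
    case False
    have "\<exists>z>s. z < t \<and> 1 / h' t - 1 / h' s = (t - s) * (- h'' z / (h' z)\<^sup>2)"
    proof (rule MVT2)
      fix x assume "s \<le> x" "x \<le> t"
      then have x: "X \<le> x" using st MX by simp
      then have "h' x \<noteq> 0" using h'_ge_1[of x] by simp
      then show "((\<lambda>x. 1 / h' x) has_real_derivative - h'' x / (h' x)\<^sup>2) (at x)"
        by (auto intro!: derivative_eq_intros dh'[OF x] simp: power2_eq_square)
    qed (use False st in auto)
    then obtain z where z: "s < z" "z < t" "1 / h' t - 1 / h' s = (t - s) * (- h'' z / (h' z)\<^sup>2)" by blast
    have zM: "real M \<le> z" "z \<le> 2 * real M" using z st by auto
    have "h'' z / (h' z)\<^sup>2 \<le> (4 * D / (e * (real M)\<^sup>2)) / (D / real M)\<^sup>2"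
      using h''_dyadic[OF zM] h'_dyadic_lower[OF zM(1)] D_pos M_pos e h''_nonneg[of z] zM MX
      by (intro frac_le power_mono) auto
    also have "\<dots> = 4 / (e * D)" using D_pos M_pos e by (simp add: field_simps power2_eq_square)
    finally have "h'' z / (h' z)\<^sup>2 \<le> 4 / (e * D)" .
    moreover have "0 \<le> h'' z / (h' z)\<^sup>2" using h''_nonneg[of z] zM MX by simp
    moreover have "1 / h' s - 1 / h' t = (h'' z / (h' z)\<^sup>2) * (t - s)" using z(3) by (simp add: algebra_simps)
    then have "\<bar>1 / h' s - 1 / h' t\<bar> = (h'' z / (h' z)\<^sup>2) * (t - s)"
      using calculation(2) st by (simp only: abs_mult abs_of_nonneg diff_ge_0_iff_ge)
    ultimately show ?thesis using st by (metis mult_right_mono diff_ge_0_iff_ge)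
  qed auto
  also have "\<dots> \<le> 4 / (e * D) * ((b' - b) * real M / D)"
    using \<phi>_gap_dyadic[OF assms(1,2)] e D_pos unfolding s_def t_def by (intro mult_left_mono) auto
  also have "\<dots> = 4 / e * (real M / D\<^sup>2) * (b' - b)" by (simp add: power2_eq_square mult_ac)
  finally show ?thesis unfolding s_def t_def .
qed

lemma \<phi>_second_difference:
  assumes "D \<le> b" "b \<le> b'" "b' + 1 \<le> h (2 * real M)"
  shows "\<bar>(\<phi> (b + 1) - \<phi> b) - (\<phi> (b' + 1) - \<phi> b')\<bar> \<le> 4 / e * (real M / D\<^sup>2) * (b' - b + 1)"
proof -
  have mvt: "\<exists>z>x. z < x + 1 \<and> \<phi> (x + 1) - \<phi> x = (x + 1 - x) * (1 / h' (\<phi> z))" if "D \<le> x" for x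
    by (rule MVT2) (use that hX_less_D in \<open>auto intro!: DERIV_\<phi>\<close>)
  obtain z where z: "b < z" "z < b + 1" "\<phi> (b + 1) - \<phi> b = 1 / h' (\<phi> z)" using mvt[of b] assms by auto
  obtain z' where z': "b' < z'" "z' < b' + 1" "\<phi> (b' + 1) - \<phi> b' = 1 / h' (\<phi> z')" using mvt[of b'] assms by auto
  have "\<bar>1 / h' (\<phi> z) - 1 / h' (\<phi> z')\<bar> \<le> 4 / e * (real M / D\<^sup>2) * \<bar>z' - z\<bar>"
    using inverse_slope_gap[of z z'] inverse_slope_gap[of z' z] z z' assms
    by (cases "z \<le> z'") (auto simp: abs_minus_commute)
  also have "\<dots> \<le> 4 / e * (real M / D\<^sup>2) * (b' - b + 1)"
    using z z' assms e D_pos by (intro mult_left_mono) auto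
  finally show ?thesis using z z' by simp
qed

text \<open>If both windows end below the cap h (2 M), a summand changes by a second difference of
  \<phi>; if both lie beyond it, the summand vanishes twice. The transitional q form the set
  \<open>T\<close> of at most (y' - y + 1) M/D + 1 elements, each costing M/D. The last +1 produces
  the term M/D that does not shrink with y' - y.\<close>

lemma w_lipschitz_ordered:
  assumes "0 \<le> y" "y \<le> y'"
  shows "\<bar>w y - w y'\<bar> \<le> (4 / e + 1) * (real M / D)\<^sup>2 * (y' - y + 1) + real M / D"
proof -
  define T where "T = {q \<in> P. h (2 * real M) - y' - 1 < h q \<and> h q < h (2 * real M) - y}"
  define A where "A = 4 / e * (real M / D\<^sup>2) * (y' - y + 1)"
  have A0: "0 \<le> A" unfolding A_def using e D_pos assms by simp
  have tm: "\<bar>(\<Phi> (h q + y + 1) - \<Phi> (h q + y)) - (\<Phi> (h q + y' + 1) - \<Phi> (h q + y'))\<bar> \<le>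
      A + real M / D * of_bool (q \<in> T)" if q: "q \<in> P" for q
  proof -
    let ?b = "h q + y" and ?b' = "h q + y'"
    have D: "D \<le> ?b" "D \<le> ?b'" "?b \<le> ?b'" using D_le_h[OF q] assms by auto
    consider "?b' + 1 \<le> h (2 * real M)" | "h (2 * real M) \<le> ?b" | "q \<in> T"
      using q unfolding T_def by force
    then show ?thesis
    proof cases
      case 1
      then have "\<Phi> (?b' + 1) = \<phi> (?b' + 1)" "\<Phi> ?b' = \<phi> ?b'" "\<Phi> (?b + 1) = \<phi> (?b + 1)" "\<Phi> ?b = \<phi> ?b"
        unfolding \<Phi>_def using \<phi>_le_2M_iff D by auto
      then show ?thesis
        using \<phi>_second_difference[OF D(1,3) 1] D_pos by (simp add: A_def add_increasing2)
    next
      case 2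
      then have "\<Phi> (?b' + 1) = 2 * real M" "\<Phi> ?b' = 2 * real M" "\<Phi> (?b + 1) = 2 * real M" "\<Phi> ?b = 2 * real M"
        using D by (auto intro!: \<Phi>_eq_2M)
      then show ?thesis using A0 D_pos by simp
    next
      case 3
      have "0 \<le> \<Phi> (?b + 1) - \<Phi> ?b" "0 \<le> \<Phi> (?b' + 1) - \<Phi> ?b'" using \<Phi>_mono D by auto
      moreover have "\<Phi> (?b + 1) - \<Phi> ?b \<le> real M / D" "\<Phi> (?b' + 1) - \<Phi> ?b' \<le> real M / D"
        using \<Phi>_gap[of ?b "?b + 1"] \<Phi>_gap[of ?b' "?b' + 1"] D by auto
      ultimately show ?thesis using A0 3 by simp
    qed
  qed
  have T: "real (card T) \<le> (y' - y + 1) * (real M / D) + 1"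
  proof (rule card_nat_spread_le(2))
    show "0 \<le> (y' - y + 1) * (real M / D)" using assms D_pos by simp
    fix p q assume pq: "p \<in> T" "q \<in> T"
    then have "h p - h q \<le> y' - y + 1" by (auto simp: T_def)
    show "real p - real q \<le> (y' - y + 1) * (real M / D)"
    proof (cases "q \<le> p")
      case True
      have qP: "q \<in> P" using pq by (auto simp: T_def)
      have "(real p - real q) * (D / real M) \<le> (real p - real q) * h' q"
        using True h'_dyadic_lower P_bounds[OF qP] by (intro mult_left_mono) auto
      also have "\<dots> \<le> h p - h q" using h_gap(1)[of q p] P_X[OF qP] True by simp
      also note \<open>h p - h q \<le> y' - y + 1\<close>
      finally show ?thesis using D_pos M_pos by (simp add: field_simps)
    next
      case False
      then have "real p - real q \<le> 0" by simp
      also have "0 \<le> (y' - y + 1) * (real M / D)" using assms D_pos by simp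
      finally show ?thesis .
    qed
  qed
  have fT: "finite T" "T \<subseteq> P" unfolding T_def by auto
  have "\<bar>w y - w y'\<bar> \<le> (\<Sum>q\<in>P. A + real M / D * of_bool (q \<in> T))"
    unfolding w_def sum_subtractf[symmetric] by (rule order_trans[OF sum_abs sum_mono]) (use tm in auto)
  also have "\<dots> = real M * A + real M / D * real (card T)"
  proof -
    have "(\<Sum>q\<in>P. of_bool (q \<in> T) :: real) = real (card (P \<inter> T))" by (simp add: Int_def)
    moreover have "P \<inter> T = T" using fT by blast
    ultimately have "(\<Sum>q\<in>P. real M / D * of_bool (q \<in> T)) = real M / D * real (card T)"
      by (simp only: sum_distrib_left[symmetric])
    then show ?thesis by (simp add: sum.distrib)
  qed
  also have "\<dots> \<le> real M * A + real M / D * ((y' - y + 1) * (real M / D) + 1)"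
    using T D_pos by (intro add_left_mono mult_left_mono) auto
  also have "\<dots> = (4 / e + 1) * (real M / D)\<^sup>2 * (y' - y + 1) + real M / D"
    unfolding A_def using D_pos e by (simp add: field_simps power2_eq_square)
  finally show ?thesis .
qed

lemma w_lipschitz:
  assumes "0 \<le> y" "0 \<le> y'"
  shows "\<bar>w y - w y'\<bar> \<le> (4 / e + 1) * (real M / D)\<^sup>2 * (\<bar>y - y'\<bar> + 1) + real M / D"
  using w_lipschitz_ordered[of y y'] w_lipschitz_ordered[of y' y] assms
  by (cases "y \<le> y'") (auto simp: abs_minus_commute)

lemma G_lipschitz:
  "\<bar>G z - G z'\<bar> \<le> 2 * (4 / e + 1) * (real_of_int \<bar>z - z'\<bar> / D\<^sup>2) + 1 / (real M * D)"
proof (cases "z = z'")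
  case False
  \<comment> \<open>Distinct integers differ by at least 1, which absorbs the additive 1 of
    \<open>w_lipschitz\<close> into a factor 2.\<close>
  then have d1: "1 \<le> real_of_int \<bar>z - z'\<bar>" by linarith
  have tri: "\<bar>\<bar>real_of_int z\<bar> - \<bar>real_of_int z'\<bar>\<bar> + 1 \<le> 2 * real_of_int \<bar>z - z'\<bar>"
    using d1 by (simp add: abs_if split: if_splits)
  have "\<bar>G z - G z'\<bar> = \<bar>w \<bar>real_of_int z\<bar> - w \<bar>real_of_int z'\<bar>\<bar> / (real M)\<^sup>2"
    unfolding G_def by (simp add: diff_divide_distrib[symmetric])
  also have "\<dots> \<le> ((4 / e + 1) * (real M / D)\<^sup>2 * (2 * real_of_int \<bar>z - z'\<bar>) + real M / D) / (real M)\<^sup>2"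
  proof (rule divide_right_mono)
    have "(4 / e + 1) * (real M / D)\<^sup>2 * (\<bar>\<bar>real_of_int z\<bar> - \<bar>real_of_int z'\<bar>\<bar> + 1) \<le>
        (4 / e + 1) * (real M / D)\<^sup>2 * (2 * real_of_int \<bar>z - z'\<bar>)"
      using tri e by (intro mult_left_mono) auto
    then show "\<bar>w \<bar>real_of_int z\<bar> - w \<bar>real_of_int z'\<bar>\<bar> \<le> (4 / e + 1) * (real M / D)\<^sup>2 * (2 * real_of_int \<bar>z - z'\<bar>) + real M / D"
      using w_lipschitz[of "\<bar>real_of_int z\<bar>" "\<bar>real_of_int z'\<bar>"] by linarith
  qed simp
  also have "\<dots> = 2 * (4 / e + 1) * (real_of_int \<bar>z - z'\<bar> / D\<^sup>2) + 1 / (real M * D)"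
    using M_pos D_pos by (simp add: field_simps power2_eq_square)
  finally show ?thesis .
qed (use D_pos in auto)

lemma G_bounds: "0 \<le> G z" "G z \<le> 1 / D"
  using w_bounds[of "\<bar>real_of_int z\<bar>"] M_pos D_pos unfolding G_def
  by (auto simp: field_simps)

lemma G_eq_0: assumes "4 * D \<le> \<bar>real_of_int z\<bar>" shows "G z = 0"
proof -
  have "\<Phi> (h q + \<bar>real_of_int z\<bar> + 1) - \<Phi> (h q + \<bar>real_of_int z\<bar>) = 0" if "q \<in> P" for q
    using D_le_h[OF that] h2M D_pos assms by (subst (1 2) \<Phi>_eq_2M) auto
  then have "w \<bar>real_of_int z\<bar> = 0" unfolding w_def by (intro sum.neutral) auto
  then show ?thesis unfolding G_def by simp
qed

section \<open>The kernel at and near the origin\<close>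

lemma K_minus: "K (- z) = K z"
proof -
  have "(\<Sum>p\<in>P. \<Sum>q\<in>P. tent (h p - h q - real_of_int (- z))) = (\<Sum>p\<in>P. \<Sum>q\<in>P. tent (h q - h p - real_of_int z))"
    by (intro sum.cong refl) (subst tent_minus[symmetric], simp)
  also have "\<dots> = (\<Sum>p\<in>P. \<Sum>q\<in>P. tent (h p - h q - real_of_int z))" by (rule sum.swap)
  finally show ?thesis unfolding K_def by simp
qed

lemma h_separated: assumes "p \<in> P" "q \<in> P" "p \<noteq> q" shows "1 \<le> \<bar>h p - h q\<bar>"
proof -
  have *: "1 \<le> h t - h s" if "s \<in> P" "t \<in> P" "s < t" for s t :: nat
  proof -
    have "1 * 1 \<le> (real t - real s) * h' s"
      using that P_X[OF that(1)] h'_ge_1 by (intro mult_mono) auto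
    then show ?thesis using h_gap(1)[of s t] P_X[OF that(1)] that by simp
  qed
  show ?thesis using *[of p q] *[of q p] assms by (cases "p < q") auto
qed

text \<open>Since h' is at least 1, distinct values of h are at distance at least 1, where the tent
  vanishes. Only the M diagonal pairs remain.\<close>

lemma K_0: "K 0 = 1 / real M"
proof -
  have "tent (h p - h q - 0) = of_bool (p = q)" if "p \<in> P" "q \<in> P" for p q
    using h_separated[OF that] by (cases "p = q") (auto simp: tent_0 tent_eq_0)
  then have "(\<Sum>p\<in>P. \<Sum>q\<in>P. tent (h p - h q - 0)) = (\<Sum>p\<in>P. \<Sum>q\<in>P. of_bool (p = q))"
    by (intro sum.cong) auto
  also have "\<dots> = real M" by (simp add: of_bool_def sum.delta)
  finally show ?thesis unfolding K_def using M_pos by (simp add: power2_eq_square)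
qed

lemma K_nonneg: "0 \<le> K z"
  unfolding K_def by (intro divide_nonneg_nonneg sum_nonneg tent_nonneg) auto

lemma K_eq_0: assumes "4 * D \<le> \<bar>real_of_int z\<bar>" shows "K z = 0"
proof -
  have "tent (h p - h q - z) = 0" if pq: "p \<in> P" "q \<in> P" for p q
  proof (rule tent_eq_0)
    have "h p \<le> 4 * D" "h q \<le> 4 * D" using h_dyadic(2) P_bounds pq by force+
    moreover have "1 \<le> D" using D_ge_M M2 by linarith
    ultimately show "1 \<le> \<bar>h p - h q - z\<bar>" using D_le_h[OF pq(1)] D_le_h[OF pq(2)] assms by linarith
  qed
  then show ?thesis unfolding K_def by simp
qed

text \<open>So close to the diagonal the curvature needed for the sawtooth estimate is missing, and
  the pairs are counted directly. With p = q + r, the mean value theorem forces r to lie between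
  R0/12 and R0. For fixed r the gap h (q + r) - h q increases in q at rate at least r e D / (4 M^2),
  so few q put it within 1 of z. Summing over at most R0 values of r cancels R0 in the main term,
  and z < M bounds the remaining R0.\<close>

lemma K_le_near_aux:
  assumes z: "1 \<le> z" "real_of_int z < real M"
  shows "K z \<le> (2 + 96 / e) / D"
proof -
  define S where "S = (\<lambda>r. {q \<in> P. q + r \<in> P \<and> \<bar>h (real (q + r)) - h q - z\<bar> < 1})"
  define R where "R = {r. 1 \<le> r \<and> S r \<noteq> {}}"
  define R0 where "R0 = (real_of_int z + 1) * real M / D"
  have R0: "0 < R0" unfolding R0_def using z M_pos D_pos by simp
  have R: "real r \<le> R0" "R0 / 12 \<le> real r" "1 \<le> r" if rR: "r \<in> R" for r
  proof -
    obtain q where q: "q \<in> P" "q + r \<in> P" "\<bar>h (real (q + r)) - h q - z\<bar> < 1"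
      using rR unfolding R_def S_def by blast
    show r1: "1 \<le> r" using that by (auto simp: R_def)
    have "real r * (D / real M) \<le> real r * h' q"
      using h'_dyadic_lower P_bounds[OF q(1)] by (intro mult_left_mono) auto
    also have "\<dots> \<le> h (real (q + r)) - h q" using h_gap(1)[of q "real (q + r)"] P_X[OF q(1)] by simp
    finally have "real r * (D / real M) \<le> z + 1" using q(3) by linarith
    then show "real r \<le> R0" unfolding R0_def using D_pos M_pos by (simp add: field_simps)
    have "h (real (q + r)) - h q \<le> real r * h' (real (q + r))" using h_gap(2)[of q "real (q + r)"] P_X[OF q(1)] by simp
    also have "\<dots> \<le> real r * (4 * D / real M)"
      using h'_dyadic_upper[of "real (q + r)"] P_bounds[OF q(2)] by (intro mult_left_mono) auto
    finally have "z - 1 \<le> real r * (4 * D / real M)" using q(3) by linarith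
    then have lo: "(real_of_int z - 1) * real M / (4 * D) \<le> real r" using D_pos M_pos by (simp add: field_simps)
    show "R0 / 12 \<le> real r"
    \<comment> \<open>The mean value bound gives r at least (z - 1) M / (4 D), which is empty for z
      = 1. There r at least 1 takes its place, since R0/12 = M/(6 D) is below 1.\<close>
    proof (cases "z = 1")
      case True
      have "R0 / 12 = real M / (6 * D)" unfolding R0_def True by simp
      also have "\<dots> \<le> 1" using D_ge_M D_pos by (simp add: field_simps)
      finally show ?thesis using r1 by linarith
    next
      case False
      then have "2 \<le> z" using z(1) by presburger
      then have "2 \<le> real_of_int z" by simp
      then have "real_of_int z + 1 \<le> 3 * (real_of_int z - 1)" by simp
      then have "(real_of_int z + 1) * real M \<le> 3 * (real_of_int z - 1) * real M" by (rule mult_right_mono) simp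
      then have "(real_of_int z + 1) * real M / (12 * D) \<le> 3 * (real_of_int z - 1) * real M / (12 * D)"
        using D_pos by (intro divide_right_mono) auto
      moreover have "3 * (real_of_int z - 1) * real M / (12 * D) = (real_of_int z - 1) * real M / (4 * D)"
        using D_pos by (simp add: divide_simps)
      ultimately have "R0 / 12 \<le> (real_of_int z - 1) * real M / (4 * D)" unfolding R0_def
        by (simp only: divide_divide_eq_left mult.commute)
      then show ?thesis using lo by linarith
    qed
  qed
  have finR: "finite R" "real (card R) \<le> R0"
  proof -
    have sub: "R \<subseteq> {1..nat \<lfloor>R0\<rfloor>}" using R by (auto simp: le_nat_floor)
    then show "finite R" using finite_subset by blast
    have "card R \<le> nat \<lfloor>R0\<rfloor>" using card_mono[OF _ sub] by simp
    then show "real (card R) \<le> R0" using R0 by (meson le_nat_floor less_imp_le of_nat_floor of_nat_mono order_trans)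
  qed
  have cS: "real (card (S r)) \<le> 8 * (real M)\<^sup>2 / (real r * e * D) + 1" if r: "1 \<le> r" for r
  proof (rule card_nat_spread_le(2))
    show "0 \<le> 8 * (real M)\<^sup>2 / (real r * e * D)" using e D_pos by simp
    fix p q assume pq: "p \<in> S r" "q \<in> S r"
    show "real p - real q \<le> 8 * (real M)\<^sup>2 / (real r * e * D)"
    proof (cases "q < p")
      case True
      define F where "F = (\<lambda>v. h (v + real r) - h v)"
      have P: "p \<in> P" "q \<in> P" "p + r \<in> P" using pq by (auto simp: S_def)
      have "\<exists>x>real q. x < real p \<and> F p - F q = (real p - real q) * (h' (x + real r) - h' x)"
      proof (rule MVT2)
        fix x assume x: "real q \<le> x" "x \<le> real p"
        then have "X \<le> x" using P_X[OF P(2)] by simp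
        then show "(F has_real_derivative h' (x + real r) - h' x) (at x)"
          unfolding F_def by (auto intro!: derivative_eq_intros dh DERIV_shift[THEN iffD1])
      qed (use True in simp)
      then obtain x where x: "real q < x" "x < real p" "F p - F q = (real p - real q) * (h' (x + real r) - h' x)"
        by blast
      have "\<exists>y>x. y < x + real r \<and> h' (x + real r) - h' x = (x + real r - x) * h'' y"
        by (rule MVT2) (use r x P_X[OF P(2)] dh' in auto)
      then obtain y where y: "x < y" "y < x + real r" "h' (x + real r) - h' x = real r * h'' y" by auto
      have "e * D / (4 * (real M)\<^sup>2) \<le> h'' y"
        using h''_dyadic(1)[of y] x y P_bounds[OF P(2)] P_bounds[OF P(3)] by simp
      then have "real r * (e * D / (4 * (real M)\<^sup>2)) \<le> h' (x + real r) - h' x"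
        unfolding y(3) by (intro mult_left_mono) auto
      then have "(real p - real q) * (real r * (e * D / (4 * (real M)\<^sup>2))) \<le> F p - F q"
        unfolding x(3) using True by (intro mult_left_mono) auto
      also have "F p - F q \<le> 2" using pq unfolding F_def S_def by (auto simp: abs_less_iff)
      finally show ?thesis using r e D_pos M_pos by (simp add: field_simps)
    next
      case False
      then have "real p - real q \<le> 0" by simp
      also have "0 \<le> 8 * (real M)\<^sup>2 / (real r * e * D)" using e D_pos by simp
      finally show ?thesis .
    qed
  qed
  define W where "W = {pq \<in> P \<times> P. \<bar>h (fst pq) - h (snd pq) - z\<bar> < 1}"
  have "W \<subseteq> (\<Union>r\<in>R. (\<lambda>q. (q + r, q)) ` S r)"
  proof
    fix pq assume "pq \<in> W"
    then obtain p q where pq: "pq = (p, q)" "p \<in> P" "q \<in> P" "\<bar>h p - h q - z\<bar> < 1" by (auto simp: W_def)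
    then have "h q < h p" using z by linarith
    then have "q < p" using h_less_iff[of q p] P_X pq by simp
    then have "p = q + (p - q)" "1 \<le> p - q" by auto
    then have "q \<in> S (p - q)" using pq unfolding S_def by auto
    then show "pq \<in> (\<Union>r\<in>R. (\<lambda>q. (q + r, q)) ` S r)"
      using \<open>1 \<le> p - q\<close> \<open>p = q + (p - q)\<close> pq(1) unfolding R_def by force
  qed
  then have "card W \<le> card (\<Union>r\<in>R. (\<lambda>q. (q + r, q)) ` S r)"
    using finR by (intro card_mono finite_UN_I) (auto simp: S_def)
  also have "\<dots> \<le> (\<Sum>r\<in>R. card ((\<lambda>q. (q + r, q)) ` S r))" by (rule card_UN_le[OF finR(1)])
  also have "\<dots> = (\<Sum>r\<in>R. card (S r))" by (intro sum.cong card_image inj_onI) auto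
  finally have "real (card W) \<le> (\<Sum>r\<in>R. real (card (S r)))" 
    unfolding of_nat_sum[symmetric] by (rule of_nat_mono)
  also have "\<dots> \<le> (\<Sum>r\<in>R. 96 * (real M)\<^sup>2 / (R0 * e * D) + 1)"
  proof (rule sum_mono)
    fix r assume r: "r \<in> R"
    have "8 * (real M)\<^sup>2 / (real r * e * D) \<le> 8 * (real M)\<^sup>2 / (R0 / 12 * e * D)"
      using R[OF r] R0 e D_pos by (intro divide_left_mono mult_right_mono mult_pos_pos) auto
    then show "real (card (S r)) \<le> 96 * (real M)\<^sup>2 / (R0 * e * D) + 1" using cS[OF R(3)[OF r]] by simp
  qed
  also have "\<dots> = real (card R) * (96 * (real M)\<^sup>2 / (R0 * e * D) + 1)" by simp
  also have "\<dots> \<le> R0 * (96 * (real M)\<^sup>2 / (R0 * e * D) + 1)"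
    using finR R0 e D_pos by (intro mult_right_mono) auto
  also have "\<dots> = 96 * (real M)\<^sup>2 / (e * D) + R0" using R0 by (simp add: field_simps)
  also have "R0 \<le> 2 * (real M)\<^sup>2 / D"
  proof -
    have "(real_of_int z + 1) * real M \<le> (2 * real M) * real M" using z by (intro mult_right_mono) auto
    then show ?thesis unfolding R0_def using D_pos by (intro divide_right_mono) (auto simp: power2_eq_square)
  qed
  finally have cW: "real (card W) \<le> 96 * (real M)\<^sup>2 / (e * D) + 2 * (real M)\<^sup>2 / D" by simp
  have "(\<Sum>p\<in>P. \<Sum>q\<in>P. tent (h p - h q - z)) \<le> (\<Sum>p\<in>P. \<Sum>q\<in>P. of_bool (\<bar>h p - h q - z\<bar> < 1))"
    by (intro sum_mono tent_le_of_bool)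
  also have "\<dots> = (\<Sum>pq\<in>P \<times> P. of_bool (\<bar>h (fst pq) - h (snd pq) - z\<bar> < 1))"
    by (subst sum.cartesian_product) (simp only: case_prod_unfold)
  also have "\<dots> = real (card W)" unfolding W_def by (simp add: Int_def)
  finally have "K z \<le> (96 * (real M)\<^sup>2 / (e * D) + 2 * (real M)\<^sup>2 / D) / (real M)\<^sup>2"
    unfolding K_def using cW by (intro divide_right_mono) auto
  also have "\<dots> = (2 + 96 / e) / D" using M_pos D_pos e by (simp add: field_simps)
  finally show ?thesis .
qed

lemma K_le_near:
  assumes "z \<noteq> 0" "real_of_int \<bar>z\<bar> < real M"
  shows "K z \<le> (2 + 96 / e) / D"
  using K_le_near_aux[of z] K_le_near_aux[of "- z"] K_minus[of z] assms by (cases "z > 0") auto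

end

section \<open>Lattice points between neighbouring level curves of \<open>h p - h q\<close>\<close>

lemma ceiling_eq_saw: "real_of_int \<lceil>t\<rceil> = t + 1/2 + saw (- t)"
  unfolding saw_def frac_def by (simp add: ceiling_def)

context regvar_scale begin

text \<open>The level curve h p - h q = y, written as a graph p = u y q over the q-axis.\<close>

definition u :: "real \<Rightarrow> real \<Rightarrow> real" where "u y v = \<phi> (h v + y)"

definition u' :: "real \<Rightarrow> real \<Rightarrow> real" where "u' y v = h' v / h' (u y v)"

lemma u_props:
  assumes "real M \<le> v" "0 \<le> y" "h v + y \<le> h (2 * real M)"
  shows "h (u y v) = h v + y" "v \<le> u y v" "u y v \<le> 2 * real M"
    "real M * y / (4 * D) \<le> u y v - v" "u y v - v \<le> real M * y / D"
proof -
  have vX: "X \<le> v" using assms MX by simp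
  have D: "D \<le> h v" unfolding D_def using h_le_iff vX assms MX by simp
  have b: "h X \<le> h v + y" "D \<le> h v + y" using D hX_less_D assms by auto
  show hu: "h (u y v) = h v + y" unfolding u_def using \<phi>_props b by simp
  have uX: "X \<le> u y v" unfolding u_def using \<phi>_props b by simp
  show vu: "v \<le> u y v" using h_le_iff[OF vX uX] hu assms by simp
  show u2: "u y v \<le> 2 * real M" unfolding u_def using \<phi>_le_2M_iff[OF b(2)] assms by simp
  have "y \<le> (u y v - v) * h' (u y v)" using h_gap(2)[OF vX vu] hu by simp
  also have "\<dots> \<le> (u y v - v) * (4 * D / real M)"
    using h'_dyadic_upper u2 vu assms by (intro mult_left_mono) auto
  finally show "real M * y / (4 * D) \<le> u y v - v" using M_pos D_pos by (simp add: field_simps)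
  have "(u y v - v) * (D / real M) \<le> (u y v - v) * h' v"
    using h'_dyadic_lower vu assms by (intro mult_left_mono) auto
  also have "\<dots> \<le> y" using h_gap(1)[OF vX vu] hu by simp
  finally show "u y v - v \<le> real M * y / D" using M_pos D_pos by (simp add: field_simps)
qed

lemma DERIV_u:
  assumes "real M \<le> v" "0 \<le> y"
  shows "(u y has_real_derivative u' y v) (at v)"
proof -
  have vX: "X \<le> v" using assms MX by simp
  have D: "D \<le> h v" unfolding D_def using h_le_iff vX assms MX by simp
  have "((\<lambda>v. \<phi> (h v + y)) has_real_derivative (1 / h' (\<phi> (h v + y))) * (h' v + 0)) (at v)"
    by (rule DERIV_chain2[OF DERIV_\<phi>]) (use D hX_less_D assms in \<open>auto intro!: derivative_eq_intros dh vX\<close>)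
  then show ?thesis unfolding u'_def u_def by simp
qed

lemma DERIV_u':
  assumes "real M \<le> v" "0 \<le> y" "h v + y \<le> h (2 * real M)"
  shows "(u' y has_real_derivative
    (h' v)\<^sup>2 / h' (u y v) * (h'' v / (h' v)\<^sup>2 - h'' (u y v) / (h' (u y v))\<^sup>2)) (at v)"
proof -
  have vX: "X \<le> v" "X \<le> u y v" using u_props(2)[OF assms] assms MX by auto
  have pos: "0 < h' v" "0 < h' (u y v)" using h'_ge_1 vX by force+
  have d: "((\<lambda>v. h' (u y v)) has_real_derivative h'' (u y v) * u' y v) (at v)"
    by (rule DERIV_chain2[OF dh'[OF vX(2)] DERIV_u[OF assms(1,2)]])
  have "(u' y has_real_derivative
      (h'' v * h' (u y v) - h' v * (h'' (u y v) * u' y v)) / (h' (u y v) * h' (u y v))) (at v)"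
    using DERIV_divide[OF dh'[OF vX(1)] d] pos unfolding u'_def[abs_def] by simp
  moreover have "(h'' v * h' (u y v) - h' v * (h'' (u y v) * u' y v)) / (h' (u y v) * h' (u y v)) =
      (h' v)\<^sup>2 / h' (u y v) * (h'' v / (h' v)\<^sup>2 - h'' (u y v) / (h' (u y v))\<^sup>2)"
    unfolding u'_def using pos by (simp add: field_simps power2_eq_square)
  ultimately show ?thesis by simp
qed

text \<open>Only three derivatives of \<open>h\<close> are available, and they suffice here because the second
  derivative of \<open>u\<close> is a difference of two values of \<open>h'' / h'\<^sup>2\<close>.\<close>

lemma u''_bounds:
  assumes "real M \<le> v" "real M / 2 \<le> y" "h v + y \<le> h (2 * real M)"
  defines "d \<equiv> (h' v)\<^sup>2 / h' (u y v) * (h'' v / (h' v)\<^sup>2 - h'' (u y v) / (h' (u y v))\<^sup>2)"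
  shows "e / (256 * D) \<le> d" "d \<le> 64 / (e * real M)"
proof -
  have y0: "0 < y" using assms M_pos by linarith
  note up = u_props[OF assms(1) less_imp_le[OF y0] assms(3)]
  have v2: "v \<le> 2 * real M" using up by simp
  have uM: "real M \<le> u y v" using up assms by simp
  have "0 < real M * y / (4 * D)" using M_pos D_pos y0 by simp
  then have vu: "v < u y v" using up by linarith
  have "\<exists>z>v. z < u y v \<and> h'' (u y v) / (h' (u y v))\<^sup>2 - h'' v / (h' v)\<^sup>2 = (u y v - v) * \<kappa>' z"
    by (rule MVT2) (use vu assms MX d\<kappa> in auto)
  then obtain z where z: "v < z" "z < u y v"
    "h'' v / (h' v)\<^sup>2 - h'' (u y v) / (h' (u y v))\<^sup>2 = (u y v - v) * (- \<kappa>' z)" by (auto simp: algebra_simps)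
  have zM: "real M \<le> z" "z \<le> 2 * real M" using z up assms by auto
  have pos: "0 < h' v" "0 < h' (u y v)" using h'_ge_1[of v] h'_ge_1[of "u y v"] assms uM MX by auto
  have y4: "y \<le> 4 * D" using assms(3) h2M h_pos[of v] assms(1) MX by simp
  define A where "A = (h' v)\<^sup>2 / h' (u y v)"
  have A: "D / (4 * real M) \<le> A" "A \<le> 16 * D / real M"
  proof -
    have "D / (4 * real M) = (D / real M)\<^sup>2 / (4 * D / real M)"
      using M_pos D_pos by (simp add: field_simps power2_eq_square)
    also have "\<dots> \<le> A" unfolding A_def
      using h'_dyadic_lower assms h'_dyadic_upper[OF uM up(3)] pos M_pos D_pos
      by (intro frac_le power_mono) auto
    finally show "D / (4 * real M) \<le> A" .
    have "A \<le> (4 * D / real M)\<^sup>2 / (D / real M)" unfolding A_def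
      using h'_dyadic_upper[OF assms(1) v2] h'_dyadic_lower[OF uM] pos M_pos D_pos
      by (intro frac_le power_mono) auto
    also have "\<dots> = 16 * D / real M" using M_pos D_pos by (simp add: field_simps power2_eq_square)
    finally show "A \<le> 16 * D / real M" .
  qed
  have d_eq: "d = A * ((u y v - v) * (- \<kappa>' z))" unfolding d_def A_def z(3) by simp
  \<comment> \<open>The three factors are of size D/M, M y/D and 1/(M D). The lower bound y \<ge>
    M/2 therefore gives curvature 1/D, and y \<le> 4 D below gives 1/M.\<close>
  have "e / (256 * D) = D / (4 * real M) * ((real M * (real M / 2) / (4 * D)) * (e / (8 * real M * D)))"
    using M_pos D_pos by (simp add: field_simps)
  also have "\<dots> \<le> A * ((u y v - v) * (- \<kappa>' z))"
  proof (intro mult_mono A \<kappa>'_dyadic zM)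
    have "real M * (real M / 2) / (4 * D) \<le> real M * y / (4 * D)"
      using assms D_pos M_pos by (intro divide_right_mono mult_left_mono) auto
    then show "real M * (real M / 2) / (4 * D) \<le> u y v - v" using up by linarith
    have "0 < D / (4 * real M)" using M_pos D_pos by simp
    then show "0 \<le> A" using A by linarith
  qed (use vu D_pos M_pos e in auto)
  finally show "e / (256 * D) \<le> d" using d_eq by simp
  have "0 < e / (8 * real M * D)" using M_pos D_pos e by simp
  then have k0: "0 \<le> - \<kappa>' z" using \<kappa>'_dyadic(1)[OF zM] by linarith
  have "d \<le> (16 * D / real M) * ((real M * (4 * D) / D) * (1 / (e * real M * D)))" unfolding d_eq
  proof (intro mult_mono A \<kappa>'_dyadic zM)
    have "real M * y / D \<le> real M * (4 * D) / D"
      using y4 D_pos by (intro divide_right_mono mult_left_mono) auto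
    then show "u y v - v \<le> real M * (4 * D) / D" using up by linarith
    show "0 \<le> (u y v - v) * - \<kappa>' z" using vu k0 by (intro mult_nonneg_nonneg) auto
  qed (use D_pos M_pos k0 in auto)
  also have "\<dots> = 64 / (e * real M)" using M_pos D_pos e by (simp add: field_simps)
  finally show "d \<le> 64 / (e * real M)" .
qed

definition R :: "real \<Rightarrow> real" where
  "R y = (\<Sum>q \<in> {q \<in> P. h q + y < h (2 * real M)}. saw (- u y q))"

text \<open>As h increases, the q in the sum form an initial segment of the block. On it the curve
  has second derivative between constants times 1/D and 1/M, inside the window of
  \<open>saw_sum_bound\<close>.\<close>

lemma R_le:
  assumes C: "saw_sum_bound (e / (256 * C0)) (real M) B"
    and y: "real M / 2 \<le> y"
  shows "\<bar>R y\<bar> \<le> B"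
proof -
  define S where "S = {q \<in> P. h q + y < h (2 * real M)}"
  define n where "n = M + card S"
  have S: "S = {M..<n}"
  proof -
    have "S = {M..<M + card S}"
    proof (cases "S = {}")
      case False
      have fin: "finite S" unfolding S_def by simp
      have "S = {M..<Suc (Max S)}"
      proof
        show "S \<subseteq> {M..<Suc (Max S)}" using fin by (auto simp: S_def le_imp_less_Suc)
        show "{M..<Suc (Max S)} \<subseteq> S"
        proof
          fix q assume q: "q \<in> {M..<Suc (Max S)}"
          have mS: "Max S \<in> S" using fin False by simp
          then have mP: "Max S \<in> P" "h (Max S) + y < h (2 * real M)" by (auto simp: S_def)
          have "h q \<le> h (Max S)" using h_le_iff[of q "Max S"] q P_X[OF mP(1)] MX by simp
          then show "q \<in> S" using q mP by (auto simp: S_def)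
        qed
      qed
      moreover have "Suc (Max S) \<ge> M" using fin False Max_in[OF fin False] by (auto simp: S_def)
      moreover from calculation have "card S = Suc (Max S) - M" by (metis card_atLeastLessThan)
      ultimately show ?thesis by simp
    qed auto
    then show ?thesis unfolding n_def .
  qed
  have y0: "0 \<le> y" using y M_pos by linarith
  \<comment> \<open>The last index n - 1 is still in \<open>S\<close>, but n need not be. This is
    why \<open>saw_sum_bound\<close> asks for derivatives only where t + 1 \<le> n.\<close>
  have dom: "h t + y \<le> h (2 * real M)" if t: "real M \<le> t" "t + 1 \<le> real n" for t
  proof -
    have "n > M" using t by linarith
    then have "n - 1 \<in> S" using S by auto
    then have "h (real (n - 1)) + y < h (2 * real M)" by (auto simp: S_def)
    moreover have "h t \<le> h (real (n - 1))" using h_le_iff[of t "real (n - 1)"] t MX \<open>n > M\<close> by simp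
    ultimately show ?thesis by linarith
  qed
  have "\<bar>\<Sum>p\<in>{M..<n}. saw (- u y (real p))\<bar> \<le> B"
  proof (rule saw_sum_boundD[OF C, where f' = "\<lambda>v. - u' y v" and lo = "e / (256 * D)" and hi = "64 / (e * real M)"])
    show "M \<le> n" unfolding n_def by simp
    have "card S \<le> card P" by (intro card_mono) (auto simp: S_def)
    then show "real n - real M \<le> real M" unfolding n_def by simp
    show "\<forall>t. real M \<le> t \<and> t + 1 \<le> real n \<longrightarrow> ((\<lambda>v. - u y v) has_real_derivative - u' y t) (at t)"
      using DERIV_u y0 by (auto intro!: derivative_intros)
    show "\<forall>s t. real M \<le> s \<and> s \<le> t \<and> t + 1 \<le> real n \<longrightarrow>
      e / (256 * D) * (t - s) \<le> \<bar>- u' y t - - u' y s\<bar> \<and> \<bar>- u' y t - - u' y s\<bar> \<le> 64 / (e * real M) * (t - s)"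
    proof (intro allI impI)
      fix s t assume st: "real M \<le> s \<and> s \<le> t \<and> t + 1 \<le> real n"
      show "e / (256 * D) * (t - s) \<le> \<bar>- u' y t - - u' y s\<bar> \<and> \<bar>- u' y t - - u' y s\<bar> \<le> 64 / (e * real M) * (t - s)"
      proof (cases "s = t")
        case False
        define d where "d = (\<lambda>v. (h' v)\<^sup>2 / h' (u y v) * (h'' v / (h' v)\<^sup>2 - h'' (u y v) / (h' (u y v))\<^sup>2))"
        have "\<exists>z>s. z < t \<and> u' y t - u' y s = (t - s) * d z"
        proof (rule MVT2)
          fix x assume "s \<le> x" "x \<le> t"
          then show "(u' y has_real_derivative d x) (at x)"
            unfolding d_def using DERIV_u'[of x y] dom[of x] st y0 by simp
        qed (use False st in simp)
        then obtain z where z: "s < z" "z < t" "u' y t - u' y s = (t - s) * d z" by blast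
        have dz: "e / (256 * D) \<le> d z" "d z \<le> 64 / (e * real M)"
          unfolding d_def using u''_bounds[of z y] dom[of z] z st y by auto
        have "0 < e / (256 * D)" using e D_pos by simp
        then have d0: "0 \<le> d z" using dz by linarith
        have ab: "\<bar>- u' y t - - u' y s\<bar> = d z * (t - s)" 
        proof -
          have "- u' y t - - u' y s = - (d z * (t - s))" using z(3) by (simp add: algebra_simps)
          then show ?thesis using d0 st by simp
        qed
        have "0 \<le> t - s" using st by simp
        then show ?thesis unfolding ab using mult_right_mono[OF dz(1)] mult_right_mono[OF dz(2)] by blast
      qed simp
    qed
    have pw: "real M powr (-21/20) * real M powr (21/20) = 1" using M_pos
      by (simp only: powr_add[symmetric]) simp
    have "D \<le> C0 * real M powr (21/20)" unfolding D_def using h_upper MX by simp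
    then have "real M powr (-21/20) * D \<le> real M powr (-21/20) * (C0 * real M powr (21/20))"
      by (intro mult_left_mono) auto
    also have "\<dots> = C0 * (real M powr (-21/20) * real M powr (21/20))" by (simp only: mult_ac)
    finally have DM: "real M powr (-21/20) * D \<le> C0" unfolding pw by simp
    have "e / (256 * C0) * real M powr (-21/20) = e / (256 * C0) * (real M powr (-21/20) * D) / D" using D_pos by simp
    also have "\<dots> \<le> e / (256 * C0) * C0 / D"
      using DM e C0 D_pos by (intro divide_right_mono mult_left_mono) auto
    also have "\<dots> = e / (256 * D)" using C0 by simp
    finally show "e / (256 * C0) * real M powr (-21/20) \<le> e / (256 * D)" .
    have "1 / real M = real M powr (-1)" using M_pos by (simp add: powr_minus_divide)
    also have "\<dots> \<le> real M powr (-19/20)" using M2 by (intro powr_mono) auto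
    finally have m1: "1 / real M \<le> real M powr (-19/20)" .
    have "64 / (e * real M) = (64 / e) * (1 / real M)" by simp
    also have "\<dots> \<le> (256 * C0 / e) * real M powr (-19/20)"
      using m1 e C0 by (intro mult_mono divide_right_mono) auto
    finally show "64 / (e * real M) \<le> real M powr (-19/20) / (e / (256 * C0))" by (simp add: mult.commute)
  qed (use e in auto)
  then show ?thesis unfolding R_def S_def[symmetric] S .
qed

definition cnt :: "real \<Rightarrow> nat \<Rightarrow> nat" where "cnt y q = card {p \<in> P. h p < h q + y}"

text \<open>The counted p are exactly the integers from M to just below
  \<open>\<Phi> (h q + y)\<close>, so the count is a ceiling minus M, and the ceiling is split into
  a smooth part and a sawtooth.\<close>

lemma cnt_eq:
  assumes "q \<in> P" "0 \<le> y"
  shows "real (cnt y q) = \<Phi> (h q + y) + 1/2 + saw (- \<Phi> (h q + y)) - real M"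
proof -
  have D: "D \<le> h q + y" using D_le_h assms by (simp add: add_increasing2)
  have M: "real M \<le> \<Phi> (h q + y)" "\<Phi> (h q + y) \<le> 2 * real M" using M_le_\<Phi>[OF D] by (auto simp: \<Phi>_def)
  define n where "n = nat \<lceil>\<Phi> (h q + y)\<rceil>"
  have n: "M \<le> n" "real n = real_of_int \<lceil>\<Phi> (h q + y)\<rceil>" "n \<le> 2 * M"
    using M unfolding n_def by (auto simp: le_nat_iff nat_le_iff ceiling_le_iff le_ceiling_iff)
  have "{p \<in> P. h p < h q + y} = {M..<n}"
  proof -
    have "h p < h q + y \<longleftrightarrow> p < n" if p: "p \<in> P" for p
    proof -
      have "h p < h q + y \<longleftrightarrow> real p < \<phi> (h q + y)" using less_\<phi>_iff[of "h q + y" p] D hX_less_D P_X[OF p] by simp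
      also have "\<dots> \<longleftrightarrow> real p < \<Phi> (h q + y)" using P_bounds[OF p] by (auto simp: \<Phi>_def)
      also have "\<dots> \<longleftrightarrow> int p < \<lceil>\<Phi> (h q + y)\<rceil>" by (simp add: less_ceiling_iff)
      also have "\<dots> \<longleftrightarrow> p < n" using n(2) by linarith
      finally show ?thesis .
    qed
    then show ?thesis using n by auto
  qed
  then have "cnt y q = n - M" unfolding cnt_def by simp
  then have "real (cnt y q) = real n - real M" using n(1) by simp
  then show ?thesis using n(2) ceiling_eq_saw by simp
qed

text \<open>Where the cap is active, \<Phi> equals the integer 2 M and the sawtooth takes its value
  -1/2 at integers. These terms oscillate with nothing, so they are split off as a plain
  count.\<close>

lemma sum_saw_\<Phi>:
  assumes "0 \<le> y"
  shows "(\<Sum>q\<in>P. saw (- \<Phi> (h q + y))) = R y - real (card {q \<in> P. h (2 * real M) \<le> h q + y}) / 2"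
proof -
  let ?S = "{q \<in> P. h q + y < h (2 * real M)}" and ?T = "{q \<in> P. h (2 * real M) \<le> h q + y}"
  have "P = ?S \<union> ?T" by auto
  then have "(\<Sum>q\<in>P. saw (- \<Phi> (h q + y))) = (\<Sum>q\<in>?S \<union> ?T. saw (- \<Phi> (h q + y)))" by (rule sum.cong) simp
  also have "\<dots> = (\<Sum>q\<in>?S. saw (- \<Phi> (h q + y))) + (\<Sum>q\<in>?T. saw (- \<Phi> (h q + y)))"
    by (rule sum.union_disjoint) auto
  also have "(\<Sum>q\<in>?S. saw (- \<Phi> (h q + y))) = R y" unfolding R_def
  proof (rule sum.cong)
    fix q assume "q \<in> ?S"
    then have "D \<le> h q + y" "h q + y \<le> h (2 * real M)" using D_le_h assms by (auto intro: add_increasing2)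
    then have "\<Phi> (h q + y) = u y q" unfolding \<Phi>_def u_def using \<phi>_le_2M_iff by simp
    then show "saw (- \<Phi> (h q + y)) = saw (- u y q)" by simp
  qed simp
  also have "(\<Sum>q\<in>?T. saw (- \<Phi> (h q + y))) = (\<Sum>q\<in>?T. - 1/2)"
  proof (rule sum.cong)
    fix q assume "q \<in> ?T"
    then have "\<Phi> (h q + y) = 2 * real M" by (intro \<Phi>_eq_2M) auto
    then have "- \<Phi> (h q + y) = of_int (- 2 * int M)" by simp
    then show "saw (- \<Phi> (h q + y)) = - 1/2" unfolding saw_def by (simp only: frac_of_int)
  qed simp
  finally show ?thesis by simp
qed

text \<open>The count is the difference of \<open>cnt\<close> at y + 1 and y; its smooth part
  telescopes to \<open>w y\<close>. The capped terms change for at most two q, because the values of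
  h are 1-separated, and with weight 1/2 this costs at most 1.\<close>

lemma pair_count:
  assumes "0 \<le> y"
  shows "\<bar>(\<Sum>p\<in>P. \<Sum>q\<in>P. of_bool (h q + y \<le> h p \<and> h p < h q + y + 1)) - w y\<bar> \<le> \<bar>R y\<bar> + \<bar>R (y + 1)\<bar> + 1"
proof -
  have cell: "(\<Sum>p\<in>P. of_bool (h q + y \<le> h p \<and> h p < h q + y + 1) :: real) = real (cnt (y + 1) q) - real (cnt y q)" for q
  proof -
    let ?A = "{p \<in> P. h q + y \<le> h p \<and> h p < h q + y + 1}" and ?B = "{p \<in> P. h p < h q + y}"
    have "{p \<in> P. h p < h q + (y + 1)} = ?A \<union> ?B" by (auto simp: add.assoc)
    moreover have "card (?A \<union> ?B) = card ?A + card ?B" by (rule card_Un_disjoint) auto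
    ultimately have "cnt (y + 1) q = card ?A + cnt y q" unfolding cnt_def by presburger
    moreover have "(\<Sum>p\<in>P. of_bool (h q + y \<le> h p \<and> h p < h q + y + 1) :: real) = real (card ?A)"
      by (subst sum_of_bool_eq) (auto simp: Int_def)
    ultimately show ?thesis by simp
  qed
  let ?T = "\<lambda>y. {q \<in> P. h (2 * real M) \<le> h q + y}"
  have T: "real (card (?T (y + 1))) \<le> real (card (?T y)) + 2" "card (?T y) \<le> card (?T (y + 1))"
  proof -
    show "card (?T y) \<le> card (?T (y + 1))" by (intro card_mono) auto
    let ?U = "{q \<in> P. h q + y < h (2 * real M) \<and> h (2 * real M) \<le> h q + (y + 1)}"
    have "real (card ?U) \<le> 1 + 1"
    proof (rule card_nat_spread_le(2))
      fix p q assume pq: "p \<in> ?U" "q \<in> ?U"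
      show "real p - real q \<le> 1"
      proof (cases "q \<le> p")
        case True
        have qX: "X \<le> q" using P_X pq by auto
        have "(real p - real q) * 1 \<le> (real p - real q) * h' q" using h'_ge_1 qX True by (intro mult_left_mono) auto
        also have "\<dots> \<le> h p - h q" using h_gap(1)[OF qX] True by simp
        finally show ?thesis using pq by simp
      qed simp
    qed simp
    moreover have "card (?T (y + 1)) \<le> card (?T y) + card ?U"
      by (rule order_trans[OF card_mono card_Un_le]) auto
    ultimately show "real (card (?T (y + 1))) \<le> real (card (?T y)) + 2" by linarith
  qed
  have S: "(\<Sum>q\<in>P. real (cnt y q)) = (\<Sum>q\<in>P. \<Phi> (h q + y)) + real M / 2 - (real M)\<^sup>2 +
      (R y - real (card (?T y)) / 2)" if "0 \<le> y" for y
  proof -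
    have "(\<Sum>q\<in>P. real (cnt y q)) = (\<Sum>q\<in>P. \<Phi> (h q + y) + 1/2 + saw (- \<Phi> (h q + y)) - real M)"
      by (intro sum.cong refl cnt_eq that)
    also have "\<dots> = (\<Sum>q\<in>P. \<Phi> (h q + y)) + real M / 2 + (\<Sum>q\<in>P. saw (- \<Phi> (h q + y))) - real M * real M"
      by (simp add: sum.distrib sum_subtractf)
    finally show ?thesis unfolding sum_saw_\<Phi>[OF that] by (simp add: power2_eq_square)
  qed
  have "(\<Sum>p\<in>P. \<Sum>q\<in>P. of_bool (h q + y \<le> h p \<and> h p < h q + y + 1) :: real) =
      (\<Sum>q\<in>P. real (cnt (y + 1) q) - real (cnt y q))"
    by (subst sum.swap) (simp only: cell)
  also have "\<dots> = w y + R (y + 1) - R y - (real (card (?T (y + 1))) - real (card (?T y))) / 2"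
    unfolding sum_subtractf S[OF assms] S[OF add_nonneg_nonneg[OF assms zero_le_one]] w_def
    by (simp add: add.assoc diff_divide_distrib)
  finally have "(\<Sum>p\<in>P. \<Sum>q\<in>P. of_bool (h q + y \<le> h p \<and> h p < h q + y + 1) :: real) =
      w y + R (y + 1) - R y - (real (card (?T (y + 1))) - real (card (?T y))) / 2" .
  moreover have "\<bar>s - v\<bar> \<le> \<bar>a\<bar> + \<bar>b\<bar> + 1" if "s = v + b - a - (k - l) / 2" "k \<le> l + 2" "l \<le> k"
    for s v a b k l :: real
    using that abs_ge_self[of a] abs_ge_minus_self[of a] abs_ge_self[of b] abs_ge_minus_self[of b]
    by (intro abs_leI) (simp_all add: field_simps)
  ultimately show ?thesis using T(1) of_nat_mono[OF T(2)] by blast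
qed

text \<open>The tent sum is an average over \<sigma> of sharp counts at y = z - \<sigma>. Each is
  compared with w y by \<open>pair_count\<close>, and w y with w z by the Lipschitz bound, which is
  O(1) here because M \<le> D.\<close>

lemma K_far:
  assumes R: "\<And>y. real M / 2 \<le> y \<Longrightarrow> \<bar>R y\<bar> \<le> B" and z: "real M \<le> real_of_int z"
  shows "\<bar>K z - G z\<bar> \<le> (2 * B + 4 + 8 / e) / (real M)\<^sup>2"
proof -
  let ?N = "\<lambda>\<sigma>. (\<Sum>p\<in>P. \<Sum>q\<in>P. of_bool (- \<sigma> \<le> h p - h q - z \<and> h p - h q - z < 1 - \<sigma>) :: real)"
  have "(?N has_integral (\<Sum>p\<in>P. \<Sum>q\<in>P. tent (h p - h q - z))) {0..1}"
    by (intro has_integral_sum has_integral_tent) auto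
  moreover have "((\<lambda>\<sigma>. w z) has_integral w z) {0..1::real}"
    using has_integral_const_real[of "w z" 0 1] by simp
  ultimately have int: "((\<lambda>\<sigma>. ?N \<sigma> - w z) has_integral ((\<Sum>p\<in>P. \<Sum>q\<in>P. tent (h p - h q - z)) - w z)) {0..1}"
    by (rule has_integral_diff)
  have pt: "\<bar>?N \<sigma> - w z\<bar> \<le> 2 * B + 4 + 8 / e" if \<sigma>: "\<sigma> \<in> {0..1}" for \<sigma>
  proof -
    define y where "y = real_of_int z - \<sigma>"
    \<comment> \<open>The shift \<sigma> can lower z by 1. With M at least 2 the argument y stays
      above M/2, the range where the bound on \<open>R\<close> is available.\<close>
    have M1: "real M / 2 \<le> real M - 1" using M2 by simp
    have y: "real M / 2 \<le> y" "0 \<le> y" using z \<sigma> M1 M_pos unfolding y_def by auto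
    have "?N \<sigma> = (\<Sum>p\<in>P. \<Sum>q\<in>P. of_bool (h q + y \<le> h p \<and> h p < h q + y + 1))"
      unfolding y_def by (intro sum.cong refl arg_cong[where f = of_bool]) auto
    then have a: "\<bar>?N \<sigma> - w y\<bar> \<le> 2 * B + 1"
      using pair_count[OF y(2)] R[of y] R[of "y + 1"] y by simp
    have MD: "real M / D \<le> 1" "0 \<le> real M / D" using D_ge_M D_pos by auto
    then have MD2: "(real M / D)\<^sup>2 \<le> 1" by (simp add: power_le_one)
    have "\<bar>w y - w z\<bar> \<le> (4 / e + 1) * (real M / D)\<^sup>2 * (\<bar>y - z\<bar> + 1) + real M / D"
      using w_lipschitz[of y "real_of_int z"] y z M_pos by simp
    also have "\<dots> \<le> (4 / e + 1) * 1 * 2 + 1"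
      using MD MD2 e \<sigma> unfolding y_def by (intro add_mono mult_mono) auto
    finally show ?thesis using a by (simp add: algebra_simps)
  qed
  have "0 \<le> 2 * B + 4 + 8 / e" using pt[of 0] by (auto intro: order_trans[OF abs_ge_zero])
  then have "\<bar>(\<Sum>p\<in>P. \<Sum>q\<in>P. tent (h p - h q - z)) - w z\<bar> \<le> (2 * B + 4 + 8 / e) * (1 - 0)"
    using has_integral_bound_real[OF _ _ int] pt by force
  then have "\<bar>(\<Sum>p\<in>P. \<Sum>q\<in>P. tent (h p - h q - z)) - w z\<bar> / (real M)\<^sup>2 \<le> (2 * B + 4 + 8 / e) / (real M)\<^sup>2"
    by (intro divide_right_mono) auto
  moreover have "\<bar>real_of_int z\<bar> = real_of_int z" using z M_pos by simp
  ultimately show ?thesis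
    unfolding K_def G_def by (simp add: diff_divide_distrib[symmetric] abs_divide)
qed

end

context regvar begin

text \<open>The diagonal contributes the mass at the origin; what remains is a Lipschitz function at scale
  \<open>h M\<close>, up to an error that is smaller than \<open>1 / h M\<close> by a power of \<open>M\<close> except near the origin.\<close>

lemma kernel_decomposition:
  "\<exists>C>0. \<forall>M::nat. X < real M \<and> 2 \<le> M \<longrightarrow> (\<exists>G E :: int \<Rightarrow> real. 
     (\<forall>z. (\<Sum>p\<in>{M..<2*M}. \<Sum>q\<in>{M..<2*M}. tent (h p - h q - of_int z)) / (real M)\<^sup>2 =
        of_bool (z = 0) / real M + G z + E z) \<and>
     (\<forall>z z'. \<bar>G z - G z'\<bar> \<le> C * (real_of_int \<bar>z - z'\<bar> / (h M)\<^sup>2 + real M powr (-1/20) / h M)) \<and>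
     (\<forall>z. \<bar>E z\<bar> \<le> C * (real M powr (-1/20) / h M + of_bool (real_of_int \<bar>z\<bar> < real M) / h M)) \<and>
     (\<forall>z. 4 * h M \<le> real_of_int \<bar>z\<bar> \<longrightarrow> G z = 0 \<and> E z = 0))"
proof -
  have "0 < e / (256 * C0)" using e C0 by simp
  from saw_sum_bound_powr[OF this] obtain C1 where C1: "C1 > 0"
    and disc: "\<And>M. 1 \<le> M \<Longrightarrow> saw_sum_bound (e / (256 * C0)) M (C1 * M powr (9/10))"
    by blast
  define C2 where "C2 = (2 * C1 + 4 + 8 / e) * C0"
  define C where "C = C2 + 2 * (4 / e + 1) + (3 + 96 / e)"
  have C2: "C2 > 0" unfolding C2_def using C1 e C0 by (simp add: add_pos_pos)
  have C: "C > 0" "C2 \<le> C" "2 * (4 / e + 1) \<le> C" "3 + 96 / e \<le> C" "1 \<le> C"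
  proof -
    have "0 < 8 / e" "0 < 96 / e" "2 * (4 / e + 1) = 8 / e + 2" using e by auto
    then have "C = C2 + 8 / e + 2 + 3 + 96 / e" unfolding C_def by linarith
    then show "C > 0" "C2 \<le> C" "2 * (4 / e + 1) \<le> C" "3 + 96 / e \<le> C" "1 \<le> C"
      using C2 \<open>0 < 8 / e\<close> \<open>0 < 96 / e\<close> \<open>2 * (4 / e + 1) = 8 / e + 2\<close> by linarith+
  qed
  show ?thesis
  proof (intro exI[of _ C] conjI allI impI)
    fix M :: nat assume M: "X < real M \<and> 2 \<le> M"
    interpret regvar_scale h h' h'' \<kappa>' X e c C0 M by unfold_locales (use M in auto)
    have RB: "\<bar>R y\<bar> \<le> C1 * real M powr (9/10)" if "real M / 2 \<le> y" for y
      by (rule R_le[OF disc that]) (use M2 in simp)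
    define E where "E z = K z - of_bool (z = 0) / real M - G z" for z
    have M1: "1 \<le> real M" using M2 by simp
    \<comment> \<open>The exponents balance as 9/10 - 2 + 21/20 = -1/20.\<close>
    have key: "real M powr (9/10) / (real M)\<^sup>2 \<le> C0 * (real M powr (-1/20) / D)"
    proof -
      have "D \<le> C0 * real M powr (21/20)" unfolding D_def using h_upper MX by simp
      then have "real M powr (9/10) / (real M)\<^sup>2 * D \<le> real M powr (9/10) / (real M)\<^sup>2 * (C0 * real M powr (21/20))"
        by (intro mult_left_mono) auto
      also have "\<dots> = C0 * (real M powr (9/10) * real M powr (-2) * real M powr (21/20))"
        using M_pos by (simp add: powr_minus_divide powr_numeral)
      also have "real M powr (9/10) * real M powr (-2) * real M powr (21/20) = real M powr (-1/20)"
        by (simp only: powr_add[symmetric]) simp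
      finally show ?thesis using D_pos by (simp add: field_simps)
    qed
    have far: "\<bar>E z\<bar> \<le> C2 * (real M powr (-1/20) / D)" if z: "real M \<le> real_of_int \<bar>z\<bar>" for z
    proof -
      have "\<bar>K z - G z\<bar> = \<bar>K \<bar>z\<bar> - G \<bar>z\<bar>\<bar>" using K_minus[of z] by (cases "z \<ge> 0") (auto simp: G_def)
      also have "\<dots> \<le> (2 * (C1 * real M powr (9/10)) + 4 + 8 / e) / (real M)\<^sup>2"
        by (rule K_far[OF RB z])
      also have "\<dots> \<le> (2 * C1 + 4 + 8 / e) * (real M powr (9/10) / (real M)\<^sup>2)"
      proof -
        have "1 \<le> real M powr (9/10)" using M1 by (simp add: ge_one_powr_ge_zero)
        then have "(4 + 8 / e) * 1 \<le> (4 + 8 / e) * real M powr (9/10)" using e by (intro mult_left_mono) auto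
        then have "2 * (C1 * real M powr (9/10)) + 4 + 8 / e \<le> (2 * C1 + 4 + 8 / e) * real M powr (9/10)"
          by (simp add: algebra_simps)
        then show ?thesis unfolding times_divide_eq_right by (rule divide_right_mono) simp
      qed
      also have "\<dots> \<le> (2 * C1 + 4 + 8 / e) * (C0 * (real M powr (-1/20) / D))"
        using key C1 e by (intro mult_left_mono) auto
      finally show ?thesis using z M_pos unfolding E_def C2_def by (auto simp: mult.assoc)
    qed
    \<comment> \<open>In this band no cancellation between \<open>K\<close> and \<open>G\<close> is
      sought: off the origin each of them is O(1/D) by itself.\<close>
    have near: "\<bar>E z\<bar> \<le> (3 + 96 / e) / D" if z: "real_of_int \<bar>z\<bar> < real M" for z
    proof (cases "z = 0")
      case True
      have "1 / D \<le> (3 + 96 / e) / D" using D_pos e by (intro divide_right_mono) auto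
      then show ?thesis using K_0 G_bounds[of 0] True unfolding E_def by simp
    next
      case False
      have "1 / D + (2 + 96 / e) / D = (3 + 96 / e) / D" by (simp add: add_divide_distrib[symmetric])
      then show ?thesis using K_le_near[OF False z] K_nonneg[of z] G_bounds[of z] False unfolding E_def by simp
    qed
    have q0: "0 \<le> real M powr (-1/20) / D" using D_pos by simp
    have "1 / (real M * D) \<le> real M powr (-1/20) / D"
    proof -
      have "1 / real M = real M powr (-1)" using M_pos by (simp add: powr_minus_divide)
      also have "\<dots> \<le> real M powr (-1/20)" using M1 by (intro powr_mono) auto
      finally have "1 / real M / D \<le> real M powr (-1/20) / D" using D_pos by (intro divide_right_mono) auto
      then show ?thesis by simp
    qed
    show "\<exists>G E :: int \<Rightarrow> real. 
     (\<forall>z. (\<Sum>p\<in>{M..<2*M}. \<Sum>q\<in>{M..<2*M}. tent (h p - h q - of_int z)) / (real M)\<^sup>2 =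
        of_bool (z = 0) / real M + G z + E z) \<and>
     (\<forall>z z'. \<bar>G z - G z'\<bar> \<le> C * (real_of_int \<bar>z - z'\<bar> / (h M)\<^sup>2 + real M powr (-1/20) / h M)) \<and>
     (\<forall>z. \<bar>E z\<bar> \<le> C * (real M powr (-1/20) / h M + of_bool (real_of_int \<bar>z\<bar> < real M) / h M)) \<and>
     (\<forall>z. 4 * h M \<le> real_of_int \<bar>z\<bar> \<longrightarrow> G z = 0 \<and> E z = 0)"
      unfolding D_def[symmetric]
    proof (rule exI[of _ G], rule exI[of _ E], intro conjI allI impI)
      fix z :: int
      show "(\<Sum>p\<in>{M..<2*M}. \<Sum>q\<in>{M..<2*M}. tent (h p - h q - of_int z)) / (real M)\<^sup>2 =
        of_bool (z = 0) / real M + G z + E z" unfolding E_def K_def by simp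
    next
      fix z z' :: int
      have "\<bar>G z - G z'\<bar> \<le> 2 * (4 / e + 1) * (real_of_int \<bar>z - z'\<bar> / D\<^sup>2) + 1 / (real M * D)" by (rule G_lipschitz)
      also have "\<dots> \<le> C * (real_of_int \<bar>z - z'\<bar> / D\<^sup>2) + C * (real M powr (-1/20) / D)"
        using C \<open>1 / (real M * D) \<le> real M powr (-1/20) / D\<close> mult_right_mono[OF C(5) q0]
        by (intro add_mono mult_right_mono) auto
      finally show "\<bar>G z - G z'\<bar> \<le> C * (real_of_int \<bar>z - z'\<bar> / D\<^sup>2 + real M powr (-1/20) / D)"
        by (simp only: distrib_left)
    next
      fix z :: int
      show "\<bar>E z\<bar> \<le> C * (real M powr (-1/20) / D + of_bool (real_of_int \<bar>z\<bar> < real M) / D)"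
      proof (cases "real_of_int \<bar>z\<bar> < real M")
        case True
        have "(3 + 96 / e) / D \<le> C * (1 / D)" using C D_pos by (simp add: divide_right_mono)
        moreover have "0 \<le> C * (real M powr (-1/20) / D)"
          by (rule mult_nonneg_nonneg[OF less_imp_le[OF C(1)] q0])
        ultimately show ?thesis using near[OF True] True by (simp add: distrib_left)
      next
        case False
        have "C2 * (real M powr (-1/20) / D) \<le> C * (real M powr (-1/20) / D)"
          by (rule mult_right_mono[OF C(2) q0])
        then show ?thesis using far[of z] False by simp
      qed
    next
      fix z :: int
      assume z: "4 * D \<le> real_of_int \<bar>z\<bar>"
      show G0: "G z = 0" using G_eq_0 z by simp
    next
      fix z :: int
      assume z: "4 * D \<le> real_of_int \<bar>z\<bar>"
      have "z \<noteq> 0" using z D_pos by auto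
      moreover have G0: "G z = 0" using G_eq_0 z by simp
      ultimately show "E z = 0" using K_eq_0 z G0 unfolding E_def by simp
    qed
  qed (rule C(1))
qed

end

section \<open>Calderon-Zygmund intervals and quadratic forms in atoms\<close>

text \<open>An interval is coded by its left end and length: the length enters the estimates as a
  number, and the left end is the point where the kernel is frozen.\<close>

definition iv :: "int \<times> nat \<Rightarrow> int set" where "iv Q = {fst Q..<fst Q + int (snd Q)}"

lemma finite_iv [simp]: "finite (iv Q)" and card_iv [simp]: "card (iv Q) = snd Q"
  by (simp_all add: iv_def)

definition dyadic :: "nat \<Rightarrow> int \<Rightarrow> int \<times> nat" where "dyadic s x = (2 ^ s * (x div 2 ^ s), 2 ^ s)"

lemma mem_dyadic_iff: "y \<in> iv (dyadic s x) \<longleftrightarrow> y div 2 ^ s = x div 2 ^ s"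
proof -
  have pos: "(0::int) < 2 ^ s" by simp
  have "y \<in> iv (dyadic s x) \<longleftrightarrow> 2 ^ s * (x div 2 ^ s) \<le> y \<and> y < 2 ^ s * (x div 2 ^ s) + 2 ^ s"
    by (simp add: iv_def dyadic_def)
  also have "\<dots> \<longleftrightarrow> y div 2 ^ s = x div 2 ^ s"
  proof
    assume a: "2 ^ s * (x div 2 ^ s) \<le> y \<and> y < 2 ^ s * (x div 2 ^ s) + 2 ^ s"
    show "y div 2 ^ s = x div 2 ^ s"
      by (rule int_div_pos_eq[of y "2 ^ s" "x div 2 ^ s" "y - 2 ^ s * (x div 2 ^ s)"]) (use a in auto)
  next
    assume a: "y div 2 ^ s = x div 2 ^ s"
    have "2 ^ s * (x div 2 ^ s) + y mod 2 ^ s = y" unfolding a[symmetric] by simp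
    moreover have "0 \<le> y mod 2 ^ s" "y mod 2 ^ s < 2 ^ s" using pos by auto
    ultimately show "2 ^ s * (x div 2 ^ s) \<le> y \<and> y < 2 ^ s * (x div 2 ^ s) + 2 ^ s" by linarith
  qed
  finally show ?thesis .
qed

lemma dyadic_eq: assumes "y \<in> iv (dyadic s x)" "s \<le> r" shows "dyadic r y = dyadic r x"
proof -
  have "y div 2 ^ r = x div 2 ^ r"
  proof -
    have "(2::int) ^ r = 2 ^ s * 2 ^ (r - s)" using assms(2) by (simp add: power_add[symmetric])
    then have "z div 2 ^ r = (z div 2 ^ s) div 2 ^ (r - s)" for z :: int by (simp add: zdiv_zmult2_eq)
    then show ?thesis using assms(1) by (simp add: mem_dyadic_iff)
  qed
  then show ?thesis by (simp add: dyadic_def)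
qed

text \<open>The selected intervals are the maximal dyadic ones with mean above \<alpha>. They exist
  because the mean over length 2^s is at most T / 2^s, and they are disjoint because dyadic
  intervals are nested. A point in none of them fails the condition already for the one-point
  interval at scale 0.\<close>

lemma calderon_zygmund_intervals:
  fixes f :: "int \<Rightarrow> real" and \<alpha> :: real
  assumes f: "\<And>x. 0 \<le> f x" "finite {x. f x \<noteq> 0}" and \<alpha>: "0 < \<alpha>"
  obtains \<Q> where "finite \<Q>" "disjoint_family_on iv \<Q>" "\<And>Q. Q \<in> \<Q> \<Longrightarrow> 0 < snd Q"
    "\<And>Q. Q \<in> \<Q> \<Longrightarrow> \<alpha> * real (snd Q) < (\<Sum>x\<in>iv Q. f x)"
    "\<And>Q. Q \<in> \<Q> \<Longrightarrow> (\<Sum>x\<in>iv Q. f x) \<le> 2 * \<alpha> * real (snd Q)"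
    "\<And>x. x \<notin> (\<Union>Q\<in>\<Q>. iv Q) \<Longrightarrow> f x \<le> \<alpha>"
proof -
  define S where "S = (\<lambda>s x. \<Sum>y\<in>iv (dyadic s x). f y)"
  define T where "T = (\<Sum>x | f x \<noteq> 0. f x)"
  define big where "big = (\<lambda>x. {s. \<alpha> * 2 ^ s < S s x})"
  have ST: "S s x \<le> T" for s x
  proof -
    have "S s x = (\<Sum>y\<in>iv (dyadic s x) \<inter> {x. f x \<noteq> 0}. f y)" unfolding S_def by (rule sum.mono_neutral_right) auto
    also have "\<dots> \<le> T" unfolding T_def using f by (intro sum_mono2) auto
    finally show ?thesis .
  qed
  have fin_big: "finite (big x)" for x
  proof -
    obtain n :: nat where n: "T / \<alpha> < 2 ^ n" using real_arch_pow[of 2 "T / \<alpha>"] by auto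
    have "big x \<subseteq> {..<n}"
    proof
      fix s assume "s \<in> big x"
      then have "\<alpha> * 2 ^ s < T" using ST[of s x] by (auto simp: big_def)
      then have "(2::real) ^ s < T / \<alpha>" using \<alpha> by (simp add: field_simps)
      then have "(2::real) ^ s < 2 ^ n" using n by linarith
      then show "s \<in> {..<n}" by simp
    qed
    then show ?thesis using finite_subset by blast
  qed
  define \<sigma> where "\<sigma> = (\<lambda>x. Max (big x))"
  define Qx where "Qx = (\<lambda>x. dyadic (\<sigma> x) x)"
  define \<Omega> where "\<Omega> = {x. big x \<noteq> {}}"
  have \<sigma>: "\<sigma> x \<in> big x" "s \<in> big x \<Longrightarrow> s \<le> \<sigma> x" if "x \<in> \<Omega>" for x s
    using that fin_big[of x] unfolding \<sigma>_def \<Omega>_def by auto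
  have same: "y \<in> \<Omega> \<and> Qx y = Qx x" if x: "x \<in> \<Omega>" and y: "y \<in> iv (Qx x)" for x y
  proof -
    have dy: "dyadic s y = dyadic s x" if "\<sigma> x \<le> s" for s
      using dyadic_eq[of y "\<sigma> x" x s] y that unfolding Qx_def by simp
    then have Sy: "s \<in> big y \<longleftrightarrow> s \<in> big x" if "\<sigma> x \<le> s" for s using that unfolding big_def S_def by simp
    then have "\<sigma> x \<in> big y" using \<sigma>[OF x] by simp
    then have yO: "y \<in> \<Omega>" by (auto simp: \<Omega>_def)
    have "\<sigma> y = \<sigma> x"
    proof (rule antisym)
      show "\<sigma> x \<le> \<sigma> y" using \<sigma>(2)[OF yO] \<open>\<sigma> x \<in> big y\<close> by simp
      then show "\<sigma> y \<le> \<sigma> x" using \<sigma>(1)[OF yO] Sy \<sigma>(2)[OF x] by simp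
    qed
    then show ?thesis using yO dy[of "\<sigma> x"] unfolding Qx_def by simp
  qed
  have self: "x \<in> iv (Qx x)" for x unfolding Qx_def by (simp add: mem_dyadic_iff)
  define \<Q> where "\<Q> = Qx ` \<Omega>"
  have lower: "\<alpha> * real (snd Q) < (\<Sum>x\<in>iv Q. f x)" if "Q \<in> \<Q>" for Q
    using that \<sigma>(1) unfolding \<Q>_def Qx_def big_def S_def by (auto simp: dyadic_def)
  show thesis
  proof (rule that[of \<Q>])
    have "\<Q> \<subseteq> Qx ` {x. f x \<noteq> 0}"
    proof
      fix Q assume Q: "Q \<in> \<Q>"
      then obtain x where x: "x \<in> \<Omega>" "Q = Qx x" by (auto simp: \<Q>_def)
      have "0 \<le> \<alpha> * real (snd Q)" using \<alpha> by simp
      then have "(\<Sum>x\<in>iv Q. f x) \<noteq> 0" using lower[OF Q] by linarith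
      then obtain y where "y \<in> iv Q" "f y \<noteq> 0" by (meson sum.neutral)
      moreover from this have "Q = Qx y" using same[OF x(1), of y] x(2) by simp
      ultimately show "Q \<in> Qx ` {x. f x \<noteq> 0}" by blast
    qed
    then show "finite \<Q>" using f(2) finite_surj by blast
    show "disjoint_family_on iv \<Q>" unfolding disjoint_family_on_def
    proof (intro ballI impI)
      fix Q Q' assume "Q \<in> \<Q>" "Q' \<in> \<Q>" "Q \<noteq> Q'"
      then obtain x x' where x: "x \<in> \<Omega>" "Q = Qx x" "x' \<in> \<Omega>" "Q' = Qx x'" unfolding \<Q>_def by auto
      show "iv Q \<inter> iv Q' = {}"
      proof (rule ccontr)
        assume "iv Q \<inter> iv Q' \<noteq> {}"
        then obtain y where "y \<in> iv (Qx x)" "y \<in> iv (Qx x')" using x by auto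
        then have "Qx y = Qx x" "Qx y = Qx x'" using same[OF x(1)] same[OF x(3)] by blast+
        then show False using \<open>Q \<noteq> Q'\<close> x by simp
      qed
    qed
    show "0 < snd Q" if "Q \<in> \<Q>" for Q using that unfolding \<Q>_def Qx_def by (auto simp: dyadic_def)
    show "(\<Sum>x\<in>iv Q. f x) \<le> 2 * \<alpha> * real (snd Q)" if Q: "Q \<in> \<Q>" for Q
    proof -
      obtain x where x: "x \<in> \<Omega>" "Q = Qx x" using Q by (auto simp: \<Q>_def)
      \<comment> \<open>By maximality the dyadic parent has mean at most \<alpha>, and its length is
        twice that of Q.\<close>
      have "\<not> Suc (\<sigma> x) \<in> big x" using \<sigma>(2)[OF x(1), of "Suc (\<sigma> x)"] by auto
      then have "S (Suc (\<sigma> x)) x \<le> \<alpha> * 2 ^ Suc (\<sigma> x)" by (simp add: big_def)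
      moreover have "(\<Sum>y\<in>iv Q. f y) \<le> S (Suc (\<sigma> x)) x" unfolding S_def
      proof (rule sum_mono2)
        show "iv Q \<subseteq> iv (dyadic (Suc (\<sigma> x)) x)"
        proof
          fix y assume "y \<in> iv Q"
          then have "dyadic (Suc (\<sigma> x)) y = dyadic (Suc (\<sigma> x)) x"
            using dyadic_eq[of y "\<sigma> x" x "Suc (\<sigma> x)"] x(2) unfolding Qx_def by simp
          then show "y \<in> iv (dyadic (Suc (\<sigma> x)) x)" by (metis mem_dyadic_iff)
        qed
      qed (use f in auto)
      ultimately show ?thesis unfolding x(2) Qx_def by (simp add: dyadic_def)
    qed
    show "f x \<le> \<alpha>" if "x \<notin> (\<Union>Q\<in>\<Q>. iv Q)" for x
    proof -
      have "x \<notin> \<Omega>" using that self unfolding \<Q>_def by blast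
      then have "\<not> 0 \<in> big x" by (auto simp: \<Omega>_def)
      moreover have "iv (dyadic 0 x) = {x}" by (auto simp: iv_def dyadic_def)
      ultimately show ?thesis unfolding big_def S_def by simp
    qed
  qed (rule lower)
qed

section \<open>Quadratic forms in mean zero atoms\<close>

lemma abs_sum_mult_le:
  fixes u v :: "'a \<Rightarrow> real"
  assumes "\<And>x. x \<in> A \<Longrightarrow> \<bar>v x\<bar> \<le> c"
  shows "\<bar>\<Sum>x\<in>A. u x * v x\<bar> \<le> (\<Sum>x\<in>A. \<bar>u x\<bar>) * c"
proof -
  have "\<bar>\<Sum>x\<in>A. u x * v x\<bar> \<le> (\<Sum>x\<in>A. \<bar>u x * v x\<bar>)" by (rule sum_abs)
  also have "\<dots> \<le> (\<Sum>x\<in>A. \<bar>u x\<bar> * c)" by (intro sum_mono) (auto simp: abs_mult intro!: mult_left_mono assms)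
  finally show ?thesis by (simp add: sum_distrib_right)
qed

text \<open>The bad part at a single scale, with D the spatial scale h M of the block. Intervals
  longer than D are excluded here and treated as part of an exceptional set.\<close>

locale atoms =
  fixes \<Q> :: "(int \<times> nat) set" and b :: "int \<Rightarrow> real" and \<alpha> D :: real
  assumes fin: "finite \<Q>" and disj: "disjoint_family_on iv \<Q>" and \<alpha>: "0 \<le> \<alpha>"
    and mean: "\<And>Q. Q \<in> \<Q> \<Longrightarrow> (\<Sum>x\<in>iv Q. b x) = 0"
    and mass_le: "\<And>Q. Q \<in> \<Q> \<Longrightarrow> (\<Sum>x\<in>iv Q. \<bar>b x\<bar>) \<le> 4 * \<alpha> * real (snd Q)"
    and len: "\<And>Q. Q \<in> \<Q> \<Longrightarrow> real (snd Q) \<le> D"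
begin

definition supp :: "int set" where "supp = (\<Union>Q\<in>\<Q>. iv Q)"

definition mass :: "int \<times> nat \<Rightarrow> real" where "mass Q = (\<Sum>x\<in>iv Q. \<bar>b x\<bar>)"

lemma mass_nonneg: "0 \<le> mass Q" unfolding mass_def by (intro sum_nonneg) auto

lemma finite_supp: "finite supp" unfolding supp_def using fin by auto

lemma sum_supp: "(\<Sum>x\<in>supp. g x) = (\<Sum>Q\<in>\<Q>. \<Sum>x\<in>iv Q. g x)"
  unfolding supp_def using fin disj by (intro sum.UNION_disjoint) (simp_all add: disjoint_family_on_def)

text \<open>The mass of each atom is at most 4 \<alpha> times its length, and disjoint intervals
  between s and t have total length at most t - s + 1.\<close>

lemma sum_mass_le:
  assumes "\<S> \<subseteq> \<Q>" "\<And>Q x. Q \<in> \<S> \<Longrightarrow> x \<in> iv Q \<Longrightarrow> s \<le> real_of_int x \<and> real_of_int x \<le> t" "s \<le> t"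
  shows "(\<Sum>Q\<in>\<S>. mass Q) \<le> 4 * \<alpha> * (t - s + 1)"
proof -
  have fS: "finite \<S>" using assms fin finite_subset by blast
  have "(\<Sum>Q\<in>\<S>. mass Q) \<le> (\<Sum>Q\<in>\<S>. 4 * \<alpha> * real (snd Q))"
    unfolding mass_def using mass_le assms by (intro sum_mono) auto
  also have "\<dots> = 4 * \<alpha> * (\<Sum>Q\<in>\<S>. real (snd Q))" by (simp add: sum_distrib_left)
  also have "(\<Sum>Q\<in>\<S>. real (snd Q)) = real (card (\<Union>Q\<in>\<S>. iv Q))"
  proof -
    have "\<forall>i\<in>\<S>. \<forall>j\<in>\<S>. i \<noteq> j \<longrightarrow> iv i \<inter> iv j = {}"
      using disj assms(1) unfolding disjoint_family_on_def by blast
    then show ?thesis using fS by (subst card_UN_disjoint) simp_all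
  qed
  also have "\<dots> \<le> t - s + 1"
  proof -
    have sub: "(\<Union>Q\<in>\<S>. iv Q) \<subseteq> {\<lceil>s\<rceil>..\<lfloor>t\<rfloor>}" using assms(2) by (auto simp: ceiling_le_iff le_floor_iff)
    have "card (\<Union>Q\<in>\<S>. iv Q) \<le> card {\<lceil>s\<rceil>..\<lfloor>t\<rfloor>}" by (rule card_mono[OF _ sub]) simp
    then have "real (card (\<Union>Q\<in>\<S>. iv Q)) \<le> real (nat (\<lfloor>t\<rfloor> + 1 - \<lceil>s\<rceil>))" by simp
    also have "\<dots> \<le> t - s + 1"
    proof (cases "0 \<le> \<lfloor>t\<rfloor> + 1 - \<lceil>s\<rceil>")
      case True
      then have "real (nat (\<lfloor>t\<rfloor> + 1 - \<lceil>s\<rceil>)) = real_of_int \<lfloor>t\<rfloor> + 1 - real_of_int \<lceil>s\<rceil>" by simp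
      moreover have "real_of_int \<lfloor>t\<rfloor> \<le> t" "s \<le> real_of_int \<lceil>s\<rceil>" by linarith+
      ultimately show ?thesis by linarith
    qed (use assms(3) in simp)
    finally show ?thesis .
  qed
  finally show ?thesis using \<alpha> by (simp add: mult_left_mono)
qed

text \<open>An interval of length at most D that meets the window of radius 5 D lies within 6 D of
  its centre, so the masses add up to 4 \<alpha> (12 D + 1), and 4 * 13 = 52.\<close>

lemma sum_near_le:
  assumes "1 \<le> D"
  shows "(\<Sum>y \<in> {y \<in> supp. \<bar>real_of_int (y - a)\<bar> < 5 * D}. \<bar>b y\<bar>) \<le> 52 * \<alpha> * D"
proof -
  define \<S> where "\<S> = {Q \<in> \<Q>. \<exists>y\<in>iv Q. \<bar>real_of_int (y - a)\<bar> < 5 * D}"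
  have "(\<Sum>y \<in> {y \<in> supp. \<bar>real_of_int (y - a)\<bar> < 5 * D}. \<bar>b y\<bar>) \<le> (\<Sum>y \<in> (\<Union>Q\<in>\<S>. iv Q). \<bar>b y\<bar>)"
    using fin by (intro sum_mono2) (auto simp: \<S>_def supp_def)
  also have "\<dots> = (\<Sum>Q\<in>\<S>. mass Q)" unfolding mass_def
    using fin disj by (intro sum.UNION_disjoint) (auto simp: \<S>_def disjoint_family_on_def)
  also have "\<dots> \<le> 4 * \<alpha> * ((real_of_int a + 6 * D) - (real_of_int a - 6 * D) + 1)"
  proof (rule sum_mass_le)
    fix Q x assume Q: "Q \<in> \<S>" "x \<in> iv Q"
    then obtain y where y: "y \<in> iv Q" "\<bar>real_of_int (y - a)\<bar> < 5 * D" "Q \<in> \<Q>" by (auto simp: \<S>_def)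
    have "\<bar>x - y\<bar> \<le> int (snd Q)" using y Q by (auto simp: iv_def)
    then have "real_of_int \<bar>x - y\<bar> \<le> real_of_int (int (snd Q))" by (rule of_int_le_iff[THEN iffD2])
    then have "\<bar>real_of_int x - real_of_int y\<bar> \<le> D" using len[OF y(3)] by simp
    then show "real_of_int a - 6 * D \<le> real_of_int x \<and> real_of_int x \<le> real_of_int a + 6 * D"
      using y(2) by (auto simp: abs_le_iff abs_less_iff)
  qed (use assms in \<open>auto simp: \<S>_def\<close>)
  also have "\<dots> \<le> 4 * \<alpha> * (13 * D)" using assms \<alpha> by (intro mult_left_mono) auto
  finally show ?thesis by simp
qed

text \<open>Here \<open>T Q\<close> stands for the kernel applied to the atom on Q. It lives within
  5 D of the left end of Q: 4 D from the kernel and D from the length of the interval.\<close>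

lemma sum_long_range_le:
  assumes D1: "1 \<le> D" and supp: "\<And>Q y. Q \<in> \<Q> \<Longrightarrow> 5 * D \<le> \<bar>real_of_int (y - fst Q)\<bar> \<Longrightarrow> T Q y = 0"
    and bd: "\<And>Q y. Q \<in> \<Q> \<Longrightarrow> \<bar>T Q y\<bar> \<le> mass Q * c Q" and c: "\<And>Q. Q \<in> \<Q> \<Longrightarrow> 0 \<le> c Q"
  shows "(\<Sum>Q\<in>\<Q>. \<Sum>y\<in>supp. \<bar>b y\<bar> * \<bar>T Q y\<bar>) \<le> (\<Sum>Q\<in>\<Q>. mass Q * (52 * \<alpha> * D * c Q))"
proof (rule sum_mono)
  fix Q assume Q: "Q \<in> \<Q>"
  let ?N = "{y \<in> supp. \<bar>real_of_int (y - fst Q)\<bar> < 5 * D}"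
  have "(\<Sum>y\<in>supp. \<bar>b y\<bar> * \<bar>T Q y\<bar>) = (\<Sum>y\<in>?N. \<bar>b y\<bar> * \<bar>T Q y\<bar>)"
    using finite_supp supp[OF Q] by (intro sum.mono_neutral_right) (auto simp: not_less)
  also have "\<dots> \<le> (\<Sum>y\<in>?N. \<bar>b y\<bar> * (mass Q * c Q))"
    using bd[OF Q] by (intro sum_mono mult_left_mono) auto
  also have "\<dots> = (\<Sum>y\<in>?N. \<bar>b y\<bar>) * (mass Q * c Q)" by (simp add: sum_distrib_right)
  also have "\<dots> \<le> (52 * \<alpha> * D) * (mass Q * c Q)"
    using sum_near_le[OF D1] c[OF Q] mass_nonneg by (intro mult_right_mono) auto
  finally show "(\<Sum>y\<in>supp. \<bar>b y\<bar> * \<bar>T Q y\<bar>) \<le> mass Q * (52 * \<alpha> * D * c Q)" by (simp add: mult_ac)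
qed

text \<open>By symmetry only pairs where Q' is no longer than Q are considered, at the cost of a
  factor 2. Such Q' interacting with Q lie within a stretch of length 3 L + 2 M, where L is the
  length of Q; without this ordering the stretch could be as long as D.\<close>

lemma sum_short_range_le:
  assumes M: "1 \<le> M"
  shows "(\<Sum>x\<in>supp. \<Sum>y\<in>supp. of_bool (\<bar>real_of_int (x - y)\<bar> < M) * (\<bar>b x\<bar> * \<bar>b y\<bar>)) \<le>
    24 * \<alpha> * (\<Sum>Q\<in>\<Q>. mass Q * (real (snd Q) + M))"
proof -
  define g where "g = (\<lambda>Q Q'. \<Sum>x\<in>iv Q. \<Sum>y\<in>iv Q'. of_bool (\<bar>real_of_int (x - y)\<bar> < M) * (\<bar>b x\<bar> * \<bar>b y\<bar>))"
  have g0: "0 \<le> g Q Q'" for Q Q' unfolding g_def by (intro sum_nonneg) auto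
  have gsym: "g Q Q' = g Q' Q" for Q Q'
    unfolding g_def by (subst sum.swap) (simp add: abs_minus_commute mult.commute)
  have gle: "g Q Q' \<le> mass Q * mass Q'" for Q Q'
    unfolding g_def mass_def sum_product by (intro sum_mono) auto
  have tot: "(\<Sum>x\<in>supp. \<Sum>y\<in>supp. of_bool (\<bar>real_of_int (x - y)\<bar> < M) * (\<bar>b x\<bar> * \<bar>b y\<bar>)) = (\<Sum>Q\<in>\<Q>. \<Sum>Q'\<in>\<Q>. g Q Q')"
    unfolding g_def sum_supp by (intro sum.cong refl) (rule sum.swap)
  define G where "G = (\<lambda>Q. \<Sum>Q'\<in>\<Q>. of_bool (snd Q' \<le> snd Q) * g Q Q')"
  have "(\<Sum>Q\<in>\<Q>. \<Sum>Q'\<in>\<Q>. g Q Q') \<le>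
      (\<Sum>Q\<in>\<Q>. \<Sum>Q'\<in>\<Q>. of_bool (snd Q' \<le> snd Q) * g Q Q' + of_bool (snd Q \<le> snd Q') * g Q Q')"
    using g0 by (intro sum_mono) auto
  also have "\<dots> = (\<Sum>Q\<in>\<Q>. G Q) + (\<Sum>Q\<in>\<Q>. \<Sum>Q'\<in>\<Q>. of_bool (snd Q \<le> snd Q') * g Q Q')"
    unfolding G_def by (simp add: sum.distrib)
  also have "(\<Sum>Q\<in>\<Q>. \<Sum>Q'\<in>\<Q>. of_bool (snd Q \<le> snd Q') * g Q Q') = (\<Sum>Q\<in>\<Q>. G Q)"
    unfolding G_def by (subst sum.swap) (simp add: gsym)
  also have "(\<Sum>Q\<in>\<Q>. G Q) + (\<Sum>Q\<in>\<Q>. G Q) = 2 * (\<Sum>Q\<in>\<Q>. G Q)" by simp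
  also have "(\<Sum>Q\<in>\<Q>. G Q) \<le> (\<Sum>Q\<in>\<Q>. 12 * \<alpha> * (mass Q * (real (snd Q) + M)))"
  proof (rule sum_mono)
    fix Q assume Q: "Q \<in> \<Q>"
    define \<S> where "\<S> = {Q' \<in> \<Q>. snd Q' \<le> snd Q \<and> g Q Q' \<noteq> 0}"
    let ?L = "real (snd Q)" and ?a = "real_of_int (fst Q)"
    have "G Q = (\<Sum>Q'\<in>\<S>. g Q Q')" unfolding G_def
      by (rule sum.mono_neutral_cong_right) (use fin in \<open>auto simp: \<S>_def\<close>)
    also have "\<dots> \<le> (\<Sum>Q'\<in>\<S>. mass Q * mass Q')" by (intro sum_mono gle)
    also have "\<dots> = mass Q * (\<Sum>Q'\<in>\<S>. mass Q')" by (simp add: sum_distrib_left)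
    finally have GQ: "G Q \<le> mass Q * (\<Sum>Q'\<in>\<S>. mass Q')" .
    have "(\<Sum>Q'\<in>\<S>. mass Q') \<le> 4 * \<alpha> * ((?a + 2 * ?L + M) - (?a - ?L - M) + 1)"
    proof (rule sum_mass_le)
      fix Q' z assume Q': "Q' \<in> \<S>" "z \<in> iv Q'"
      then have "g Q Q' \<noteq> 0" "snd Q' \<le> snd Q" by (auto simp: \<S>_def)
      have "\<exists>x\<in>iv Q. \<exists>y\<in>iv Q'. \<bar>real_of_int (x - y)\<bar> < M"
      proof (rule ccontr)
        assume "\<not> (\<exists>x\<in>iv Q. \<exists>y\<in>iv Q'. \<bar>real_of_int (x - y)\<bar> < M)"
        then have "g Q Q' = 0" unfolding g_def by (intro sum.neutral ballI) auto
        then show False using \<open>g Q Q' \<noteq> 0\<close> by simp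
      qed
      then obtain x y where xy: "x \<in> iv Q" "y \<in> iv Q'" "\<bar>real_of_int (x - y)\<bar> < M" by blast
      have "fst Q \<le> x" "x \<le> fst Q + int (snd Q)" "z - y \<le> int (snd Q)" "y - z \<le> int (snd Q)"
        using xy Q' \<open>snd Q' \<le> snd Q\<close> by (auto simp: iv_def)
      then have "?a \<le> real_of_int x" "real_of_int x \<le> ?a + ?L" "real_of_int z - real_of_int y \<le> ?L"
        "real_of_int y - real_of_int z \<le> ?L" by linarith+
      then show "?a - ?L - M \<le> real_of_int z \<and> real_of_int z \<le> ?a + 2 * ?L + M"
        using xy(3) by (auto simp: abs_less_iff)
    qed (use M in \<open>auto simp: \<S>_def\<close>)
    also have "\<dots> \<le> 4 * \<alpha> * (3 * (?L + M))" using M \<alpha> by (intro mult_left_mono) auto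
    finally have "mass Q * (\<Sum>Q'\<in>\<S>. mass Q') \<le> mass Q * (4 * \<alpha> * (3 * (?L + M)))"
      using mass_nonneg by (rule mult_left_mono)
    also have "\<dots> = 12 * \<alpha> * (mass Q * (?L + M))" by (simp add: mult_ac)
    finally show "G Q \<le> 12 * \<alpha> * (mass Q * (?L + M))" using GQ by linarith
  qed
  also have "2 * (\<Sum>Q\<in>\<Q>. 12 * \<alpha> * (mass Q * (real (snd Q) + M))) = 24 * \<alpha> * (\<Sum>Q\<in>\<Q>. mass Q * (real (snd Q) + M))"
    by (simp add: sum_distrib_left algebra_simps)
  finally show ?thesis unfolding tot by simp
qed

text \<open>Each atom pairs with total mass O(\<alpha> D) nearby, so a kernel bound C/D costs C
  \<alpha> times its mass. The mean zero property improves this by the factor length/D + \<eta> for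
  \<open>G\<close>; the \<eta> part of \<open>E\<close> is small as it stands; and its part near the
  origin meets only mass O(\<alpha> (length + M)).\<close>

lemma quadratic_form_le:
  fixes G E :: "int \<Rightarrow> real" and M C \<eta> :: real
  assumes M: "1 \<le> M" "M \<le> D" and C: "0 \<le> C" and \<eta>: "0 \<le> \<eta>"
    and G: "\<And>z z'. \<bar>G z - G z'\<bar> \<le> C * (real_of_int \<bar>z - z'\<bar> / D\<^sup>2 + \<eta> / D)"
    and E: "\<And>z. \<bar>E z\<bar> \<le> C * (\<eta> / D + of_bool (real_of_int \<bar>z\<bar> < M) / D)"
    and far: "\<And>z. 4 * D \<le> real_of_int \<bar>z\<bar> \<Longrightarrow> G z = 0" "\<And>z. 4 * D \<le> real_of_int \<bar>z\<bar> \<Longrightarrow> E z = 0"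
  shows "(\<Sum>x\<in>supp. \<Sum>y\<in>supp. b x * b y * (of_bool (x - y = 0) / M + G (x - y) + E (x - y))) \<le>
    (\<Sum>x\<in>supp. (b x)\<^sup>2) / M + 104 * C * \<alpha> * (\<Sum>Q\<in>\<Q>. mass Q * (real (snd Q) / D + \<eta> + M / D))"
proof -
  have D: "1 \<le> D" "0 < D" using M by auto
  have away: "4 * D \<le> real_of_int \<bar>x - y\<bar>"
    if "Q \<in> \<Q>" "x \<in> iv Q" "5 * D \<le> \<bar>real_of_int (y - fst Q)\<bar>" for Q x y
  proof -
    have "0 \<le> x - fst Q" "x - fst Q \<le> int (snd Q)" using that(2) by (auto simp: iv_def)
    then have "0 \<le> real_of_int x - real_of_int (fst Q)" "real_of_int x - real_of_int (fst Q) \<le> D"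
      using len[OF that(1)] by linarith+
    then show ?thesis using that(3) D by (simp add: abs_if split: if_splits)
  qed
  have diag: "(\<Sum>x\<in>supp. \<Sum>y\<in>supp. b x * b y * (of_bool (x - y = 0) / M)) = (\<Sum>x\<in>supp. (b x)\<^sup>2) / M"
  proof -
    have "(\<Sum>y\<in>supp. b x * b y * (of_bool (x - y = 0) / M)) = (b x)\<^sup>2 / M" if "x \<in> supp" for x
    proof -
      have "(\<Sum>y\<in>supp. b x * b y * (of_bool (x - y = 0) / M)) = (\<Sum>y\<in>supp. if y = x then b x * b x / M else 0)"
        by (intro sum.cong) auto
      then show ?thesis using that finite_supp by (simp add: power2_eq_square)
    qed
    then show ?thesis by (simp add: sum_divide_distrib)
  qed
  have Gpart: "(\<Sum>x\<in>supp. \<Sum>y\<in>supp. b x * b y * G (x - y)) \<le>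
      (\<Sum>Q\<in>\<Q>. mass Q * (52 * \<alpha> * D * (C * (real (snd Q) / D\<^sup>2 + \<eta> / D))))"
  proof -
    define T where "T = (\<lambda>Q y. \<Sum>x\<in>iv Q. b x * G (x - y))"
    have "(\<Sum>x\<in>supp. \<Sum>y\<in>supp. b x * b y * G (x - y)) = (\<Sum>Q\<in>\<Q>. \<Sum>y\<in>supp. b y * T Q y)"
      unfolding T_def sum_distrib_left sum_supp[of "\<lambda>x. \<Sum>y\<in>supp. b x * b y * G (x - y)"]
      by (rule sum.cong[OF refl], subst sum.swap) (simp add: mult_ac)
    also have "\<dots> \<le> (\<Sum>Q\<in>\<Q>. \<Sum>y\<in>supp. \<bar>b y\<bar> * \<bar>T Q y\<bar>)"
      by (intro sum_mono) (metis abs_ge_self abs_mult)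
    also have "\<dots> \<le> (\<Sum>Q\<in>\<Q>. mass Q * (52 * \<alpha> * D * (C * (real (snd Q) / D\<^sup>2 + \<eta> / D))))"
    proof (rule sum_long_range_le[OF D(1)])
      fix Q y assume Q: "Q \<in> \<Q>"
      show "0 \<le> C * (real (snd Q) / D\<^sup>2 + \<eta> / D)" using C D \<eta> by simp
      \<comment> \<open>Since the atom has mean zero, the kernel may be replaced by its increment
        from the left end of Q.\<close>
      have "T Q y = (\<Sum>x\<in>iv Q. b x * G (x - y)) - G (fst Q - y) * (\<Sum>x\<in>iv Q. b x)"
        unfolding T_def using mean[OF Q] by simp
      also have "\<dots> = (\<Sum>x\<in>iv Q. b x * (G (x - y) - G (fst Q - y)))"
        by (simp add: right_diff_distrib sum_subtractf sum_distrib_right mult.commute)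
      finally have Teq: "T Q y = (\<Sum>x\<in>iv Q. b x * (G (x - y) - G (fst Q - y)))" .
      show "\<bar>T Q y\<bar> \<le> mass Q * (C * (real (snd Q) / D\<^sup>2 + \<eta> / D))"
        unfolding Teq mass_def
      proof (rule abs_sum_mult_le)
        fix x assume "x \<in> iv Q"
        then have "\<bar>(x - y) - (fst Q - y)\<bar> \<le> int (snd Q)" by (auto simp: iv_def)
        then have "real_of_int \<bar>(x - y) - (fst Q - y)\<bar> \<le> real (snd Q)" by linarith
        then have "C * (real_of_int \<bar>(x - y) - (fst Q - y)\<bar> / D\<^sup>2 + \<eta> / D) \<le> C * (real (snd Q) / D\<^sup>2 + \<eta> / D)"
          using C D by (intro mult_left_mono add_right_mono divide_right_mono) auto
        then show "\<bar>G (x - y) - G (fst Q - y)\<bar> \<le> C * (real (snd Q) / D\<^sup>2 + \<eta> / D)"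
          using G[of "x - y" "fst Q - y"] by linarith
      qed
      assume "5 * D \<le> \<bar>real_of_int (y - fst Q)\<bar>"
      then show "T Q y = 0" unfolding T_def using far(1) away[OF Q] by (intro sum.neutral) auto
    qed
    finally show ?thesis .
  qed
  define F where "F = (\<lambda>z::int. of_bool (real_of_int \<bar>z\<bar> < 4 * D) * (C * (\<eta> / D)))"
  have EF: "\<bar>E z\<bar> \<le> F z + C / D * of_bool (\<bar>real_of_int z\<bar> < M)" for z
  proof (cases "real_of_int \<bar>z\<bar> < 4 * D")
    case True
    then show ?thesis using E[of z] unfolding F_def by (simp add: distrib_left)
  next
    case False
    then show ?thesis using far(2)[of z] C D unfolding F_def by simp
  qed
  have F0: "0 \<le> F z" "F z \<le> C * (\<eta> / D)" for z using C \<eta> D unfolding F_def by auto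
  have Epart: "(\<Sum>x\<in>supp. \<Sum>y\<in>supp. b x * b y * E (x - y)) \<le>
      (\<Sum>Q\<in>\<Q>. mass Q * (52 * \<alpha> * D * (C * (\<eta> / D)))) + C / D * (24 * \<alpha> * (\<Sum>Q\<in>\<Q>. mass Q * (real (snd Q) + M)))"
  proof -
    have "(\<Sum>x\<in>supp. \<Sum>y\<in>supp. b x * b y * E (x - y)) \<le> (\<Sum>x\<in>supp. \<Sum>y\<in>supp.
        \<bar>b x\<bar> * \<bar>b y\<bar> * F (x - y) + C / D * (of_bool (\<bar>real_of_int (x - y)\<bar> < M) * (\<bar>b x\<bar> * \<bar>b y\<bar>)))"
    proof (intro sum_mono)
      fix x y
      have "b x * b y * E (x - y) \<le> \<bar>b x\<bar> * \<bar>b y\<bar> * \<bar>E (x - y)\<bar>"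
        by (metis abs_ge_self abs_mult)
      also have "\<dots> \<le> \<bar>b x\<bar> * \<bar>b y\<bar> * (F (x - y) + C / D * of_bool (\<bar>real_of_int (x - y)\<bar> < M))"
        by (rule mult_left_mono[OF EF]) simp
      finally show "b x * b y * E (x - y) \<le>
        \<bar>b x\<bar> * \<bar>b y\<bar> * F (x - y) + C / D * (of_bool (\<bar>real_of_int (x - y)\<bar> < M) * (\<bar>b x\<bar> * \<bar>b y\<bar>))"
        by (simp add: distrib_left mult_ac)
    qed
    also have "\<dots> = (\<Sum>x\<in>supp. \<Sum>y\<in>supp. \<bar>b x\<bar> * \<bar>b y\<bar> * F (x - y)) +
        C / D * (\<Sum>x\<in>supp. \<Sum>y\<in>supp. of_bool (\<bar>real_of_int (x - y)\<bar> < M) * (\<bar>b x\<bar> * \<bar>b y\<bar>))"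
      by (simp only: sum.distrib sum_distrib_left)
    also have "(\<Sum>x\<in>supp. \<Sum>y\<in>supp. \<bar>b x\<bar> * \<bar>b y\<bar> * F (x - y)) \<le>
        (\<Sum>Q\<in>\<Q>. mass Q * (52 * \<alpha> * D * (C * (\<eta> / D))))"
    proof -
      define T where "T = (\<lambda>Q y. \<Sum>x\<in>iv Q. \<bar>b x\<bar> * F (x - y))"
      have T0: "0 \<le> T Q y" for Q y unfolding T_def using F0 by (intro sum_nonneg) auto
      have "(\<Sum>x\<in>supp. \<Sum>y\<in>supp. \<bar>b x\<bar> * \<bar>b y\<bar> * F (x - y)) = (\<Sum>Q\<in>\<Q>. \<Sum>y\<in>supp. \<bar>b y\<bar> * \<bar>T Q y\<bar>)"
        unfolding abs_of_nonneg[OF T0] unfolding T_def sum_distrib_left sum_supp[of "\<lambda>x. \<Sum>y\<in>supp. \<bar>b x\<bar> * \<bar>b y\<bar> * F (x - y)"]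
        by (rule sum.cong[OF refl], subst sum.swap) (simp add: mult_ac)
      also have "\<dots> \<le> (\<Sum>Q\<in>\<Q>. mass Q * (52 * \<alpha> * D * (C * (\<eta> / D))))"
      proof (rule sum_long_range_le[OF D(1)])
        fix Q y assume Q: "Q \<in> \<Q>"
        show "0 \<le> C * (\<eta> / D)" using C D \<eta> by simp
        have "\<bar>T Q y\<bar> \<le> (\<Sum>x\<in>iv Q. \<bar>\<bar>b x\<bar>\<bar>) * (C * (\<eta> / D))"
          unfolding T_def using F0 by (intro abs_sum_mult_le) auto
        then show "\<bar>T Q y\<bar> \<le> mass Q * (C * (\<eta> / D))" unfolding mass_def by simp
        assume "5 * D \<le> \<bar>real_of_int (y - fst Q)\<bar>"
        then show "T Q y = 0" unfolding T_def F_def using away[OF Q] by (intro sum.neutral) force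
      qed
      finally show ?thesis .
    qed
    also have "C / D * (\<Sum>x\<in>supp. \<Sum>y\<in>supp. of_bool (\<bar>real_of_int (x - y)\<bar> < M) * (\<bar>b x\<bar> * \<bar>b y\<bar>)) \<le>
        C / D * (24 * \<alpha> * (\<Sum>Q\<in>\<Q>. mass Q * (real (snd Q) + M)))"
      using sum_short_range_le[OF M(1)] C D by (intro mult_left_mono) auto
    finally show ?thesis by simp
  qed
  have "(\<Sum>x\<in>supp. \<Sum>y\<in>supp. b x * b y * (of_bool (x - y = 0) / M + G (x - y) + E (x - y))) =
      (\<Sum>x\<in>supp. (b x)\<^sup>2) / M + (\<Sum>x\<in>supp. \<Sum>y\<in>supp. b x * b y * G (x - y)) + (\<Sum>x\<in>supp. \<Sum>y\<in>supp. b x * b y * E (x - y))"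
    unfolding diag[symmetric] by (simp only: distrib_left sum.distrib)
  also have "\<dots> \<le> (\<Sum>x\<in>supp. (b x)\<^sup>2) / M + (\<Sum>Q\<in>\<Q>. mass Q * (52 * \<alpha> * D * (C * (real (snd Q) / D\<^sup>2 + \<eta> / D)))) +
      ((\<Sum>Q\<in>\<Q>. mass Q * (52 * \<alpha> * D * (C * (\<eta> / D)))) + C / D * (24 * \<alpha> * (\<Sum>Q\<in>\<Q>. mass Q * (real (snd Q) + M))))"
    using Gpart Epart by linarith
  also have "\<dots> = (\<Sum>x\<in>supp. (b x)\<^sup>2) / M + (\<Sum>Q\<in>\<Q>. mass Q * (52 * \<alpha> * D * (C * (real (snd Q) / D\<^sup>2 + \<eta> / D))) +
      mass Q * (52 * \<alpha> * D * (C * (\<eta> / D))) + C / D * (24 * \<alpha> * (mass Q * (real (snd Q) + M))))"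
    by (simp add: sum.distrib sum_distrib_left)
  also have "\<dots> \<le> (\<Sum>x\<in>supp. (b x)\<^sup>2) / M + (\<Sum>Q\<in>\<Q>. 104 * C * \<alpha> * (mass Q * (real (snd Q) / D + \<eta> + M / D)))"
  proof (intro add_left_mono sum_mono)
    fix Q
    define m where "m = C * \<alpha> * mass Q"
    have m0: "0 \<le> m" unfolding m_def using C \<alpha> mass_nonneg by simp
    have "mass Q * (52 * \<alpha> * D * (C * (real (snd Q) / D\<^sup>2 + \<eta> / D))) = m * (52 * (real (snd Q) / D) + 52 * \<eta>)"
      unfolding m_def using D by (simp add: field_simps power2_eq_square)
    moreover have "mass Q * (52 * \<alpha> * D * (C * (\<eta> / D))) = m * (52 * \<eta>)"
      unfolding m_def using D by simp
    moreover have "C / D * (24 * \<alpha> * (mass Q * (real (snd Q) + M))) = m * (24 * (real (snd Q) / D) + 24 * (M / D))"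
      unfolding m_def using D by (simp add: field_simps)
    moreover have "104 * C * \<alpha> * (mass Q * (real (snd Q) / D + \<eta> + M / D)) = m * (104 * (real (snd Q) / D) + 104 * \<eta> + 104 * (M / D))"
      unfolding m_def by (simp add: algebra_simps)
    moreover have "m * (52 * (real (snd Q) / D) + 52 * \<eta>) + m * (52 * \<eta>) + m * (24 * (real (snd Q) / D) + 24 * (M / D)) =
        m * (76 * (real (snd Q) / D) + 104 * \<eta> + 24 * (M / D))" by (simp add: algebra_simps)
    moreover have "m * (76 * (real (snd Q) / D) + 104 * \<eta> + 24 * (M / D)) \<le> m * (104 * (real (snd Q) / D) + 104 * \<eta> + 104 * (M / D))"
    proof (rule mult_left_mono[OF _ m0])
      have "0 \<le> real (snd Q) / D" "0 \<le> M / D" using D M by auto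
      then show "76 * (real (snd Q) / D) + 104 * \<eta> + 24 * (M / D) \<le> 104 * (real (snd Q) / D) + 104 * \<eta> + 104 * (M / D)"
        by linarith
    qed
    ultimately show "mass Q * (52 * \<alpha> * D * (C * (real (snd Q) / D\<^sup>2 + \<eta> / D))) +
      mass Q * (52 * \<alpha> * D * (C * (\<eta> / D))) + C / D * (24 * \<alpha> * (mass Q * (real (snd Q) + M))) \<le>
      104 * C * \<alpha> * (mass Q * (real (snd Q) / D + \<eta> + M / D))" by presburger
  qed
  finally show ?thesis by (simp add: sum_distrib_left)
qed

end

section \<open>Weak type bound for block averages\<close>

text \<open>With \<beta> the fractional part of b, the floor of b + \<tau> jumps at \<tau> = 1 -
  \<beta>. Before and after the jump the condition confines d + \<beta> + \<tau> to a unit window,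
  and the two resulting lengths always add up to the tent, whatever \<beta> is.\<close>

lemma has_integral_floor_difference:
  fixes a b :: real and z :: int
  shows "((\<lambda>\<tau>. of_bool (\<lfloor>a + \<tau>\<rfloor> - \<lfloor>b + \<tau>\<rfloor> = z)) has_integral tent (a - b - z)) {0..1}"
proof -
  define d \<beta> where "d = a - b - z" and "\<beta> = b - \<lfloor>b\<rfloor>"
  have \<beta>: "0 \<le> \<beta>" "\<beta> < 1" unfolding \<beta>_def by linarith+
  define P1 P2 where "P1 = (\<lambda>\<tau>. \<tau> < 1 - \<beta> \<and> 0 \<le> d + \<beta> + \<tau> \<and> d + \<beta> + \<tau> < 1)"
    and "P2 = (\<lambda>\<tau>. 1 - \<beta> \<le> \<tau> \<and> 1 \<le> d + \<beta> + \<tau> \<and> d + \<beta> + \<tau> < 2)"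
  have split: "of_bool (\<lfloor>a + \<tau>\<rfloor> - \<lfloor>b + \<tau>\<rfloor> = z) = (of_bool (P1 \<tau>) + of_bool (P2 \<tau>) :: real)" if \<tau>: "\<tau> \<in> {0..1}" for \<tau>
  proof -
    have "\<lfloor>b + \<tau>\<rfloor> = \<lfloor>b\<rfloor> + \<lfloor>\<beta> + \<tau>\<rfloor>" unfolding \<beta>_def by linarith
    moreover have "\<lfloor>a + \<tau>\<rfloor> = z + \<lfloor>b\<rfloor> + \<lfloor>d + \<beta> + \<tau>\<rfloor>" unfolding d_def \<beta>_def by linarith
    ultimately have "(\<lfloor>a + \<tau>\<rfloor> - \<lfloor>b + \<tau>\<rfloor> = z) \<longleftrightarrow> \<lfloor>d + \<beta> + \<tau>\<rfloor> = \<lfloor>\<beta> + \<tau>\<rfloor>" by linarith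
    also have "\<dots> \<longleftrightarrow> P1 \<tau> \<or> P2 \<tau>"
    proof (cases "\<tau> < 1 - \<beta>")
      case True
      then have fl: "\<lfloor>\<beta> + \<tau>\<rfloor> = 0" using \<tau> \<beta> by (simp add: floor_eq_iff)
      show ?thesis using True unfolding P1_def P2_def fl by (auto simp: floor_eq_iff)
    next
      case False
      then have fl: "\<lfloor>\<beta> + \<tau>\<rfloor> = 1" using \<tau> \<beta> by (simp add: floor_eq_iff)
      show ?thesis using False unfolding P1_def P2_def fl by (auto simp: floor_eq_iff)
    qed
    finally show ?thesis unfolding P1_def P2_def by auto
  qed
  have "((\<lambda>\<tau>. of_bool (P1 \<tau>)) has_integral max 0 (min (1 - \<beta>) (1 - d - \<beta>) - max 0 (- d - \<beta>))) {0..1}"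
    by (rule has_integral_of_bool_interval) (use \<beta> in \<open>auto simp: P1_def\<close>)
  moreover have "((\<lambda>\<tau>. of_bool (P2 \<tau>)) has_integral max 0 (min 1 (2 - d - \<beta>) - max (1 - \<beta>) (1 - d - \<beta>))) {0..1}"
    by (rule has_integral_of_bool_interval) (use \<beta> in \<open>auto simp: P2_def\<close>)
  ultimately have "((\<lambda>\<tau>. of_bool (P1 \<tau>) + of_bool (P2 \<tau>)) has_integral
    max 0 (min (1 - \<beta>) (1 - d - \<beta>) - max 0 (- d - \<beta>)) + max 0 (min 1 (2 - d - \<beta>) - max (1 - \<beta>) (1 - d - \<beta>))) {0..1}"
    by (rule has_integral_add)
  moreover have "max 0 (min (1 - \<beta>) (1 - d - \<beta>) - max 0 (- d - \<beta>)) + max 0 (min 1 (2 - d - \<beta>) - max (1 - \<beta>) (1 - d - \<beta>)) = tent d"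
    using \<beta> by (simp add: tent_def max_def min_def abs_if)
  ultimately have "((\<lambda>\<tau>. of_bool (P1 \<tau>) + of_bool (P2 \<tau>)) has_integral tent d) {0..1}" by simp
  then show ?thesis unfolding d_def[symmetric]
    by (rule has_integral_eq[rotated]) (simp add: split)
qed

lemma sum_geometric_le:
  fixes r :: real assumes "finite A" "0 \<le> r" "r < 1"
  shows "(\<Sum>k\<in>A. r ^ k) \<le> 1 / (1 - r)"
proof -
  have "(\<Sum>k\<in>A. r ^ k) \<le> (\<Sum>k. r ^ k)" using assms by (intro sum_le_suminf) (auto intro: summable_geometric)
  then show ?thesis using assms by (simp add: suminf_geometric)
qed

text \<open>The first admissible scale contributes at most 1 and each later one at most half of the
  previous. It is applied to interval lengths against h (2^k) and to values of f against \<alpha>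
  2^k.\<close>

lemma sum_lacunary_le:
  fixes d :: "nat \<Rightarrow> real" and y :: real
  assumes A: "finite A" "A \<subseteq> {start..}" and d: "\<And>k. start \<le> k \<Longrightarrow> 0 < d k \<and> 2 * d k \<le> d (Suc k)"
    and y: "0 \<le> y" "\<And>k. k \<in> A \<Longrightarrow> y \<le> d k"
  shows "(\<Sum>k\<in>A. y / d k) \<le> 2"
proof (cases "A = {}")
  case False
  define m where "m = Min A"
  have m: "m \<in> A" "\<And>k. k \<in> A \<Longrightarrow> m \<le> k" using A False unfolding m_def by auto
  have grow: "2 ^ j * d m \<le> d (m + j)" for j
  proof (induction j)
    case (Suc j)
    have "2 ^ Suc j * d m = 2 * (2 ^ j * d m)" by simp
    also have "\<dots> \<le> 2 * d (m + j)" using Suc by simp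
    also have "\<dots> \<le> d (m + Suc j)" using d[of "m + j"] A m by auto
    finally show ?case .
  qed simp
  have "(\<Sum>k\<in>A. y / d k) \<le> (\<Sum>k\<in>A. (1/2) ^ (k - m))"
  proof (rule sum_mono)
    fix k assume k: "k \<in> A"
    have pos: "0 < d k" "0 < d m" using d A k m by auto
    have "y * 2 ^ (k - m) \<le> d m * 2 ^ (k - m)" using y(2)[OF m(1)] by (intro mult_right_mono) auto
    also have "\<dots> \<le> d k" using grow[of "k - m"] m(2)[OF k] by (simp add: mult.commute)
    finally show "y / d k \<le> (1/2) ^ (k - m)" using pos by (simp add: field_simps)
  qed
  also have "\<dots> = (\<Sum>j\<in>(\<lambda>k. k - m) ` A. (1/2) ^ j)"
    by (subst sum.reindex) (auto intro!: inj_onI simp: eq_diff_iff m(2))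
  also have "\<dots> \<le> 1 / (1 - 1/2)" using A by (intro sum_geometric_le) auto
  finally show ?thesis by simp
qed simp

lemma sum_powers_of_2_less:
  fixes y :: real assumes "finite A" "\<And>k. k \<in> A \<Longrightarrow> 2 ^ k < y" "0 \<le> y"
  shows "(\<Sum>k\<in>A. 2 ^ k) \<le> 2 * y"
proof (cases "A = {}")
  case False
  have "(\<Sum>k\<in>A. (2::real) ^ k) \<le> (\<Sum>k<Suc (Max A). 2 ^ k)"
    using assms(1) by (intro sum_mono2) (auto simp: le_imp_less_Suc)
  also have "\<dots> = 2 ^ Suc (Max A) - 1" by (simp add: sum_gp_strict del: sum.lessThan_Suc)
  also have "\<dots> \<le> 2 * y" using assms(2)[OF Max_in[OF assms(1) False]] by simp
  finally show ?thesis .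
qed (use assms in simp)

definition block_avg :: "(real \<Rightarrow> real) \<Rightarrow> nat \<Rightarrow> real \<Rightarrow> (int \<Rightarrow> real) \<Rightarrow> int \<Rightarrow> real" where
  "block_avg h k \<tau> f n = (\<Sum>p\<in>{2 ^ k..<2 * 2 ^ k}. f (n - \<lfloor>h (real p) + \<tau>\<rfloor>)) / 2 ^ k"

text \<open>A shift by \<tau> moves each floor by 0 or 1, so every value seen from n is seen after
  the shift from n or from n + 1. This permits averaging over \<tau> although the averages of
  interest have \<tau> = 0.\<close>

lemma block_avg_floor_le:
  assumes "\<And>x. 0 \<le> f x" "0 \<le> \<tau>" "\<tau> \<le> 1"
  shows "block_avg h k 0 f n \<le> block_avg h k \<tau> f n + block_avg h k \<tau> f (n + 1)"
proof -
  have "f (n - \<lfloor>h (real p) + 0\<rfloor>) \<le> f (n - \<lfloor>h (real p) + \<tau>\<rfloor>) + f (n + 1 - \<lfloor>h (real p) + \<tau>\<rfloor>)" for p :: nat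
  proof -
    have "\<lfloor>h (real p) + \<tau>\<rfloor> = \<lfloor>h (real p)\<rfloor> \<or> \<lfloor>h (real p) + \<tau>\<rfloor> = \<lfloor>h (real p)\<rfloor> + 1"
      using assms(2,3) by linarith
    then show ?thesis using assms(1) by (auto simp: add_increasing add_increasing2)
  qed
  then have "block_avg h k 0 f n \<le>
      (\<Sum>p\<in>{2 ^ k..<2 * 2 ^ k}. f (n - \<lfloor>h (real p) + \<tau>\<rfloor>) + f (n + 1 - \<lfloor>h (real p) + \<tau>\<rfloor>)) / 2 ^ k"
    unfolding block_avg_def by (intro divide_right_mono sum_mono) auto
  then show ?thesis unfolding block_avg_def by (simp add: sum.distrib add_divide_distrib)
qed

lemma block_avg_mono_on:
  assumes "\<And>p. p \<in> {2 ^ k..<2 * 2 ^ k} \<Longrightarrow> f (n - \<lfloor>h (real p) + \<tau>\<rfloor>) \<le> c + g (n - \<lfloor>h (real p) + \<tau>\<rfloor>)"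
  shows "block_avg h k \<tau> f n \<le> c + block_avg h k \<tau> g n"
proof -
  have "(\<Sum>p\<in>{2 ^ k..<2 * 2 ^ k}. f (n - \<lfloor>h (real p) + \<tau>\<rfloor>)) \<le> (\<Sum>p\<in>{2 ^ k..<2 * 2 ^ k}. c + g (n - \<lfloor>h (real p) + \<tau>\<rfloor>))"
    using assms by (intro sum_mono) auto
  also have "\<dots> = 2 ^ k * c + (\<Sum>p\<in>{2 ^ k..<2 * 2 ^ k}. g (n - \<lfloor>h (real p) + \<tau>\<rfloor>))"
    by (simp add: sum.distrib)
  finally show ?thesis unfolding block_avg_def by (simp add: field_simps)
qed

text \<open>Averaging over the shift \<open>\<tau>\<close> makes the square function of the block average a function of the
  differences \<open>h p - h q\<close> alone, without any dependence on the fractional parts of \<open>h p\<close>.\<close>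

lemma integral_block_avg_square:
  fixes b :: "int \<Rightarrow> real" and X N :: "int set"
  assumes X: "finite X" "\<And>x. x \<notin> X \<Longrightarrow> b x = 0" and N: "finite N"
  shows "\<exists>F. (F has_integral (\<Sum>x\<in>X. \<Sum>y\<in>X. b x * b y *
      ((\<Sum>p\<in>{2 ^ k..<2 * 2 ^ k}. \<Sum>q\<in>{2 ^ k..<2 * 2 ^ k}. tent (h (real p) - h (real q) - of_int (x - y))) / (2 ^ k)\<^sup>2))) {0..1} \<and>
    (\<forall>\<tau>\<in>{0..1}. (\<Sum>n\<in>N. (block_avg h k \<tau> b n)\<^sup>2) \<le> F \<tau>)"
proof -
  let ?P = "{2 ^ k..<2 * 2 ^ k} :: nat set"
  define F where "F = (\<lambda>\<tau>. (\<Sum>x\<in>X. \<Sum>y\<in>X. b x * b y *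
     ((\<Sum>p\<in>?P. \<Sum>q\<in>?P. of_bool (\<lfloor>h (real p) + \<tau>\<rfloor> - \<lfloor>h (real q) + \<tau>\<rfloor> = x - y)) / (2 ^ k)\<^sup>2)))"
  have "(F has_integral (\<Sum>x\<in>X. \<Sum>y\<in>X. b x * b y *
      ((\<Sum>p\<in>?P. \<Sum>q\<in>?P. tent (h (real p) - h (real q) - of_int (x - y))) / (2 ^ k)\<^sup>2))) {0..1}"
    unfolding F_def
    by (intro has_integral_sum has_integral_mult_right has_integral_divide has_integral_floor_difference X(1)) auto
  moreover have "(\<Sum>n\<in>N. (block_avg h k \<tau> b n)\<^sup>2) \<le> F \<tau>" if \<tau>: "\<tau> \<in> {0..1}" for \<tau>
  proof -
    define a where "a = (\<lambda>p::nat. \<lfloor>h (real p) + \<tau>\<rfloor>)"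
    \<comment> \<open>Enlarging \<open>N\<close> to all points where the block average can be
      nonzero makes the sum over n of the products of indicators exact; for squares the enlargement
      only increases the sum.\<close>
    define N' where "N' = N \<union> (\<lambda>(x, p). x + a p) ` (X \<times> ?P)"
    have N': "finite N'" "N \<subseteq> N'" unfolding N'_def using N X by auto
    have avg: "block_avg h k \<tau> b n = (\<Sum>p\<in>?P. \<Sum>x\<in>X. b x * of_bool (n = x + a p)) / 2 ^ k" for n
    proof -
      have "b (n - a p) = (\<Sum>x\<in>X. b x * of_bool (n = x + a p))" for p
      proof -
        have "(\<Sum>x\<in>X. b x * of_bool (n = x + a p)) = (\<Sum>x\<in>X. if x = n - a p then b x else 0)"
          by (intro sum.cong) auto
        also have "\<dots> = b (n - a p)" using X by simp
        finally show ?thesis by simp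
      qed
      then show ?thesis unfolding block_avg_def a_def by simp
    qed
    have "(\<Sum>n\<in>N. (block_avg h k \<tau> b n)\<^sup>2) \<le> (\<Sum>n\<in>N'. (block_avg h k \<tau> b n)\<^sup>2)"
      using N' by (intro sum_mono2) auto
    also have "\<dots> = (\<Sum>n\<in>N'. (\<Sum>x\<in>X. \<Sum>p\<in>?P. b x * of_bool (n = x + a p))\<^sup>2 / (2 ^ k)\<^sup>2)"
      unfolding avg power_divide by (subst sum.swap) simp
    also have "\<dots> = (\<Sum>n\<in>N'. \<Sum>x\<in>X. \<Sum>y\<in>X. \<Sum>p\<in>?P. \<Sum>q\<in>?P.
        b x * b y * (of_bool (n = x + a p) * of_bool (n = y + a q)) / (2 ^ k)\<^sup>2)"
      unfolding power2_eq_square[of "sum _ _"] sum_product sum_divide_distrib by (simp add: mult_ac)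
    also have "\<dots> = (\<Sum>x\<in>X. \<Sum>y\<in>X. \<Sum>p\<in>?P. \<Sum>q\<in>?P.
        \<Sum>n\<in>N'. b x * b y * (of_bool (n = x + a p) * of_bool (n = y + a q)) / (2 ^ k)\<^sup>2)"
      by (simp only: sum.swap[of _ _ N'])
    also have "\<dots> = (\<Sum>x\<in>X. \<Sum>y\<in>X. \<Sum>p\<in>?P. \<Sum>q\<in>?P. b x * b y * of_bool (y + a q = x + a p) / (2 ^ k)\<^sup>2)"
    proof (intro sum.cong refl)
      fix x y p q assume "x \<in> X" "y \<in> X" "p \<in> ?P" "q \<in> ?P"
      then have mem: "x + a p \<in> N'" unfolding N'_def by auto
      have "(\<Sum>n\<in>N'. b x * b y * (of_bool (n = x + a p) * of_bool (n = y + a q)) / (2 ^ k)\<^sup>2) =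
          (\<Sum>n\<in>N'. if n = x + a p then b x * b y * of_bool (n = y + a q) / (2 ^ k)\<^sup>2 else 0)"
        by (intro sum.cong) auto
      also have "\<dots> = b x * b y * of_bool (y + a q = x + a p) / (2 ^ k)\<^sup>2" using mem N' by (auto simp: of_bool_def)
      finally show "(\<Sum>n\<in>N'. b x * b y * (of_bool (n = x + a p) * of_bool (n = y + a q)) / (2 ^ k)\<^sup>2) =
        b x * b y * of_bool (y + a q = x + a p) / (2 ^ k)\<^sup>2" .
    qed
    also have "\<dots> = (\<Sum>x\<in>X. \<Sum>y\<in>X. b x * b y * ((\<Sum>p\<in>?P. \<Sum>q\<in>?P. of_bool (a q - a p = x - y)) / (2 ^ k)\<^sup>2))"
    proof -
      have "(y + a q = x + a p) = (a q - a p = x - y)" for x y p q by auto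
      then show ?thesis by (simp only: sum_distrib_left sum_divide_distrib times_divide_eq_right)
    qed
    also have "\<dots> = (\<Sum>x\<in>X. \<Sum>y\<in>X. b x * b y * ((\<Sum>p\<in>?P. \<Sum>q\<in>?P. of_bool (a p - a q = x - y)) / (2 ^ k)\<^sup>2))"
    proof -
      have "(\<Sum>p\<in>?P. \<Sum>q\<in>?P. of_bool (a q - a p = x - y) :: real) = (\<Sum>p\<in>?P. \<Sum>q\<in>?P. of_bool (a p - a q = x - y))"
        for x y by (rule sum.swap)
      then show ?thesis by (simp only:)
    qed
    also have "\<dots> = F \<tau>" unfolding F_def a_def ..
    finally show ?thesis .
  qed
  ultimately show ?thesis by blast
qed

section \<open>The square function argument over all scales\<close>

context regvar begin

lemma h_dyadic_growth:
  assumes "X < 2 ^ k" "2 \<le> (2::nat) ^ k"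
  shows "0 < h (2 ^ k)" "2 * h (2 ^ k) \<le> h (2 ^ Suc k)"
    "\<And>p. p \<in> {2 ^ k..<2 * 2 ^ k::nat} \<Longrightarrow> h (real p) \<le> 4 * h (2 ^ k)"
    "\<And>p. p \<in> {2 ^ k..<2 * 2 ^ k::nat} \<Longrightarrow> 0 \<le> h (real p)"
    "2 ^ k / h (2 ^ k) \<le> (2 powr (1 - c)) ^ k"
proof -
  interpret regvar_scale h h' h'' \<kappa>' X e c C0 "2 ^ k" by unfold_locales (use assms in auto)
  show "0 < h (2 ^ k)" using D_pos unfolding D_def by simp
  show "2 * h (2 ^ k) \<le> h (2 ^ Suc k)" using h_dyadic(4)[of "2 ^ k"] unfolding D_def by simp
  have P: "2 ^ k \<le> real p \<and> real p \<le> 2 * 2 ^ k" if "p \<in> {2 ^ k..<2 * 2 ^ k::nat}" for p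
  proof -
    have "real (2 ^ k) \<le> real p" "real p \<le> real (2 * 2 ^ k)" using that by (simp_all del: of_nat_power of_nat_mult)
    then show ?thesis by simp
  qed
  show "h (real p) \<le> 4 * h (2 ^ k)" if "p \<in> {2 ^ k..<2 * 2 ^ k::nat}" for p
    using h_dyadic(2)[of "real p"] P[OF that] unfolding D_def by simp
  show "0 \<le> h (real p)" if "p \<in> {2 ^ k..<2 * 2 ^ k::nat}" for p
    using h_dyadic(1)[of "real p"] P[OF that] D_pos by simp
  have "(2 ^ k) powr c \<le> h (2 ^ k)" using h_lower assms by simp
  then have "2 ^ k / h (2 ^ k) \<le> 2 ^ k / (2 ^ k) powr c"
    by (intro divide_left_mono mult_pos_pos) (use \<open>0 < h (2 ^ k)\<close> in auto)
  also have "\<dots> = (2 ^ k) powr (1 - c)" by (simp add: powr_diff)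
  also have "\<dots> = (2 powr (1 - c)) ^ k"
    by (simp add: powr_realpow[symmetric] powr_powr mult.commute)
  finally show "2 ^ k / h (2 ^ k) \<le> (2 powr (1 - c)) ^ k" .
qed

text \<open>Finite support of f and a finite set F of points keep all sums finite, and the constant
  depends on neither. The scale \<open>k0\<close> only ensures that blocks lie in the range where h
  is controlled.\<close>

lemma weak_type_block_avg:
  "\<exists>C>0. \<exists>k0. \<forall>(f :: int \<Rightarrow> real) \<alpha> F. (\<forall>x. 0 \<le> f x) \<longrightarrow> finite {x. f x \<noteq> 0} \<longrightarrow> 0 < \<alpha> \<longrightarrow> finite F \<longrightarrow>
     (\<forall>n\<in>F. \<exists>k\<ge>k0. 6 * \<alpha> < block_avg h k 0 f n) \<longrightarrow> real (card F) \<le> C / \<alpha> * (\<Sum>x | f x \<noteq> 0. f x)"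
proof -
  obtain C1 where C1: "C1 > 0" and dec: "\<And>M::nat. X < real M \<and> 2 \<le> M \<Longrightarrow> (\<exists>G E :: int \<Rightarrow> real. 
     (\<forall>z. (\<Sum>p\<in>{M..<2*M}. \<Sum>q\<in>{M..<2*M}. tent (h p - h q - of_int z)) / (real M)\<^sup>2 =
        of_bool (z = 0) / real M + G z + E z) \<and>
     (\<forall>z z'. \<bar>G z - G z'\<bar> \<le> C1 * (real_of_int \<bar>z - z'\<bar> / (h M)\<^sup>2 + real M powr (-1/20) / h M)) \<and>
     (\<forall>z. \<bar>E z\<bar> \<le> C1 * (real M powr (-1/20) / h M + of_bool (real_of_int \<bar>z\<bar> < real M) / h M)) \<and>
     (\<forall>z. 4 * h M \<le> real_of_int \<bar>z\<bar> \<longrightarrow> G z = 0 \<and> E z = 0))"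
    using kernel_decomposition by blast
  obtain k1 :: nat where k1: "X < 2 ^ k1" using real_arch_pow[of 2 X] by auto
  define k0 where "k0 = Suc k1"
  have k0: "X < 2 ^ k" "2 \<le> (2::nat) ^ k" if "k0 \<le> k" for k
  proof -
    have "(2::real) ^ k1 \<le> 2 ^ k" using that unfolding k0_def by (intro power_increasing) auto
    then show "X < 2 ^ k" using k1 by linarith
    have "(2::nat) ^ 1 \<le> 2 ^ k" using that unfolding k0_def by (intro power_increasing) auto
    then show "2 \<le> (2::nat) ^ k" by simp
  qed
  define r1 r2 where "r1 = (2::real) powr (-1/20)" and "r2 = (2::real) powr (1 - c)"
  have r: "0 \<le> r1" "r1 < 1" "0 \<le> r2" "r2 < 1"
    unfolding r1_def r2_def using c powr_less_mono[of "-1/20" 0 "2::real"] powr_less_mono[of "1 - c" 0 "2::real"] by auto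
  define C2 where "C2 = 2 + 1 / (1 - r1) + 1 / (1 - r2)"
  have C2: "C2 > 0" unfolding C2_def using r by (simp add: add_pos_pos)
  define C where "C = 2 * (2 + 208 * C1 * C2) + 20"
  have C: "C > 0" unfolding C_def using C1 C2 by (simp add: add_pos_pos)
  have main: "real (card F) \<le> C / \<alpha> * (\<Sum>x | f x \<noteq> 0. f x)"
    if f: "\<And>x. 0 \<le> f x" "finite {x. f x \<noteq> 0}" and \<alpha>: "0 < \<alpha>" and F: "finite F"
      and big: "\<And>n. n \<in> F \<Longrightarrow> \<exists>k\<ge>k0. 6 * \<alpha> < block_avg h k 0 f n" for f :: "int \<Rightarrow> real" and \<alpha> F
  proof -
    define T where "T = (\<Sum>x | f x \<noteq> 0. f x)"
    have T0: "0 \<le> T" unfolding T_def using f by (intro sum_nonneg) auto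
    \<comment> \<open>Linearisation: one scale is fixed for each point of F, so only the finite set
      \<open>A\<close> of these scales enters, and the supremum is bounded by a square sum over
      A.\<close>
    obtain kk where kk: "\<And>n. n \<in> F \<Longrightarrow> k0 \<le> kk n \<and> 6 * \<alpha> < block_avg h (kk n) 0 f n" using big by metis
    define A where "A = kk ` F"
    have A: "finite A" "A \<subseteq> {k0..}" unfolding A_def using F kk by auto
    obtain \<Q> where \<Q>: "finite \<Q>" "disjoint_family_on iv \<Q>" "\<And>Q. Q \<in> \<Q> \<Longrightarrow> 0 < snd Q"
      "\<And>Q. Q \<in> \<Q> \<Longrightarrow> \<alpha> * real (snd Q) < (\<Sum>x\<in>iv Q. f x)"
      "\<And>Q. Q \<in> \<Q> \<Longrightarrow> (\<Sum>x\<in>iv Q. f x) \<le> 2 * \<alpha> * real (snd Q)"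
      "\<And>x. x \<notin> (\<Union>Q\<in>\<Q>. iv Q) \<Longrightarrow> f x \<le> \<alpha>"
      using calderon_zygmund_intervals[OF f \<alpha>] by metis
    have sum_le_T: "(\<Sum>x\<in>Z. f x) \<le> T" if "finite Z" for Z
    proof -
      have "(\<Sum>x\<in>Z. f x) = (\<Sum>x\<in>Z \<inter> {x. f x \<noteq> 0}. f x)" using that by (intro sum.mono_neutral_right) auto
      also have "\<dots> \<le> T" unfolding T_def using f by (intro sum_mono2) auto
      finally show ?thesis .
    qed
    have \<Q>T: "(\<Sum>Q\<in>\<Q>. \<Sum>x\<in>iv Q. f x) \<le> T"
    proof -
      have "(\<Sum>Q\<in>\<Q>. \<Sum>x\<in>iv Q. f x) = (\<Sum>x\<in>(\<Union>Q\<in>\<Q>. iv Q). f x)"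
        using \<Q>(1,2) by (intro sum.UNION_disjoint[symmetric]) (simp_all add: disjoint_family_on_def)
      also have "\<dots> \<le> T" using \<Q>(1) by (intro sum_le_T) auto
      finally show ?thesis .
    qed
    define fk where "fk = (\<lambda>k x. f x * of_bool (f x \<le> \<alpha> * 2 ^ k))"
    have fk: "0 \<le> fk k x" "fk k x \<le> f x" for k x unfolding fk_def using f by auto
    \<comment> \<open>At scale k only intervals shorter than h (2^k) can profit from the Lipschitz
      bound on the kernel.\<close>
    define Qk where "Qk = (\<lambda>k. {Q \<in> \<Q>. real (snd Q) \<le> h (2 ^ k)})"
    define av where "av = (\<lambda>k Q. (\<Sum>x\<in>iv Q. fk k x) / real (snd Q))"
    \<comment> \<open>The mean of the truncated function is subtracted, so that the bad part has
      mean zero on each interval at every scale.\<close>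
    define b where "b = (\<lambda>k x. \<Sum>Q\<in>Qk k. of_bool (x \<in> iv Q) * (fk k x - av k Q))"
    have Qk: "finite (Qk k)" "Qk k \<subseteq> \<Q>" for k unfolding Qk_def using \<Q>(1) by auto
    have b_in: "b k x = fk k x - av k Q" if "Q \<in> Qk k" "x \<in> iv Q" for k x Q
    proof -
      have "b k x = (\<Sum>Q'\<in>Qk k. if Q' = Q then fk k x - av k Q' else 0)" unfolding b_def
      proof (intro sum.cong refl)
        fix Q' assume "Q' \<in> Qk k"
        then have "x \<in> iv Q' \<longleftrightarrow> Q' = Q"
          using that Qk(2)[of k] \<Q>(2) unfolding disjoint_family_on_def by blast
        then show "of_bool (x \<in> iv Q') * (fk k x - av k Q') = (if Q' = Q then fk k x - av k Q' else 0)" by simp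
      qed
      then show ?thesis using that(1) Qk(1) by simp
    qed
    have b_out: "b k x = 0" if "x \<notin> (\<Union>Q\<in>Qk k. iv Q)" for k x
      unfolding b_def using that by (intro sum.neutral) auto
    have av: "0 \<le> av k Q" "av k Q \<le> 2 * \<alpha>" if "Q \<in> \<Q>" for k Q
    proof -
      show "0 \<le> av k Q" unfolding av_def using fk by (intro divide_nonneg_nonneg sum_nonneg) auto
      have "(\<Sum>x\<in>iv Q. fk k x) \<le> (\<Sum>x\<in>iv Q. f x)" by (intro sum_mono fk)
      also have "\<dots> \<le> 2 * \<alpha> * real (snd Q)" by (rule \<Q>(5)[OF that])
      finally show "av k Q \<le> 2 * \<alpha>" unfolding av_def using \<Q>(3)[OF that] by (simp add: divide_le_eq)
    qed
    have av_sum: "real (snd Q) * av k Q = (\<Sum>x\<in>iv Q. fk k x)" if "Q \<in> \<Q>" for k Q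
      unfolding av_def using \<Q>(3)[OF that] by simp
    define m where "m = (\<lambda>Q. \<Sum>x\<in>iv Q. f x)"
    have mass_b: "(\<Sum>x\<in>iv Q. \<bar>b k x\<bar>) \<le> 2 * m Q" if Q: "Q \<in> Qk k" for k Q
    proof -
      have QQ: "Q \<in> \<Q>" using Q Qk by auto
      have "(\<Sum>x\<in>iv Q. \<bar>b k x\<bar>) \<le> (\<Sum>x\<in>iv Q. fk k x + av k Q)"
      proof (rule sum_mono)
        fix x assume "x \<in> iv Q"
        then show "\<bar>b k x\<bar> \<le> fk k x + av k Q" using b_in[OF Q] fk[of k x] av[OF QQ, of k] by (simp add: abs_le_iff)
      qed
      also have "\<dots> = 2 * (\<Sum>x\<in>iv Q. fk k x)" using av_sum[OF QQ, of k] by (simp add: sum.distrib)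
      also have "\<dots> \<le> 2 * m Q" unfolding m_def using fk by (intro mult_left_mono sum_mono) auto
      finally show ?thesis .
    qed
    have atoms: "atoms (Qk k) (b k) \<alpha> (h (2 ^ k))" for k
    proof unfold_locales
      show "finite (Qk k)" by (rule Qk)
      show "disjoint_family_on iv (Qk k)" using \<Q>(2) Qk(2) by (rule disjoint_family_on_mono[rotated])
      show "0 \<le> \<alpha>" using \<alpha> by simp
      fix Q assume Q: "Q \<in> Qk k"
      then have QQ: "Q \<in> \<Q>" using Qk by auto
      have "(\<Sum>x\<in>iv Q. b k x) = (\<Sum>x\<in>iv Q. fk k x - av k Q)" using b_in[OF Q] by (intro sum.cong) auto
      then show "(\<Sum>x\<in>iv Q. b k x) = 0" using av_sum[OF QQ, of k] by (simp add: sum_subtractf)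
      show "(\<Sum>x\<in>iv Q. \<bar>b k x\<bar>) \<le> 4 * \<alpha> * real (snd Q)"
        using mass_b[OF Q] \<Q>(5)[OF QQ] unfolding m_def by linarith
      show "real (snd Q) \<le> h (2 ^ k)" using Q unfolding Qk_def by simp
    qed
    define X where "X = (\<lambda>k. \<Union>Q\<in>Qk k. iv Q)"
    have X: "finite (X k)" for k unfolding X_def using Qk by auto
    define W where "W = (\<lambda>k. \<Sum>x\<in>X k. \<Sum>y\<in>X k. b k x * b k y *
      ((\<Sum>p\<in>{2 ^ k..<2 * 2 ^ k::nat}. \<Sum>q\<in>{2 ^ k..<2 * 2 ^ k::nat}. tent (h (real p) - h (real q) - of_int (x - y))) / (2 ^ k)\<^sup>2))"
    have W_le: "W k \<le> (\<Sum>x | f x \<noteq> 0. (fk k x)\<^sup>2 / 2 ^ k) +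
        208 * C1 * \<alpha> * (\<Sum>Q\<in>Qk k. m Q * (real (snd Q) / h (2 ^ k) + r1 ^ k + r2 ^ k))" if k: "k0 \<le> k" for k
    proof -
      interpret a: atoms "Qk k" "b k" \<alpha> "h (2 ^ k)" by (rule atoms)
      have kX: "X k = a.supp" unfolding X_def a.supp_def ..
      have M: "(1::real) \<le> 2 ^ k" "2 ^ k \<le> h (2 ^ k)" using h_ge_self[of "2 ^ k"] k0[OF k] by auto
      obtain G E where GE:
        "\<And>z. (\<Sum>p\<in>{2 ^ k..<2*2 ^ k::nat}. \<Sum>q\<in>{2 ^ k..<2*2 ^ k::nat}. tent (h p - h q - of_int z)) / (real (2 ^ k))\<^sup>2 =
          of_bool (z = 0) / real (2 ^ k) + G z + E z"
        "\<And>z z'. \<bar>G z - G z'\<bar> \<le> C1 * (real_of_int \<bar>z - z'\<bar> / (h (real (2 ^ k)))\<^sup>2 + real (2 ^ k) powr (-1/20) / h (real (2 ^ k)))"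
        "\<And>z. \<bar>E z\<bar> \<le> C1 * (real (2 ^ k) powr (-1/20) / h (real (2 ^ k)) + of_bool (real_of_int \<bar>z\<bar> < real (2 ^ k)) / h (real (2 ^ k)))"
        "\<And>z. 4 * h (real (2 ^ k)) \<le> real_of_int \<bar>z\<bar> \<Longrightarrow> G z = 0"
        "\<And>z. 4 * h (real (2 ^ k)) \<le> real_of_int \<bar>z\<bar> \<Longrightarrow> E z = 0"
        using dec[of "2 ^ k"] k0[OF k] by auto
      have r1k: "real (2 ^ k) powr (-1/20) = r1 ^ k"
        unfolding r1_def by (simp add: powr_realpow[symmetric] powr_powr mult.commute)
      have "W k = (\<Sum>x\<in>a.supp. \<Sum>y\<in>a.supp. b k x * b k y * (of_bool (x - y = 0) / 2 ^ k + G (x - y) + E (x - y)))"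
        unfolding W_def kX using GE(1) by (simp only: of_nat_power of_nat_numeral)
      also have "\<dots> \<le> (\<Sum>x\<in>a.supp. (b k x)\<^sup>2) / 2 ^ k +
          104 * C1 * \<alpha> * (\<Sum>Q\<in>Qk k. a.mass Q * (real (snd Q) / h (2 ^ k) + r1 ^ k + 2 ^ k / h (2 ^ k)))"
        by (rule a.quadratic_form_le) (use M C1 r GE(2-5)[unfolded r1k] in auto)
      also have "(\<Sum>x\<in>a.supp. (b k x)\<^sup>2) / 2 ^ k \<le> (\<Sum>x | f x \<noteq> 0. (fk k x)\<^sup>2 / 2 ^ k)"
      proof -
        have "(\<Sum>x\<in>a.supp. (b k x)\<^sup>2) = (\<Sum>Q\<in>Qk k. \<Sum>x\<in>iv Q. (b k x)\<^sup>2)" by (rule a.sum_supp)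
        \<comment> \<open>Removing the mean is an orthogonal projection on each interval, hence does
          not increase the square sum.\<close>
        also have "\<dots> \<le> (\<Sum>Q\<in>Qk k. \<Sum>x\<in>iv Q. (fk k x)\<^sup>2)"
        proof (rule sum_mono)
          fix Q assume Q: "Q \<in> Qk k"
          then have QQ: "Q \<in> \<Q>" using Qk by auto
          have "(\<Sum>x\<in>iv Q. (b k x)\<^sup>2) = (\<Sum>x\<in>iv Q. (fk k x)\<^sup>2 - 2 * av k Q * fk k x + (av k Q)\<^sup>2)"
            using b_in[OF Q] by (intro sum.cong) (auto simp: power2_diff)
          also have "\<dots> = (\<Sum>x\<in>iv Q. (fk k x)\<^sup>2) - 2 * av k Q * (\<Sum>x\<in>iv Q. fk k x) + real (snd Q) * (av k Q)\<^sup>2"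
            by (simp add: sum.distrib sum_subtractf sum_distrib_left)
          also have "\<dots> = (\<Sum>x\<in>iv Q. (fk k x)\<^sup>2) - real (snd Q) * (av k Q)\<^sup>2"
            unfolding av_sum[OF QQ, symmetric] by (simp add: power2_eq_square)
          also have "\<dots> \<le> (\<Sum>x\<in>iv Q. (fk k x)\<^sup>2)" by simp
          finally show "(\<Sum>x\<in>iv Q. (b k x)\<^sup>2) \<le> (\<Sum>x\<in>iv Q. (fk k x)\<^sup>2)" .
        qed
        also have "\<dots> = (\<Sum>x\<in>a.supp. (fk k x)\<^sup>2)" by (rule a.sum_supp[symmetric])
        also have "\<dots> = (\<Sum>x\<in>a.supp \<inter> {x. f x \<noteq> 0}. (fk k x)\<^sup>2)"
          using a.finite_supp by (intro sum.mono_neutral_right) (auto simp: fk_def)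
        also have "\<dots> \<le> (\<Sum>x | f x \<noteq> 0. (fk k x)\<^sup>2)" using f by (intro sum_mono2) auto
        finally show ?thesis by (simp add: divide_right_mono flip: sum_divide_distrib)
      qed
      \<comment> \<open>The masses of the atoms are at most twice the masses of f on the same
        intervals, and 2^k / h (2^k) is at most r2^k because h grows at least like the power c >
        1.\<close>
      also have "104 * C1 * \<alpha> * (\<Sum>Q\<in>Qk k. a.mass Q * (real (snd Q) / h (2 ^ k) + r1 ^ k + 2 ^ k / h (2 ^ k))) \<le>
          104 * C1 * \<alpha> * (\<Sum>Q\<in>Qk k. 2 * m Q * (real (snd Q) / h (2 ^ k) + r1 ^ k + r2 ^ k))"
      proof (rule mult_left_mono[OF sum_mono])
        fix Q assume Q: "Q \<in> Qk k"
        have hp: "0 < h (2 ^ k)" using h_dyadic_growth(1) k0[OF k] by simp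
        show "a.mass Q * (real (snd Q) / h (2 ^ k) + r1 ^ k + 2 ^ k / h (2 ^ k)) \<le>
            2 * m Q * (real (snd Q) / h (2 ^ k) + r1 ^ k + r2 ^ k)"
        proof (rule mult_mono)
          show "a.mass Q \<le> 2 * m Q" unfolding a.mass_def by (rule mass_b[OF Q])
          show "real (snd Q) / h (2 ^ k) + r1 ^ k + 2 ^ k / h (2 ^ k) \<le> real (snd Q) / h (2 ^ k) + r1 ^ k + r2 ^ k"
            using h_dyadic_growth(5)[OF k0[OF k]] unfolding r2_def by simp
          show "0 \<le> 2 * m Q" unfolding m_def using f by (intro mult_nonneg_nonneg sum_nonneg) auto
          show "0 \<le> real (snd Q) / h (2 ^ k) + r1 ^ k + 2 ^ k / h (2 ^ k)" using hp r by simp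
        qed
      qed (use C1 \<alpha> in simp)
      finally show ?thesis by (simp add: sum_distrib_left mult_ac)
    qed
    have W_sum: "(\<Sum>k\<in>A. W k) \<le> (2 + 208 * C1 * C2) * \<alpha> * T"
    proof -
      have m0: "0 \<le> m Q" for Q unfolding m_def using f by (intro sum_nonneg) auto
      have "(\<Sum>k\<in>A. W k) \<le> (\<Sum>k\<in>A. (\<Sum>x | f x \<noteq> 0. (fk k x)\<^sup>2 / 2 ^ k) +
        208 * C1 * \<alpha> * (\<Sum>Q\<in>Qk k. m Q * (real (snd Q) / h (2 ^ k) + r1 ^ k + r2 ^ k)))"
        using A by (intro sum_mono W_le) auto
      also have "\<dots> = (\<Sum>x | f x \<noteq> 0. \<Sum>k\<in>A. (fk k x)\<^sup>2 / 2 ^ k) +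
        208 * C1 * \<alpha> * (\<Sum>k\<in>A. \<Sum>Q\<in>Qk k. m Q * (real (snd Q) / h (2 ^ k) + r1 ^ k + r2 ^ k))"
        unfolding sum.distrib sum_distrib_left[symmetric] by (subst sum.swap) simp
      also have "(\<Sum>x | f x \<noteq> 0. \<Sum>k\<in>A. (fk k x)\<^sup>2 / 2 ^ k) \<le> (\<Sum>x | f x \<noteq> 0. 2 * \<alpha> * f x)"
      proof (rule sum_mono)
        fix x
        let ?A = "{k \<in> A. f x \<le> \<alpha> * 2 ^ k}"
        have "(\<Sum>k\<in>A. (fk k x)\<^sup>2 / 2 ^ k) = (\<Sum>k\<in>?A. (f x)\<^sup>2 / 2 ^ k)"
          using A by (intro sum.mono_neutral_cong_right) (auto simp: fk_def)
        also have "\<dots> = (\<alpha> * f x) * (\<Sum>k\<in>?A. (f x / \<alpha>) / 2 ^ k)"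
          using \<alpha> by (simp add: sum_distrib_left power2_eq_square)
        also have "\<dots> \<le> (\<alpha> * f x) * 2"
          using A \<alpha> f by (intro mult_left_mono sum_lacunary_le[where start = 0]) (auto simp: field_simps)
        finally show "(\<Sum>k\<in>A. (fk k x)\<^sup>2 / 2 ^ k) \<le> 2 * \<alpha> * f x" by simp
      qed
      also have "(\<Sum>x | f x \<noteq> 0. 2 * \<alpha> * f x) = 2 * \<alpha> * T" unfolding T_def by (simp add: sum_distrib_left)
      \<comment> \<open>Exchanging the sums leaves, for each Q, the scales with h (2^k) at least its
        length. Over these all three terms are geometric, and \<open>C2\<close> is the sum of their
        totals.\<close>
      also have "(\<Sum>k\<in>A. \<Sum>Q\<in>Qk k. m Q * (real (snd Q) / h (2 ^ k) + r1 ^ k + r2 ^ k)) \<le> C2 * T"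
      proof -
        have "(\<Sum>k\<in>A. \<Sum>Q\<in>Qk k. m Q * (real (snd Q) / h (2 ^ k) + r1 ^ k + r2 ^ k)) =
            (\<Sum>k\<in>A. \<Sum>Q\<in>\<Q>. of_bool (real (snd Q) \<le> h (2 ^ k)) * (m Q * (real (snd Q) / h (2 ^ k) + r1 ^ k + r2 ^ k)))"
          using \<Q>(1) by (intro sum.cong sum.mono_neutral_cong_left) (auto simp: Qk_def)
        also have "\<dots> = (\<Sum>Q\<in>\<Q>. \<Sum>k\<in>A. of_bool (real (snd Q) \<le> h (2 ^ k)) * (m Q * (real (snd Q) / h (2 ^ k) + r1 ^ k + r2 ^ k)))"
          by (rule sum.swap)
        also have "\<dots> \<le> (\<Sum>Q\<in>\<Q>. m Q * C2)"
        proof (rule sum_mono)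
          fix Q :: "int \<times> nat"
          let ?A = "{k \<in> A. real (snd Q) \<le> h (2 ^ k)}"
          have "(\<Sum>k\<in>A. of_bool (real (snd Q) \<le> h (2 ^ k)) * (m Q * (real (snd Q) / h (2 ^ k) + r1 ^ k + r2 ^ k))) =
              (\<Sum>k\<in>?A. m Q * (real (snd Q) / h (2 ^ k) + r1 ^ k + r2 ^ k))"
            using A by (intro sum.mono_neutral_cong_right) auto
          also have "\<dots> = m Q * ((\<Sum>k\<in>?A. real (snd Q) / h (2 ^ k)) + (\<Sum>k\<in>?A. r1 ^ k) + (\<Sum>k\<in>?A. r2 ^ k))"
            by (simp add: sum_distrib_left sum.distrib distrib_left)
          also have "\<dots> \<le> m Q * C2" unfolding C2_def
          proof (intro mult_left_mono[OF _ m0] add_mono)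
            show "(\<Sum>k\<in>?A. real (snd Q) / h (2 ^ k)) \<le> 2"
              by (rule sum_lacunary_le[where start = k0]) (use A h_dyadic_growth k0 in auto)
            show "(\<Sum>k\<in>?A. r1 ^ k) \<le> 1 / (1 - r1)" using A r by (intro sum_geometric_le) auto
            show "(\<Sum>k\<in>?A. r2 ^ k) \<le> 1 / (1 - r2)" using A r by (intro sum_geometric_le) auto
          qed
          finally show "(\<Sum>k\<in>A. of_bool (real (snd Q) \<le> h (2 ^ k)) * (m Q * (real (snd Q) / h (2 ^ k) + r1 ^ k + r2 ^ k))) \<le> m Q * C2" .
        qed
        also have "\<dots> = C2 * (\<Sum>Q\<in>\<Q>. m Q)" by (simp add: sum_distrib_left mult.commute)
        also have "\<dots> \<le> C2 * T" using \<Q>T C2 unfolding m_def by (intro mult_left_mono) auto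
        finally show ?thesis .
      qed
      finally have "(\<Sum>k\<in>A. W k) \<le> 2 * \<alpha> * T + 208 * C1 * \<alpha> * (C2 * T)" using C1 \<alpha> by (simp add: mult_left_mono)
      then show ?thesis by (simp add: algebra_simps)
    qed
    \<comment> \<open>The points reached by the values removed in the truncation; both candidates
      for the shifted floor are included. Each x contributes at most 2 * 2^k points at scale k, and
      the 2^k below f x / \<alpha> sum to at most twice that bound, hence 4 f x / \<alpha>.\<close>
    define Bad1 where "Bad1 = (\<Union>x\<in>{x. f x \<noteq> 0}. \<Union>k\<in>{k\<in>A. \<alpha> * 2 ^ k < f x}. \<Union>p\<in>{2 ^ k..<2 * 2 ^ k::nat}.
      {x + \<lfloor>h (real p)\<rfloor>, x + \<lfloor>h (real p)\<rfloor> + 1})"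
    \<comment> \<open>If Q is longer than h (2^k), then h p \<le> 4 h (2^k) displaces its points by
      at most 4 lengths. The dilate extends only to the right since the floors are
      nonnegative.\<close>
    define Bad2 where "Bad2 = (\<Union>Q\<in>\<Q>. {fst Q..<fst Q + 6 * int (snd Q)})"
    have cBad1: "finite Bad1" "real (card Bad1) \<le> 4 / \<alpha> * T"
    proof -
      show "finite Bad1" unfolding Bad1_def using f A by auto
      have "card Bad1 \<le> (\<Sum>x | f x \<noteq> 0. card (\<Union>k\<in>{k\<in>A. \<alpha> * 2 ^ k < f x}. \<Union>p\<in>{2 ^ k..<2 * 2 ^ k::nat}.
          {x + \<lfloor>h (real p)\<rfloor>, x + \<lfloor>h (real p)\<rfloor> + 1}))"
        unfolding Bad1_def by (rule card_UN_le[OF f(2)])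
      also have "\<dots> \<le> (\<Sum>x | f x \<noteq> 0. \<Sum>k\<in>{k\<in>A. \<alpha> * 2 ^ k < f x}. 2 * 2 ^ k)"
      proof (rule sum_mono)
        fix x
        have "card (\<Union>k\<in>{k\<in>A. \<alpha> * 2 ^ k < f x}. \<Union>p\<in>{2 ^ k..<2 * 2 ^ k::nat}. {x + \<lfloor>h (real p)\<rfloor>, x + \<lfloor>h (real p)\<rfloor> + 1}) \<le>
            (\<Sum>k\<in>{k\<in>A. \<alpha> * 2 ^ k < f x}. card (\<Union>p\<in>{2 ^ k..<2 * 2 ^ k::nat}. {x + \<lfloor>h (real p)\<rfloor>, x + \<lfloor>h (real p)\<rfloor> + 1}))"
          using A by (intro card_UN_le) auto
        also have "\<dots> \<le> (\<Sum>k\<in>{k\<in>A. \<alpha> * 2 ^ k < f x}. 2 * 2 ^ k)"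
        proof (rule sum_mono)
          fix k
          have "card (\<Union>p\<in>{2 ^ k..<2 * 2 ^ k::nat}. {x + \<lfloor>h (real p)\<rfloor>, x + \<lfloor>h (real p)\<rfloor> + 1}) \<le>
              (\<Sum>p\<in>{2 ^ k..<2 * 2 ^ k::nat}. card {x + \<lfloor>h (real p)\<rfloor>, x + \<lfloor>h (real p)\<rfloor> + 1})" by (intro card_UN_le) auto
          also have "\<dots> = 2 * 2 ^ k" by simp
          finally show "card (\<Union>p\<in>{2 ^ k..<2 * 2 ^ k::nat}. {x + \<lfloor>h (real p)\<rfloor>, x + \<lfloor>h (real p)\<rfloor> + 1}) \<le> 2 * 2 ^ k" .
        qed
        finally show "card (\<Union>k\<in>{k\<in>A. \<alpha> * 2 ^ k < f x}. \<Union>p\<in>{2 ^ k..<2 * 2 ^ k::nat}. {x + \<lfloor>h (real p)\<rfloor>, x + \<lfloor>h (real p)\<rfloor> + 1}) \<le>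
          (\<Sum>k\<in>{k\<in>A. \<alpha> * 2 ^ k < f x}. 2 * 2 ^ k)" .
      qed
      finally have "real (card Bad1) \<le> real (\<Sum>x | f x \<noteq> 0. \<Sum>k\<in>{k\<in>A. \<alpha> * 2 ^ k < f x}. 2 * 2 ^ k)" by (rule of_nat_mono)
      also have "\<dots> = (\<Sum>x | f x \<noteq> 0. 2 * (\<Sum>k\<in>{k\<in>A. \<alpha> * 2 ^ k < f x}. 2 ^ k))" by (simp add: sum_distrib_left)
      also have "\<dots> \<le> (\<Sum>x | f x \<noteq> 0. 2 * (2 * (f x / \<alpha>)))"
        using A \<alpha> f by (intro sum_mono mult_left_mono sum_powers_of_2_less) (auto simp: field_simps)
      also have "\<dots> = 4 / \<alpha> * T" unfolding T_def by (simp add: sum_distrib_left)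
      finally show "real (card Bad1) \<le> 4 / \<alpha> * T" .
    qed
    have cBad2: "finite Bad2" "real (card Bad2) \<le> 6 / \<alpha> * T"
    proof -
      show "finite Bad2" unfolding Bad2_def using \<Q>(1) by auto
      have "card Bad2 \<le> (\<Sum>Q\<in>\<Q>. card {fst Q..<fst Q + 6 * int (snd Q)})" unfolding Bad2_def by (rule card_UN_le[OF \<Q>(1)])
      then have "real (card Bad2) \<le> real (\<Sum>Q\<in>\<Q>. card {fst Q..<fst Q + 6 * int (snd Q)})" by (rule of_nat_mono)
      also have "\<dots> = (\<Sum>Q\<in>\<Q>. 6 * real (snd Q))" by (simp add: nat_mult_distrib)
      also have "\<dots> \<le> (\<Sum>Q\<in>\<Q>. 6 / \<alpha> * m Q)"
        using \<Q>(4) \<alpha> unfolding m_def by (intro sum_mono) (simp add: field_simps less_imp_le)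
      also have "\<dots> = 6 / \<alpha> * (\<Sum>Q\<in>\<Q>. m Q)" by (simp add: sum_distrib_left)
      also have "\<dots> \<le> 6 / \<alpha> * T" using \<Q>T \<alpha> unfolding m_def by (intro mult_left_mono) auto
      finally show "real (card Bad2) \<le> 6 / \<alpha> * T" .
    qed
    define Bad where "Bad = Bad1 \<union> Bad2"
    have cBad: "finite Bad" "real (card Bad) \<le> 10 / \<alpha> * T"
    proof -
      show "finite Bad" unfolding Bad_def using cBad1 cBad2 by simp
      have "real (card Bad) \<le> real (card Bad1) + real (card Bad2)"
        unfolding Bad_def of_nat_add[symmetric] by (rule of_nat_mono[OF card_Un_le])
      also have "\<dots> \<le> 4 / \<alpha> * T + 6 / \<alpha> * T" using cBad1 cBad2 by (intro add_mono) auto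
      finally show "real (card Bad) \<le> 10 / \<alpha> * T" by (simp add: field_simps)
    qed
    have good: "block_avg h k \<tau> f n \<le> 2 * \<alpha> + block_avg h k \<tau> (b k) n"
      if k: "k \<in> A" and \<tau>: "\<tau> \<in> {0..1}" and n: "n \<notin> Bad" for k \<tau> n
    proof (rule block_avg_mono_on)
      fix p assume p: "p \<in> {2 ^ k..<2 * 2 ^ k::nat}"
      have kk0: "k0 \<le> k" using k A by auto
      define x where "x = n - \<lfloor>h (real p) + \<tau>\<rfloor>"
      have fl: "\<lfloor>h (real p) + \<tau>\<rfloor> = \<lfloor>h (real p)\<rfloor> \<or> \<lfloor>h (real p) + \<tau>\<rfloor> = \<lfloor>h (real p)\<rfloor> + 1" using \<tau> by auto linarith
      have small: "f x \<le> \<alpha> * 2 ^ k"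
      proof (rule ccontr)
        assume "\<not> f x \<le> \<alpha> * 2 ^ k"
        then have xk: "\<alpha> * 2 ^ k < f x" by simp
        moreover have "0 < \<alpha> * 2 ^ k" using \<alpha> by simp
        ultimately have "f x \<noteq> 0" by linarith
        moreover have "n \<in> {x + \<lfloor>h (real p)\<rfloor>, x + \<lfloor>h (real p)\<rfloor> + 1}" using fl unfolding x_def by auto
        ultimately have "n \<in> Bad1" unfolding Bad1_def using xk k p by blast
        then show False using n unfolding Bad_def by simp
      qed
      then have fx: "fk k x = f x" unfolding fk_def by simp
      have "f x \<le> 2 * \<alpha> + b k x"
      proof (cases "x \<in> (\<Union>Q\<in>\<Q>. iv Q)")
        case False
        then have "f x \<le> \<alpha>" "b k x = 0" using \<Q>(6) b_out[of x k] Qk(2)[of k] by blast+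
        then show ?thesis using \<alpha> by simp
      next
        case True
        then obtain Q where Q: "Q \<in> \<Q>" "x \<in> iv Q" by blast
        have "real (snd Q) \<le> h (2 ^ k)"
        proof (rule ccontr)
          assume "\<not> real (snd Q) \<le> h (2 ^ k)"
          then have hL: "h (2 ^ k) < real (snd Q)" by simp
          have "h (real p) \<le> 4 * h (2 ^ k)" "0 \<le> h (real p)" using h_dyadic_growth(3,4)[OF k0[OF kk0] p] by auto
          then have "h (real p) < real (4 * snd Q)" using hL by simp
          then have "\<lfloor>h (real p)\<rfloor> < 4 * int (snd Q)" by (simp add: floor_less_iff)
          then have "\<lfloor>h (real p) + \<tau>\<rfloor> \<le> 4 * int (snd Q)" "0 \<le> \<lfloor>h (real p) + \<tau>\<rfloor>"
            using fl \<open>0 \<le> h (real p)\<close> \<tau> by auto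
          moreover have "fst Q \<le> x" "x < fst Q + int (snd Q)" "n = x + \<lfloor>h (real p) + \<tau>\<rfloor>"
            using Q(2) unfolding x_def iv_def by simp_all
          ultimately have "n \<in> {fst Q..<fst Q + 6 * int (snd Q)}" using \<Q>(3)[OF Q(1)]
            unfolding atLeastLessThan_iff by linarith
          then have "n \<in> Bad2" unfolding Bad2_def using Q(1) by blast
          then show False using n unfolding Bad_def by simp
        qed
        then have "Q \<in> Qk k" using Q unfolding Qk_def by simp
        then have "b k x = f x - av k Q" using b_in Q fx by simp
        then show ?thesis using av[OF Q(1), of k] by simp
      qed
      then show "f (n - \<lfloor>h (real p) + \<tau>\<rfloor>) \<le> 2 * \<alpha> + b k (n - \<lfloor>h (real p) + \<tau>\<rfloor>)" unfolding x_def .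
    qed
    \<comment> \<open>The bound for n also uses the block average at n + 1, so both points have to
      avoid \<open>Bad\<close>. This doubles the exceptional cost from 10 to 20.\<close>
    define F' where "F' = {n \<in> F. n \<notin> Bad \<and> n + 1 \<notin> Bad}"
    have cF: "real (card F) \<le> real (card F') + 20 / \<alpha> * T"
    proof -
      have "F \<subseteq> F' \<union> (Bad \<union> (\<lambda>n. n - 1) ` Bad)" unfolding F'_def by force
      then have "card F \<le> card (F' \<union> (Bad \<union> (\<lambda>n. n - 1) ` Bad))"
        using cBad F unfolding F'_def by (intro card_mono) auto
      also have "\<dots> \<le> card F' + (card Bad + card ((\<lambda>n. n - 1) ` Bad))"
        by (meson card_Un_le add_left_mono order_trans)
      also have "card ((\<lambda>n. n - 1) ` Bad) \<le> card Bad" by (rule card_image_le[OF cBad(1)])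
      finally have "card F \<le> card F' + 2 * card Bad" by simp
      then have "real (card F) \<le> real (card F') + 2 * real (card Bad)" by linarith
      moreover have "2 * real (card Bad) \<le> 2 * (10 / \<alpha> * T)" using cBad(2) by (intro mult_left_mono) auto
      moreover have "2 * (10 / \<alpha> * T) = 20 / \<alpha> * T" by simp
      ultimately show ?thesis by linarith
    qed
    define N where "N = F' \<union> (\<lambda>n. n + 1) ` F'"
    have N: "finite N" "F' \<subseteq> N" "\<And>n. n \<in> F' \<Longrightarrow> n + 1 \<in> N" unfolding N_def F'_def using F by auto
    have "\<exists>Fk. \<forall>k. (Fk k has_integral W k) {0..1} \<and> (\<forall>\<tau>\<in>{0..1}. (\<Sum>n\<in>N. (block_avg h k \<tau> (b k) n)\<^sup>2) \<le> Fk k \<tau>)"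
      unfolding W_def
      by (rule choice, rule allI, rule integral_block_avg_square[OF X _ N(1)]) (use b_out in \<open>auto simp: X_def\<close>)
    then obtain Fk where Fk: "\<And>k. (Fk k has_integral W k) {0..1}"
      "\<And>k \<tau>. \<tau> \<in> {0..1} \<Longrightarrow> (\<Sum>n\<in>N. (block_avg h k \<tau> (b k) n)\<^sup>2) \<le> Fk k \<tau>" by blast
    have lower: "\<alpha>\<^sup>2 * real (card F') \<le> (\<Sum>k\<in>A. 2 * Fk k \<tau>)" if \<tau>: "\<tau> \<in> {0..1}" for \<tau>
    proof -
      let ?s = "\<lambda>k n. (block_avg h k \<tau> (b k) n)\<^sup>2"
      have "\<alpha>\<^sup>2 * real (card F') = (\<Sum>n\<in>F'. \<alpha>\<^sup>2)" by simp
      also have "\<dots> \<le> (\<Sum>n\<in>F'. \<Sum>k\<in>A. ?s k n + ?s k (n + 1))"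
      proof (rule sum_mono)
        fix n assume n: "n \<in> F'"
        define k where "k = kk n"
        have nF: "n \<in> F" "n \<notin> Bad" "n + 1 \<notin> Bad" using n by (auto simp: F'_def)
        have k: "k \<in> A" using nF unfolding A_def k_def by auto
        \<comment> \<open>The threshold 6 \<alpha> leaves 2 \<alpha> after the good parts at n and n
          + 1 take 2 \<alpha> each, so one of the two bad averages is at least \<alpha>.\<close>
        have "6 * \<alpha> < block_avg h k \<tau> f n + block_avg h k \<tau> f (n + 1)"
          using kk[OF nF(1)] block_avg_floor_le[of f \<tau> h k n] f \<tau> unfolding k_def by force
        also have "\<dots> \<le> (2 * \<alpha> + block_avg h k \<tau> (b k) n) + (2 * \<alpha> + block_avg h k \<tau> (b k) (n + 1))"
          by (intro add_mono good k \<tau> nF)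
        finally have "\<alpha> \<le> block_avg h k \<tau> (b k) n \<or> \<alpha> \<le> block_avg h k \<tau> (b k) (n + 1)" by linarith
        then have "\<alpha>\<^sup>2 \<le> ?s k n \<or> \<alpha>\<^sup>2 \<le> ?s k (n + 1)" using \<alpha> by (auto intro: power_mono)
        then have "\<alpha>\<^sup>2 \<le> ?s k n + ?s k (n + 1)" by (auto intro: add_increasing add_increasing2)
        also have "\<dots> \<le> (\<Sum>k\<in>A. ?s k n + ?s k (n + 1))"
          using member_le_sum[of k A "\<lambda>k. ?s k n + ?s k (n + 1)"] k A by simp
        finally show "\<alpha>\<^sup>2 \<le> (\<Sum>k\<in>A. ?s k n + ?s k (n + 1))" .
      qed
      also have "\<dots> = (\<Sum>k\<in>A. (\<Sum>n\<in>F'. ?s k n) + (\<Sum>n\<in>F'. ?s k (n + 1)))"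
        by (subst sum.swap) (simp add: sum.distrib)
      also have "\<dots> \<le> (\<Sum>k\<in>A. 2 * Fk k \<tau>)"
      proof (rule sum_mono)
        fix k
        have "(\<Sum>n\<in>F'. ?s k n) \<le> (\<Sum>n\<in>N. ?s k n)" using N by (intro sum_mono2) auto
        moreover have "(\<Sum>n\<in>F'. ?s k (n + 1)) = (\<Sum>n\<in>(\<lambda>n. n + 1) ` F'. ?s k n)" by (subst sum.reindex) auto
        moreover have "(\<Sum>n\<in>(\<lambda>n. n + 1) ` F'. ?s k n) \<le> (\<Sum>n\<in>N. ?s k n)" using N by (intro sum_mono2) auto
        ultimately show "(\<Sum>n\<in>F'. ?s k n) + (\<Sum>n\<in>F'. ?s k (n + 1)) \<le> 2 * Fk k \<tau>" using Fk(2)[OF \<tau>, of k] by linarith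
      qed
      finally show ?thesis .
    qed
    have upI: "((\<lambda>\<tau>. \<Sum>k\<in>A. 2 * Fk k \<tau>) has_integral (\<Sum>k\<in>A. 2 * W k)) {0..1}"
      by (intro has_integral_sum has_integral_mult_right Fk A)
    have loI: "((\<lambda>\<tau>. \<alpha>\<^sup>2 * real (card F')) has_integral \<alpha>\<^sup>2 * real (card F')) {0..1::real}"
      using has_integral_const_real[of "\<alpha>\<^sup>2 * real (card F')" 0 1] by simp
    \<comment> \<open>The lower bound holds for every \<tau>, whereas the upper bound
      \<open>W k\<close> is only available after integration over \<tau>.\<close>
    have "\<alpha>\<^sup>2 * real (card F') \<le> (\<Sum>k\<in>A. 2 * W k)"
      by (rule has_integral_le[OF loI upI lower])
    also have "\<dots> = 2 * (\<Sum>k\<in>A. W k)" by (simp add: sum_distrib_left)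
    also have "\<dots> \<le> 2 * ((2 + 208 * C1 * C2) * \<alpha> * T)" using W_sum by simp
    finally have "\<alpha> * (\<alpha> * real (card F')) \<le> \<alpha> * (2 * (2 + 208 * C1 * C2) * T)"
      by (simp add: power2_eq_square mult_ac)
    then have "\<alpha> * real (card F') \<le> 2 * (2 + 208 * C1 * C2) * T" using \<alpha> by (simp only: mult_le_cancel_left_pos)
    then have "real (card F') \<le> 2 * (2 + 208 * C1 * C2) * T / \<alpha>"
      using \<alpha> by (simp add: pos_le_divide_eq mult.commute)
    then have "real (card F) \<le> 2 * (2 + 208 * C1 * C2) * T / \<alpha> + 20 / \<alpha> * T" using cF by linarith
    also have "\<dots> = C / \<alpha> * T" unfolding C_def by (simp add: add_divide_distrib algebra_simps)
    finally show ?thesis unfolding T_def .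
  qed
  show ?thesis
  proof (rule exI[of _ C], intro conjI C, rule exI[of _ k0], intro allI impI)
    fix f :: "int \<Rightarrow> real" and \<alpha> :: real and F :: "int set"
    assume a: "\<forall>x. 0 \<le> f x" "finite {x. f x \<noteq> 0}" "0 < \<alpha>" "finite F"
      "\<forall>n\<in>F. \<exists>k\<ge>k0. 6 * \<alpha> < block_avg h k 0 f n"
    show "real (card F) \<le> C / \<alpha> * (\<Sum>x | f x \<noteq> 0. f x)"
      by (rule main[OF spec[OF a(1)] a(2-4) bspec[OF a(5)]])
  qed
qed

end

section \<open>The classes of regularly varying functions\<close>

text \<open>The logarithmic derivative of h is (c + \<theta> x)/x, and l \<ge> 1 gives h x \<ge>
  x^c. The lemma serves both functions: h1, where c > 1 and the decay of the derivatives of \<theta>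
  matters, and h2, where c may be 1 and the first derivative is enough.\<close>

lemma class_R_derivative:
  assumes "x0 \<ge> 1" and h: "h \<in> class_R x0 c"
  shows "\<exists>\<theta> \<theta>' \<theta>''. C2_from x0 \<theta> \<theta>' \<theta>'' \<and> (\<theta> \<longlongrightarrow> 0) at_top \<and>
    (c \<noteq> 1 \<longrightarrow> ((\<lambda>x. x * \<theta>' x) \<longlongrightarrow> 0) at_top \<and> ((\<lambda>x. x\<^sup>2 * \<theta>'' x) \<longlongrightarrow> 0) at_top) \<and>
    (\<forall>x>x0. (h has_real_derivative h x / x * (c + \<theta> x)) (at x)) \<and> (\<forall>x\<ge>x0. x powr c \<le> h x)"
proof -
  obtain l where l: "l \<in> (if c = 1 then class_L0 x0 else class_L x0)" "\<And>x. x0 \<le> x \<Longrightarrow> h x = x powr c * l x"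
    using h unfolding class_R_def by auto
  have l1: "1 \<le> l x" if "x0 \<le> x" for x using l(1) that by (auto simp: class_L_def class_L0_def split: if_splits)
  obtain \<theta> \<theta>' \<theta>'' where \<theta>: "C2_from x0 \<theta> \<theta>' \<theta>''" "\<And>x. x0 \<le> x \<Longrightarrow> l x = exp (integral {x0..x} (\<lambda>t. \<theta> t / t))"
    "(\<theta> \<longlongrightarrow> 0) at_top" "c \<noteq> 1 \<Longrightarrow> ((\<lambda>x. x * \<theta>' x) \<longlongrightarrow> 0) at_top"
    "c \<noteq> 1 \<Longrightarrow> ((\<lambda>x. x\<^sup>2 * \<theta>'' x) \<longlongrightarrow> 0) at_top"
  proof (cases "c = 1")
    case True
    then have "l \<in> class_L0 x0" using l(1) by simp
    then show ?thesis using that True unfolding class_L0_def by blast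
  next
    case False
    then have "l \<in> class_L x0" using l(1) by simp
    then show ?thesis using that unfolding class_L_def by blast
  qed
  have cont: "continuous_on {x0..} \<theta>"
    using \<theta>(1) unfolding C2_from_def by (intro DERIV_continuous_on) auto
  have dl: "(l has_real_derivative l x * (\<theta> x / x)) (at x)" if x: "x0 < x" for x
  proof -
    \<comment> \<open>The range extends to x + 1 so that x is an interior point and the derivative
      is two-sided.\<close>
    have "continuous_on {x0..x + 1} (\<lambda>t. \<theta> t / t)"
      using assms(1) by (intro continuous_intros continuous_on_subset[OF cont]) auto
    then have "((\<lambda>x. integral {x0..x} (\<lambda>t. \<theta> t / t)) has_real_derivative \<theta> x / x) (at x within {x0..x + 1})"
      using x by (intro integral_has_real_derivative) auto
    moreover have "at x within {x0..x + 1} = at x"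
      using x by (intro at_within_interior) simp
    ultimately have "((\<lambda>x. exp (integral {x0..x} (\<lambda>t. \<theta> t / t))) has_real_derivative
        exp (integral {x0..x} (\<lambda>t. \<theta> t / t)) * (\<theta> x / x)) (at x)"
      by (intro DERIV_fun_exp) simp
    then have "(l has_real_derivative exp (integral {x0..x} (\<lambda>t. \<theta> t / t)) * (\<theta> x / x)) (at x)"
      by (rule has_field_derivative_transform_within_open[where S = "{x0<..}"]) (use x \<theta>(2) in auto)
    then show ?thesis using \<theta>(2)[of x] x by simp
  qed
  have dh: "(h has_real_derivative h x / x * (c + \<theta> x)) (at x)" if x: "x0 < x" for x
  proof -
    have x0: "0 < x" using x assms(1) by simp
    have "((\<lambda>x. x powr c * l x) has_real_derivative c * x powr (c - 1) * l x + l x * (\<theta> x / x) * x powr c) (at x)"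
      by (rule DERIV_mult[OF has_real_derivative_powr[OF x0] dl[OF x]])
    moreover have "c * x powr (c - 1) * l x + l x * (\<theta> x / x) * x powr c = h x / x * (c + \<theta> x)"
      using l(2)[of x] x x0 by (simp add: powr_diff field_simps)
    ultimately have "((\<lambda>x. x powr c * l x) has_real_derivative h x / x * (c + \<theta> x)) (at x)" by simp
    then show ?thesis
      by (rule has_field_derivative_transform_within_open[where S = "{x0<..}"]) (use x l(2) in auto)
  qed
  have "x powr c \<le> h x" if "x0 \<le> x" for x
    using l(2)[OF that] l1[OF that] mult_left_mono[of 1 "l x" "x powr c"] by simp
  then show ?thesis using \<theta> dh by blast
qed

text \<open>The quantities t h' / h, t^2 h'' / h and - \<kappa>' t h, called A, B and K here, tend
  to c, c (c - 1) and c - 1. For c > 1 these limits are positive, which gives two-sided bounds from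
  some X on.\<close>

lemma regvar_of_class_R:
  assumes "x0 \<ge> 1" and h: "h \<in> class_R x0 c" and c: "1 < c" "c < 30/29"
  shows "\<exists>h' h'' \<kappa>' X e C0. regvar h h' h'' \<kappa>' X e c C0 \<and> x0 < X"
proof -
  obtain \<theta> \<theta>' \<theta>'' where \<theta>: "C2_from x0 \<theta> \<theta>' \<theta>''" "(\<theta> \<longlongrightarrow> 0) at_top"
    and lim: "((\<lambda>x. x * \<theta>' x) \<longlongrightarrow> 0) at_top" "((\<lambda>x. x\<^sup>2 * \<theta>'' x) \<longlongrightarrow> 0) at_top"
    and dh: "\<And>x. x0 < x \<Longrightarrow> (h has_real_derivative h x / x * (c + \<theta> x)) (at x)"
    and hl: "\<And>x. x0 \<le> x \<Longrightarrow> x powr c \<le> h x"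
    using class_R_derivative[OF assms(1,2)] c by auto
  have hpos: "0 < h x" if "x0 \<le> x" for x
  proof -
    have "0 < x powr c" using that assms(1) by simp
    then show ?thesis using hl[OF that] by linarith
  qed
  have within: "at x within {x0..} = at x" if "x0 < x" for x
    using that by (intro at_within_interior) (simp add: interior_real_atLeast)
  have d\<theta>: "(\<theta> has_real_derivative \<theta>' x) (at x)" "(\<theta>' has_real_derivative \<theta>'' x) (at x)" if "x0 < x" for x
  proof -
    have "(\<theta> has_real_derivative \<theta>' x) (at x within {x0..})" "(\<theta>' has_real_derivative \<theta>'' x) (at x within {x0..})"
      using \<theta>(1) that unfolding C2_from_def by simp_all
    then show "(\<theta> has_real_derivative \<theta>' x) (at x)" "(\<theta>' has_real_derivative \<theta>'' x) (at x)"
      unfolding within[OF that] .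
  qed
  define A where "A = (\<lambda>x. c + \<theta> x)"
  define B where "B = (\<lambda>x. (c + \<theta> x) * (c - 1 + \<theta> x) + x * \<theta>' x)"
  define K where "K = (\<lambda>x. B x / A x + 2 * B x * (x * \<theta>' x) / (A x) ^ 3
    - (x * \<theta>' x * (c - 1 + \<theta> x) + (c + \<theta> x) * (x * \<theta>' x) + x * \<theta>' x + x\<^sup>2 * \<theta>'' x) / (A x)\<^sup>2)"
  have limA: "(A \<longlongrightarrow> c) at_top" unfolding A_def using tendsto_add[OF tendsto_const \<theta>(2), of c] by simp
  have limB: "(B \<longlongrightarrow> c * (c - 1)) at_top"
  proof -
    have "(B \<longlongrightarrow> (c + 0) * (c - 1 + 0) + 0) at_top" unfolding B_def by (intro tendsto_intros \<theta>(2) lim)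
    then show ?thesis by simp
  qed
  have limK: "(K \<longlongrightarrow> c - 1) at_top"
  proof -
    have "(K \<longlongrightarrow> (c * (c - 1)) / c + 2 * (c * (c - 1)) * 0 / c ^ 3 -
      (0 * (c - 1 + 0) + (c + 0) * 0 + 0 + 0) / c\<^sup>2) at_top"
      unfolding K_def using c by (intro tendsto_intros \<theta>(2) lim limA limB) auto
    then show ?thesis using c by simp
  qed
  \<comment> \<open>Half of the smaller limit c - 1 lies strictly below both limits of B and K. As c
    is close to 1, its inverse lies above both.\<close>
  define e where "e = (c - 1) / 2"
  have e: "0 < e" "e \<le> 1" "1 < 1 / e" unfolding e_def using c by (auto simp: field_simps)
  have e1: "e < c * (c - 1)" "c * (c - 1) < 1 / e" "e < c - 1" "c - 1 < 1 / e"
  proof -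
    have "1 * (c - 1) < c * (c - 1)" using c by (intro mult_strict_right_mono) auto
    moreover have "e < 1 * (c - 1)" unfolding e_def using c by simp
    ultimately show "e < c * (c - 1)" by (rule less_trans[rotated])
    have "c * (c - 1) < 2 * (1/2)" using c by (intro mult_strict_mono) auto
    then show "c * (c - 1) < 1 / e" using e by linarith
    show "e < c - 1" using c unfolding e_def by simp
    show "c - 1 < 1 / e" using e c by linarith
  qed
  have "eventually (\<lambda>x. x0 < x \<and> 1 < A x \<and> A x < 21/20 \<and> e < B x \<and> B x < 1 / e \<and> e < K x \<and> K x < 1 / e) at_top"
    using c e1
    by (intro eventually_conj eventually_gt_at_top order_tendstoD[OF limA] order_tendstoD[OF limB] order_tendstoD[OF limK]) auto
  then obtain X where X: "\<And>x. X \<le> x \<Longrightarrow> x0 < x \<and> 1 < A x \<and> A x < 21/20 \<and> e < B x \<and> B x < 1 / e \<and> e < K x \<and> K x < 1 / e"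
    unfolding eventually_at_top_linorder by blast
  define h' where "h' = (\<lambda>x. h x / x * A x)"
  define h'' where "h'' = (\<lambda>x. h x / x\<^sup>2 * B x)"
  define \<kappa>' where "\<kappa>' = (\<lambda>x. - K x / (x * h x))"
  define C0 where "C0 = max 1 (h X / X powr (21/20))"
  have pos: "0 < x" "0 < h x" "x0 < x" if "X \<le> x" for x
  proof -
    show "x0 < x" using X[OF that] by simp
    then show "0 < x" "0 < h x" using assms(1) hpos[of x] by auto
  qed
  have "regvar h h' h'' \<kappa>' X e c C0"
  proof
    show "X \<ge> 1" using pos[of X] assms(1) by simp
    show "0 < e" "e \<le> 1" by (fact e)+
    show "c > 1" by fact
    show "C0 \<ge> 1" unfolding C0_def by simp
    fix t assume t: "t \<ge> X"
    note p = pos[OF t] and Xt = X[OF t]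
    show "(h has_real_derivative h' t) (at t)" unfolding h'_def A_def by (rule dh[OF p(3)])
    show "(h' has_real_derivative h'' t) (at t)"
    proof -
      have "((\<lambda>x. h x / x * (c + \<theta> x)) has_real_derivative
          ((h t / t * (c + \<theta> t)) * t - h t * 1) / (t * t) * (c + \<theta> t) + (0 + \<theta>' t) * (h t / t)) (at t)"
        by (rule derivative_eq_intros dh[OF p(3)] d\<theta>[OF p(3)] refl | use p in simp)+
      moreover have "((h t / t * (c + \<theta> t)) * t - h t * 1) / (t * t) * (c + \<theta> t) + (0 + \<theta>' t) * (h t / t) = h'' t"
        unfolding h''_def B_def using p(1) by (simp add: field_simps power2_eq_square)
      ultimately show ?thesis unfolding h'_def A_def by simp
    qed
    show "((\<lambda>t. h'' t / (h' t)\<^sup>2) has_real_derivative \<kappa>' t) (at t)"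
    proof -
      have dA: "(A has_real_derivative \<theta>' t) (at t)"
        unfolding A_def by (rule derivative_eq_intros d\<theta>[OF p(3)] refl | simp)+
      have dB: "(B has_real_derivative (\<theta>' t * (c - 1 + \<theta> t) + (c + \<theta> t) * \<theta>' t + \<theta>' t + t * \<theta>'' t)) (at t)"
        unfolding B_def by (rule derivative_eq_intros d\<theta>[OF p(3)] refl | simp add: algebra_simps)+
      have A0: "A t \<noteq> 0" using Xt by simp
      have dh': "(h has_real_derivative h t / t * A t) (at t)" unfolding A_def by (rule dh[OF p(3)])
      \<comment> \<open>In h'' / h'^2 the powers of x cancel and B / (A^2 h) remains, so
        differentiating it involves only two derivatives of \<theta>.\<close>
      have "((\<lambda>x. B x / ((A x)\<^sup>2 * h x)) has_real_derivative
         ((\<theta>' t * (c - 1 + \<theta> t) + (c + \<theta> t) * \<theta>' t + \<theta>' t + t * \<theta>'' t) * ((A t)\<^sup>2 * h t) -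
          B t * (2 * A t * \<theta>' t * h t + (A t)\<^sup>2 * (h t / t * A t))) / (((A t)\<^sup>2 * h t) * ((A t)\<^sup>2 * h t))) (at t)"
        by (rule derivative_eq_intros dA dB dh' refl | use A0 p in \<open>simp add: algebra_simps\<close>)+
      moreover have "((\<theta>' t * (c - 1 + \<theta> t) + (c + \<theta> t) * \<theta>' t + \<theta>' t + t * \<theta>'' t) * ((A t)\<^sup>2 * h t) -
          B t * (2 * A t * \<theta>' t * h t + (A t)\<^sup>2 * (h t / t * A t))) / (((A t)\<^sup>2 * h t) * ((A t)\<^sup>2 * h t)) = \<kappa>' t"
        unfolding \<kappa>'_def K_def using A0 p(1,2) by (simp add: field_simps power2_eq_square power3_eq_cube)
      ultimately have "((\<lambda>x. B x / ((A x)\<^sup>2 * h x)) has_real_derivative \<kappa>' t) (at t)" by simp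
      moreover have "B x / ((A x)\<^sup>2 * h x) = h'' x / (h' x)\<^sup>2" if "x0 < x" for x
        using that assms(1) hpos[of x] unfolding h''_def h'_def by (simp add: field_simps power2_eq_square)
      ultimately show ?thesis
        using has_field_derivative_transform_within_open[of "\<lambda>x. B x / ((A x)\<^sup>2 * h x)" "\<kappa>' t" t "{x0<..}"] p(3) by auto
    qed
    have th': "t * h' t = h t * A t" unfolding h'_def using p by simp
    show "h t \<le> t * h' t" unfolding th' using Xt p by (simp add: mult_le_cancel_left1)
    show "t * h' t \<le> 2 * h t" unfolding th' using Xt p by (simp add: mult.commute)
    have th'': "t\<^sup>2 * h'' t = h t * B t" unfolding h''_def using p by simp
    show "e * h t \<le> t\<^sup>2 * h'' t" unfolding th'' using Xt p by (simp add: mult.commute)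
    show "t\<^sup>2 * h'' t \<le> h t / e"
    proof -
      have "h t * B t \<le> h t * (1 / e)" using Xt p by (intro mult_left_mono) auto
      then show ?thesis unfolding th'' by simp
    qed
    have k: "- \<kappa>' t * (t * h t) = K t" unfolding \<kappa>'_def using p by simp
    show "e \<le> - \<kappa>' t * (t * h t)" "- \<kappa>' t * (t * h t) \<le> 1 / e" unfolding k using Xt by auto
    show "t powr c \<le> h t" using hl[of t] p by simp
    \<comment> \<open>Since A stays below 21/20, this quotient decreases, and its value at X serves
      as \<open>C0\<close>. The assumption c < 30/29 leaves room below 21/20.\<close>
    have "h t / t powr (21/20) \<le> h X / X powr (21/20)"
    proof (rule DERIV_nonpos_imp_nonincreasing[OF t])
      fix x assume x: "X \<le> x" "x \<le> t"
      note px = pos[OF x(1)]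
      have pw: "x powr (21/20 - 1) = x powr (21/20) / x" using px by (simp only: powr_diff) simp
      have dd: "((\<lambda>x. h x / x powr (21/20)) has_real_derivative
          ((h x / x * (c + \<theta> x)) * x powr (21/20) - h x * (21/20 * x powr (21/20 - 1))) / (x powr (21/20) * x powr (21/20))) (at x)"
        by (rule DERIV_divide[OF dh[OF px(3)] has_real_derivative_powr[OF px(1)]]) (use px in simp)
      have eq: "(h x / x * (c + \<theta> x)) * x powr (21/20) - h x * (21/20 * x powr (21/20 - 1)) =
          h x * x powr (21/20) / x * (A x - 21/20)"
        unfolding A_def pw using px by (simp add: field_simps)
      have le: "h x * x powr (21/20) / x * (A x - 21/20) \<le> 0"
        using px X[OF x(1)] by (intro mult_nonneg_nonpos) auto
      show "\<exists>y. ((\<lambda>x. h x / x powr (21/20)) has_real_derivative y) (at x) \<and> y \<le> 0"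
        by (rule exI, rule conjI, rule dd[unfolded eq], rule divide_nonpos_nonneg[OF le]) simp
    qed
    also have "\<dots> \<le> C0" unfolding C0_def by simp
    finally show "h t \<le> C0 * t powr (21/20)" using p by (simp add: pos_divide_le_eq)
  qed
  then show ?thesis using pos(3)[of X] by blast
qed

text \<open>Intended for h2: the inverse is the one on the full domain, but derivative information
  is available only from x1 on, so the formula holds for arguments beyond h x1.\<close>

lemma the_inv_into_deriv:
  fixes h h' :: "real \<Rightarrow> real"
  assumes mono: "strict_mono_on {x0..} h" and x1: "x0 < x1"
    and d: "\<And>x. x1 \<le> x \<Longrightarrow> (h has_real_derivative h' x) (at x)" and h': "\<And>x. x1 \<le> x \<Longrightarrow> 0 < h' x"
    and ge: "\<And>x. x1 \<le> x \<Longrightarrow> x \<le> h x" and y: "h x1 < y"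
  defines "\<phi> \<equiv> the_inv_into {x0..} h"
  shows "x1 < \<phi> y" "h (\<phi> y) = y" "deriv \<phi> y = 1 / h' (\<phi> y)"
proof -
  have inj: "inj_on h {x0..}" using mono by (rule strict_mono_on_imp_inj_on)
  have \<phi>h: "\<phi> (h x) = x" if "x0 \<le> x" for x unfolding \<phi>_def using that by (intro the_inv_into_f_f[OF inj]) auto
  have surj: "\<exists>x\<ge>x1. h x = z" if "h x1 \<le> z" for z
  proof -
    have "x1 \<le> h x1" using ge by simp
    then have "x1 \<le> z" "z \<le> h z" using that ge[of z] by auto
    then have "\<exists>t. x1 \<le> t \<and> t \<le> z \<and> h t = z"
      by (intro IVT) (use that d DERIV_isCont in auto)
    then show ?thesis by auto
  qed
  obtain x where x: "x1 \<le> x" "h x = y" using surj[of y] y by auto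
  have xx: "x1 < x" using x y by (cases "x = x1") auto
  have \<phi>y: "\<phi> y = x" using \<phi>h[of x] x x1 by simp
  show "x1 < \<phi> y" "h (\<phi> y) = y" using \<phi>y x xx by auto
  have ch: "isCont h z" if "x1 \<le> z" for z using DERIV_isCont[OF d[OF that]] .
  have cont: "isCont \<phi> y" unfolding x(2)[symmetric]
    by (rule isCont_inverse_function2[where f = h and a = x1 and b = "x + 1"]) (use xx x1 \<phi>h ch in auto)
  have "DERIV \<phi> y :> inverse (h' (\<phi> y))"
  proof (rule DERIV_inverse_function[where f = h and a = "h x1" and b = "y + 1"])
    show "(h has_real_derivative h' (\<phi> y)) (at (\<phi> y))" using d \<phi>y x by simp
    show "h' (\<phi> y) \<noteq> 0" using h'[of "\<phi> y"] \<phi>y x by simp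
    show "h (\<phi> z) = z" if "h x1 < z" "z < y + 1" for z
      using surj[of z] that \<phi>h x1 by auto
  qed (use y cont in auto)
  then show "deriv \<phi> y = 1 / h' (\<phi> y)" by (simp add: DERIV_imp_deriv inverse_eq_divide)
qed

section \<open>Structure and density of the sets\<close>

text \<open>The floor of t - \<delta> drops by 1 exactly when frac t < \<delta>. The identity
  reduces counting such t to two sawtooth sums.\<close>

lemma of_bool_frac_less_eq_saw:
  assumes "0 < \<delta>" "\<delta> < 1"
  shows "of_bool (frac t < \<delta>) = \<delta> + saw (t - \<delta>) - saw t"
proof -
  have "frac (t - \<delta>) = frac t - \<delta> + of_bool (frac t < \<delta>)"
  proof (cases "frac t < \<delta>")
    case True
    have "\<lfloor>t - \<delta>\<rfloor> = \<lfloor>t\<rfloor> - 1" using True assms unfolding frac_def by linarith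
    then show ?thesis using True by (simp add: frac_def)
  next
    case False
    have "\<lfloor>t - \<delta>\<rfloor> = \<lfloor>t\<rfloor>" using False assms unfolding frac_def by linarith
    then show ?thesis using False by (simp add: frac_def)
  qed
  then show ?thesis unfolding saw_def by simp
qed

lemma power_of_2_bracket:
  fixes y :: real assumes "1 \<le> y"
  obtains K :: nat where "2 ^ K \<le> y" "y < 2 ^ Suc K"
proof -
  define n where "n = (LEAST n. y < 2 ^ n)"
  have ex: "\<exists>n. y < 2 ^ n" using real_arch_pow[of 2 y] by auto
  have n: "y < 2 ^ n" unfolding n_def using ex by (rule LeastI_ex)
  have "n \<noteq> 0" using n assms by (cases "n = 0") auto
  then obtain K where K: "n = Suc K" using not0_implies_Suc by blast
  have "\<not> y < 2 ^ K" using not_less_Least[of K "\<lambda>n. y < 2 ^ n"] K unfolding n_def by simp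
  then show thesis using that[of K] n unfolding K by simp
qed

lemma sum_dyadic_blocks:
  fixes u :: "nat \<Rightarrow> real"
  shows "(\<Sum>m\<in>{2 ^ k..<2 ^ (k + d)}. u m) = (\<Sum>i<d. \<Sum>m\<in>{2 ^ (k + i)..<2 * 2 ^ (k + i)}. u m)"
proof (induction d)
  case (Suc d)
  have "(\<Sum>m\<in>{2 ^ k..<2 ^ (k + Suc d)}. u m) =
      (\<Sum>m\<in>{2 ^ k..<2 ^ (k + d)}. u m) + (\<Sum>m\<in>{2 ^ (k + d)..<2 ^ (k + Suc d)}. u m)"
    by (rule sum.atLeastLessThan_concat[symmetric]) (auto intro: power_increasing)
  then show ?case using Suc by simp
qed simp

context regvar begin

text \<open>Equidistribution of h p modulo 1 on a block: the count is \<delta> M + O(M^(9/10)). The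
  sign s = -1 serves \<open>B_plus\<close>, where h p lies just below an integer, and s = 1 serves
  \<open>B_minus\<close>.\<close>

lemma frac_count:
  fixes s \<delta> :: real
  assumes s: "s = 1 \<or> s = -1" and \<delta>: "0 < \<delta>" "\<delta> < 1"
  shows "\<exists>k0. \<forall>k\<ge>k0. X < 2 ^ k \<and> \<delta> / 2 * 2 ^ k \<le> real (card {p \<in> {2 ^ k..<2 * 2 ^ k::nat}. frac (s * h (real p)) < \<delta>})"
proof -
  have "0 < e / (4 * C0)" using e C0 by simp
  from saw_sum_bound_powr[OF this] obtain C where C: "C > 0"
    and disc: "\<And>M. 1 \<le> M \<Longrightarrow> saw_sum_bound (e / (4 * C0)) M (C * M powr (9/10))"
    by blast
  \<comment> \<open>Beyond the tenth power of 4 C / \<delta> the error 2 C M^(9/10) is at most half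
    of the main term \<delta> M.\<close>
  obtain k0 where k0': "max (X + 2) ((4 * C / \<delta>) powr 10) < 2 ^ k0"
    using real_arch_pow[of 2 "max (X + 2) ((4 * C / \<delta>) powr 10)"] by auto
  have k0: "max (X + 2) ((4 * C / \<delta>) powr 10) \<le> 2 ^ k" if "k0 \<le> k" for k
    using k0' power_increasing[OF that, of "2::real"] by linarith
  show ?thesis
  proof (rule exI[of _ k0], intro allI impI conjI)
    fix k assume k: "k0 \<le> k"
    define M :: nat where "M = 2 ^ k"
    have MX': "X + 2 \<le> real M" "(4 * C / \<delta>) powr 10 \<le> real M" using k0[OF k] unfolding M_def by auto
    show "X < 2 ^ k" using k0[OF k] by simp
    interpret regvar_scale h h' h'' \<kappa>' X e c C0 M by unfold_locales (use MX' X1 in linarith)+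
    have M1: "1 \<le> real M" using M2 by simp
    have bound: "\<bar>\<Sum>p\<in>{M..<2*M}. saw (s * h (real p) - a)\<bar> \<le> C * real M powr (9/10)" for a
    proof (rule saw_sum_boundD[OF disc[OF M1], where f = "\<lambda>v. s * h v - a" and f' = "\<lambda>v. s * h' v" and lo = "e * D / (4 * (real M)\<^sup>2)" and hi = "4 * D / (e * (real M)\<^sup>2)"])
      show "\<forall>t. real M \<le> t \<and> t + 1 \<le> real (2 * M) \<longrightarrow> ((\<lambda>v. s * h v - a) has_real_derivative s * h' t) (at t)"
        using MX by (auto intro!: derivative_eq_intros dh)
      show "\<forall>v t. real M \<le> v \<and> v \<le> t \<and> t + 1 \<le> real (2 * M) \<longrightarrow>
        e * D / (4 * (real M)\<^sup>2) * (t - v) \<le> \<bar>s * h' t - s * h' v\<bar> \<and> \<bar>s * h' t - s * h' v\<bar> \<le> 4 * D / (e * (real M)\<^sup>2) * (t - v)"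
      proof (intro allI impI)
        fix v t assume vt: "real M \<le> v \<and> v \<le> t \<and> t + 1 \<le> real (2 * M)"
        have ab: "\<bar>s * h' t - s * h' v\<bar> = h' t - h' v" using s h'_mono[of v t] vt MX by auto
        show "e * D / (4 * (real M)\<^sup>2) * (t - v) \<le> \<bar>s * h' t - s * h' v\<bar> \<and> \<bar>s * h' t - s * h' v\<bar> \<le> 4 * D / (e * (real M)\<^sup>2) * (t - v)"
        proof (cases "v = t")
          case False
          have "\<exists>z>v. z < t \<and> h' t - h' v = (t - v) * h'' z"
            by (rule MVT2) (use False vt MX dh' in auto)
          then obtain z where z: "v < z" "z < t" "h' t - h' v = h'' z * (t - v)" by (auto simp: mult.commute)
          have "real M \<le> z" "z \<le> 2 * real M" using z vt by auto
          note bz = h''_dyadic[OF this]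
          have "0 \<le> t - v" using vt by simp
          then show ?thesis unfolding ab z(3) using mult_right_mono[OF bz(1)] mult_right_mono[OF bz(2)] by blast
        qed simp
      qed
      have D0: "0 < D" by (rule D_pos)
      have "e / (4 * C0) * real M powr (-21/20) \<le> e / 4 * real M powr (-1)"
      proof (rule mult_mono)
        show "e / (4 * C0) \<le> e / 4" using e C0 by (simp add: field_simps mult_le_cancel_left1)
        show "real M powr (-21/20) \<le> real M powr (-1)" using M1 by (intro powr_mono) auto
      qed (use e in auto)
      also have "\<dots> = e * real M / (4 * (real M)\<^sup>2)" using M_pos by (simp add: powr_minus_divide power2_eq_square)
      also have "\<dots> \<le> e * D / (4 * (real M)\<^sup>2)" using D_ge_M e by (intro divide_right_mono mult_left_mono) auto
      finally show "e / (4 * C0) * real M powr (-21/20) \<le> e * D / (4 * (real M)\<^sup>2)" .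
      show "0 \<le> 4 * D / (e * (real M)\<^sup>2)" using D0 e by simp
      have "D \<le> C0 * real M powr (21/20)" unfolding D_def using h_upper MX by simp
      then have "4 * D / (e * (real M)\<^sup>2) \<le> 4 * (C0 * real M powr (21/20)) / (e * (real M)\<^sup>2)"
        using e by (intro divide_right_mono mult_left_mono) auto
      also have "\<dots> = (real M powr (21/20) * real M powr (-2)) / (e / (4 * C0))"
        using M_pos by (simp add: powr_minus_divide powr_numeral mult_ac)
      also have "real M powr (21/20) * real M powr (-2) = real M powr (-19/20)" by (simp only: powr_add[symmetric]) simp
      finally show "4 * D / (e * (real M)\<^sup>2) \<le> real M powr (-19/20) / (e / (4 * C0))" .
    qed (use M1 in auto)
    have "real (card {p \<in> {M..<2*M}. frac (s * h (real p)) < \<delta>}) = (\<Sum>p\<in>{M..<2*M}. of_bool (frac (s * h (real p)) < \<delta>))"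
      by (subst sum_of_bool_eq) (auto simp: Int_def)
    also have "\<dots> = (\<Sum>p\<in>{M..<2*M}. \<delta> + saw (s * h (real p) - \<delta>) - saw (s * h (real p) - 0))"
      by (simp only: of_bool_frac_less_eq_saw[OF \<delta>] diff_0_right)
    also have "\<dots> = real M * \<delta> + (\<Sum>p\<in>{M..<2*M}. saw (s * h (real p) - \<delta>)) - (\<Sum>p\<in>{M..<2*M}. saw (s * h (real p) - 0))"
      by (simp only: sum.distrib sum_subtractf sum_constant card_atLeastLessThan) simp
    finally have cnt: "real M * \<delta> - 2 * (C * real M powr (9/10)) \<le> real (card {p \<in> {M..<2*M}. frac (s * h (real p)) < \<delta>})"
      using bound[of \<delta>] bound[of 0] by linarith
    have "4 * C / \<delta> \<le> real M powr (1/10)"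
    proof -
      have "((4 * C / \<delta>) powr 10) powr (1/10) \<le> real M powr (1/10)" using MX'(2) by (intro powr_mono2) auto
      moreover have "((4 * C / \<delta>) powr 10) powr (1/10) = 4 * C / \<delta>" by (subst powr_powr) (use C \<delta> in simp)
      ultimately show ?thesis by simp
    qed
    then have "2 * C \<le> \<delta> / 2 * real M powr (1/10)" using \<delta> by (simp add: field_simps)
    then have "2 * C * real M powr (9/10) \<le> \<delta> / 2 * real M powr (1/10) * real M powr (9/10)" by (rule mult_right_mono) simp
    also have "\<dots> = \<delta> / 2 * (real M powr (1/10) * real M powr (9/10))" by simp
    also have "real M powr (1/10) * real M powr (9/10) = real M" using M_pos by (simp only: powr_add[symmetric]) simp
    finally have "\<delta> / 2 * real M \<le> real (card {p \<in> {M..<2*M}. frac (s * h (real p)) < \<delta>})" using cnt by (simp add: algebra_simps)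
    then show "\<delta> / 2 * 2 ^ k \<le> real (card {p \<in> {2 ^ k..<2 * 2 ^ k::nat}. frac (s * h (real p)) < \<delta>})"
      unfolding M_def by simp
  qed
qed

text \<open>In both cases the fractional part condition puts \<open>n\<close> at bounded distance from some \<open>\<lfloor>h m\<rfloor>\<close>,
  because \<open>\<psi> n\<close> is comparable to the derivative of \<open>\<phi>\<close> at \<open>n\<close>.\<close>

lemma near_floor:
  assumes \<psi>: "\<And>y. Y \<le> y \<Longrightarrow> \<psi> y * h' (\<phi> y) \<le> \<delta>" and \<delta>: "0 \<le> \<delta>"
    and n: "Y \<le> real n" "h (X + real L + 2) \<le> real n"
    and fr: "frac (\<phi> (real n)) < \<psi> (real n) \<or> frac (- \<phi> (real n)) < \<psi> (real n)"
  shows "\<exists>m::nat. L \<le> m \<and> real m \<le> \<phi> (real n) + 1 \<and> \<bar>int n - \<lfloor>h (real m)\<rfloor>\<bar> \<le> \<lfloor>4 * \<delta>\<rfloor> + 2"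
proof -
  define v where "v = \<phi> (real n)"
  have nX: "h X \<le> real n" using n(2) h_le_iff[of X "X + real L + 2"] by simp
  have hv: "h v = real n" "X \<le> v" unfolding v_def using \<phi>_props nX by auto
  have vL: "X + real L + 2 \<le> v" using h_le_iff[of "X + real L + 2" v] hv n(2) by simp
  have \<psi>v: "\<psi> (real n) * h' v \<le> \<delta>" unfolding v_def using \<psi> n by simp
  have h1: "1 \<le> h' v" using h'_ge_1 hv by simp
  have close: "\<bar>int n - \<lfloor>h (real m)\<rfloor>\<bar> \<le> \<lfloor>4 * \<delta>\<rfloor> + 2" if "\<bar>real n - h (real m)\<bar> \<le> 4 * \<delta>" for m :: nat
  proof -
    have "\<bar>real n - real_of_int \<lfloor>h (real m)\<rfloor>\<bar> \<le> 4 * \<delta> + 1" using that by linarith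
    then have "real_of_int \<bar>int n - \<lfloor>h (real m)\<rfloor>\<bar> \<le> 4 * \<delta> + 1" by simp
    then show ?thesis by linarith
  qed
  show ?thesis using fr
  proof
    assume fr: "frac (\<phi> (real n)) < \<psi> (real n)"
    \<comment> \<open>Here \<phi> n lies just above the integer m. The distance from h m to n is at
      most the fractional part times the slope at v, hence at most \<delta>.\<close>
    define m where "m = nat \<lfloor>v\<rfloor>"
    have m: "real m = real_of_int \<lfloor>v\<rfloor>" unfolding m_def using vL X1 by simp
    have mv: "real m \<le> v" "v < real m + 1" unfolding m by linarith+
    have mX: "X \<le> real m" using mv vL by linarith
    have "h v - h (real m) \<le> (v - real m) * h' v" using h_gap(2) mX mv by simp
    also have "v - real m = frac v" unfolding m frac_def ..
    also have "frac v * h' v \<le> \<psi> (real n) * h' v" using fr h1 unfolding v_def by (intro mult_right_mono) auto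
    finally have "real n - h (real m) \<le> \<delta>" using \<psi>v hv by linarith
    moreover have "h (real m) \<le> real n" using h_le_iff[of "real m" v] mX mv hv by simp
    ultimately have "\<bar>real n - h (real m)\<bar> \<le> 4 * \<delta>" using \<delta> by linarith
    moreover have "L \<le> m" using mv vL X1 by linarith
    ultimately show ?thesis using close mv unfolding v_def[symmetric] by (intro exI[of _ m]) auto
  next
    assume fr: "frac (- \<phi> (real n)) < \<psi> (real n)"
    define m where "m = nat \<lceil>v\<rceil>"
    define M where "M = nat \<lfloor>v\<rfloor>"
    have m: "real m = real_of_int \<lceil>v\<rceil>" unfolding m_def using vL X1 by simp
    have M: "real M = real_of_int \<lfloor>v\<rfloor>" unfolding M_def using vL X1 by simp
    have mv: "v \<le> real m" "real m < v + 1" unfolding m by linarith+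
    have Mv: "real M \<le> v" "v < real M + 1" unfolding M by linarith+
    have "X < real M" "2 \<le> real M" using Mv vL X1 by linarith+
    \<comment> \<open>At the scale \<lfloor>v\<rfloor> both v and \<lceil>v\<rceil> lie in the same
      block. This compares the slope at the upper point m with the slope at v, at the price of a
      factor 4.\<close>
    then interpret regvar_scale h h' h'' \<kappa>' X e c C0 M by unfold_locales auto
    have mM: "real m \<le> 2 * real M" 
    proof -
      have "\<lceil>v\<rceil> \<le> \<lfloor>v\<rfloor> + 1" by linarith
      then have "real m \<le> real M + 1" unfolding m M by linarith
      then show ?thesis using M2 by simp
    qed
    have "h' (real m) \<le> 4 * (D / real M)" using h'_dyadic_upper[of "real m"] mM mv Mv by simp
    also have "\<dots> \<le> 4 * h' v" using h'_dyadic_lower[of v] Mv by (intro mult_left_mono) auto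
    finally have h4: "h' (real m) \<le> 4 * h' v" .
    have fv: "real m - v = frac (- v)" unfolding m frac_def by (simp add: ceiling_def)
    have "h (real m) - h v \<le> (real m - v) * h' (real m)" using h_gap(2)[OF hv(2) mv(1)] .
    also have "\<dots> \<le> (real m - v) * (4 * h' v)" using h4 mv by (intro mult_left_mono) auto
    also have "\<dots> = 4 * (frac (- v) * h' v)" unfolding fv by simp
    also have "frac (- v) * h' v \<le> \<psi> (real n) * h' v" using fr h1 unfolding v_def by (intro mult_right_mono) auto
    finally have "h (real m) - real n \<le> 4 * \<delta>" using \<psi>v hv by linarith
    moreover have "real n \<le> h (real m)" using h_le_iff[of v "real m"] mv hv by simp
    ultimately have "\<bar>real n - h (real m)\<bar> \<le> 4 * \<delta>" by linarith
    moreover have "L \<le> m" using mv vL X1 by linarith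
    ultimately show ?thesis using close mv unfolding v_def[symmetric] by (intro exI[of _ m]) auto
  qed
qed

text \<open>If h p lies just below the integer n, then \<phi> n lies just above p, at distance less
  than \<delta> / h' p. The factor 4 in the choice of \<delta> pays for comparing the slopes at p
  and at \<phi> n.\<close>

lemma ceiling_in_B:
  assumes \<psi>: "\<And>y. Y \<le> y \<Longrightarrow> \<delta>1 \<le> \<psi> y * h' (\<phi> y)" and \<delta>: "0 < \<delta>" "\<delta> < 1" "4 * \<delta> \<le> \<delta>1"
    and p: "X + 2 < real p" "Y \<le> h (real p)" and fr: "frac (- h (real p)) < \<delta>"
  defines "n \<equiv> nat \<lceil>h (real p)\<rceil>"
  shows "frac (\<phi> (real n)) < \<psi> (real n)" "h (real p) \<le> real n" "real n \<le> h (real p) + 1"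
proof -
  have pX: "X \<le> real p" using p by simp
  have n: "real n = real_of_int \<lceil>h (real p)\<rceil>" unfolding n_def using h_pos[OF pX] by simp
  show nb: "h (real p) \<le> real n" "real n \<le> h (real p) + 1" unfolding n by linarith+
  have nf: "real n - h (real p) = frac (- h (real p))" unfolding n frac_def by (simp add: ceiling_def)
  define v where "v = \<phi> (real n)"
  have hX: "h X \<le> h (real p)" using h_le_iff pX by simp
  have hn: "h X \<le> real n" using hX nb by linarith
  have hp: "1 \<le> h' (real p)" using h'_ge_1 pX by simp
  have pv: "real p \<le> v" unfolding v_def using \<phi>_mono[of "h (real p)" "real n"] \<phi>_h[OF pX] hX nb by simp
  have "v - real p \<le> (real n - h (real p)) / h' (real p)"
    unfolding v_def using \<phi>_gap(1)[of "h (real p)" "real n"] \<phi>_h[OF pX] hX nb by simp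
  also have "\<dots> < \<delta> / h' (real p)" using fr nf hp by (intro divide_strict_right_mono) auto
  finally have gap: "v - real p < \<delta> / h' (real p)" .
  also have "\<delta> / h' (real p) \<le> \<delta> / 1" using hp \<delta> by (intro divide_left_mono) auto
  finally have v1: "v < real p + 1" using \<delta> by linarith
  interpret regvar_scale h h' h'' \<kappa>' X e c C0 p by unfold_locales (use p X1 in linarith)+
  have "h' v \<le> 4 * (D / real p)" using h'_dyadic_upper[of v] v1 pv M2 by simp
  also have "\<dots> \<le> 4 * h' (real p)" using h'_dyadic_lower[of "real p"] by (intro mult_left_mono) auto
  finally have h4: "h' v \<le> 4 * h' (real p)" .
  have hv: "1 \<le> h' v" using h'_ge_1 pv pX by simp
  have "\<lfloor>v\<rfloor> = int p" using pv v1 by (simp add: floor_eq_iff)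
  then have "frac v = v - real p" unfolding frac_def by simp
  also have "\<dots> < \<delta> / h' (real p)" by (rule gap)
  also have "\<dots> \<le> (\<delta>1 / 4) / h' (real p)" using \<delta> hp by (intro divide_right_mono) auto
  also have "\<dots> = \<delta>1 / (4 * h' (real p))" by simp
  also have "\<dots> \<le> \<delta>1 / h' v" using h4 hv hp \<delta> by (intro divide_left_mono) auto
  also have "\<dots> \<le> \<psi> (real n)" using \<psi>[of "real n"] nb p hv unfolding v_def[symmetric] by (simp add: pos_divide_le_eq)
  finally show "frac (\<phi> (real n)) < \<psi> (real n)" unfolding v_def .
qed

text \<open>The mirror image: h p just above n puts \<phi> n just below p. The gap is measured with
  the slope at its left end \<phi> n, which is the one in the hypothesis on \<psi>.\<close>

lemma floor_in_B:
  assumes \<psi>: "\<And>y. Y \<le> y \<Longrightarrow> \<delta>1 \<le> \<psi> y * h' (\<phi> y)" and \<delta>: "0 < \<delta>" "\<delta> < 1" "4 * \<delta> \<le> \<delta>1"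
    and p: "X + 2 < real p" "Y + 1 \<le> h (real p)" and fr: "frac (h (real p)) < \<delta>"
  defines "n \<equiv> nat \<lfloor>h (real p)\<rfloor>"
  shows "frac (- \<phi> (real n)) < \<psi> (real n)" "h (real p) - 1 \<le> real n" "real n \<le> h (real p)"
proof -
  have pX: "X \<le> real p" "X \<le> real p - 1" using p by auto
  have n: "real n = real_of_int \<lfloor>h (real p)\<rfloor>" unfolding n_def using h_pos[OF pX(1)] by simp
  show nb: "h (real p) - 1 \<le> real n" "real n \<le> h (real p)" unfolding n by linarith+
  have nf: "h (real p) - real n = frac (h (real p))" unfolding n frac_def by simp
  \<comment> \<open>Taking the floor lowers h p by less than 1 while h' is at least 1, so h (p - 1)
    is at most n. This keeps n in the range of h on [X, \<infinity>).\<close>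
  have "1 * 1 \<le> (real p - (real p - 1)) * h' (real p - 1)" using h'_ge_1[OF pX(2)] by simp
  then have g1: "h (real p - 1) \<le> real n" using h_gap(1)[OF pX(2), of "real p"] nb by simp
  define v where "v = \<phi> (real n)"
  have hX: "h X \<le> real n" using g1 h_le_iff[of X "real p - 1"] pX by simp
  have vX: "X \<le> v" unfolding v_def using \<phi>_props hX by simp
  have hv: "1 \<le> h' v" using h'_ge_1 vX by simp
  have vp: "v \<le> real p" unfolding v_def using \<phi>_mono[of "real n" "h (real p)"] \<phi>_h[OF pX(1)] hX nb by simp
  have "real p - v \<le> (h (real p) - real n) / h' v"
    unfolding v_def using \<phi>_gap(1)[of "real n" "h (real p)"] \<phi>_h[OF pX(1)] hX nb by simp
  also have "\<dots> < \<delta> / h' v" using fr nf hv by (intro divide_strict_right_mono) auto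
  finally have gap: "real p - v < \<delta> / h' v" .
  also have "\<delta> / h' v \<le> \<delta> / 1" using hv \<delta> by (intro divide_left_mono) auto
  finally have v1: "real p - v < 1" using \<delta> by linarith
  have "\<lfloor>- v\<rfloor> = - int p" using vp v1 by (simp add: floor_eq_iff)
  then have "frac (- v) = real p - v" unfolding frac_def by simp
  also have "\<dots> < \<delta> / h' v" by (rule gap)
  also have "\<dots> \<le> \<delta>1 / h' v" using hv \<delta> by (intro divide_right_mono) auto
  also have "\<dots> \<le> \<psi> (real n)" using \<psi>[of "real n"] nb p hv unfolding v_def[symmetric] by (simp add: pos_divide_le_eq)
  finally show "frac (- \<phi> (real n)) < \<psi> (real n)" unfolding v_def .
qed

text \<open>A fixed proportion of the p in a block just below \<phi> N satisfies the condition of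
  \<open>frac_count\<close>, and each yields an element of B by rounding h p. Rounding is injective
  because values of h at distinct integers differ by at least 1.\<close>

lemma card_B_lower:
  assumes \<psi>: "\<And>y. Y \<le> y \<Longrightarrow> \<delta>1 \<le> \<psi> y * h' (\<phi> y)" and \<delta>1: "0 < \<delta>1"
    and B: "(\<forall>n. Y \<le> real n \<and> frac (\<phi> (real n)) < \<psi> (real n) \<longrightarrow> n \<in> B) \<or>
      (\<forall>n. Y \<le> real n \<and> frac (- \<phi> (real n)) < \<psi> (real n) \<longrightarrow> n \<in> B)"
  shows "\<exists>c0>0. \<exists>N0. \<forall>N\<ge>N0. c0 * \<phi> (real N) \<le> real (card (B \<inter> {1..N}))"
proof -
  define \<delta> where "\<delta> = min (1/2) (\<delta>1 / 8)"
  have \<delta>: "0 < \<delta>" "\<delta> < 1" "4 * \<delta> \<le> \<delta>1" unfolding \<delta>_def using \<delta>1 by auto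
  have "\<exists>(s::real) (g :: nat \<Rightarrow> nat). (s = 1 \<or> s = -1) \<and> (\<forall>p q. X \<le> real p \<and> p < q \<longrightarrow> g p \<noteq> g q) \<and>
    (\<forall>p. X + 2 < real p \<and> \<bar>Y\<bar> + 2 \<le> h (real p) \<and> frac (s * h (real p)) < \<delta> \<longrightarrow>
      g p \<in> B \<and> 1 \<le> g p \<and> real (g p) \<le> h (real p) + 1)"
  proof -
    have sep: "h (real p) + 1 \<le> h (real q)" if "X \<le> real p" "p < q" for p q :: nat
    proof -
      have "1 * 1 \<le> (real q - real p) * h' (real p)" using that h'_ge_1[OF that(1)] by (intro mult_mono) auto
      then show ?thesis using h_gap(1)[OF that(1), of "real q"] that by simp
    qed
    show ?thesis using B
    proof
      assume B: "\<forall>n. Y \<le> real n \<and> frac (\<phi> (real n)) < \<psi> (real n) \<longrightarrow> n \<in> B"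
      show ?thesis
      proof (rule exI[of _ "-1"], rule exI[of _ "\<lambda>p. nat \<lceil>h (real p)\<rceil>"], intro conjI allI impI)
        fix p q :: nat assume pq: "X \<le> real p \<and> p < q"
        have "\<lceil>h (real p)\<rceil> < \<lceil>h (real q)\<rceil>" using sep[of p q] pq by linarith
        moreover have "0 < \<lceil>h (real p)\<rceil>" using h_pos[of "real p"] pq by simp
        ultimately show "nat \<lceil>h (real p)\<rceil> \<noteq> nat \<lceil>h (real q)\<rceil>" by linarith
      next
        fix p :: nat assume p: "X + 2 < real p \<and> \<bar>Y\<bar> + 2 \<le> h (real p) \<and> frac (- 1 * h (real p)) < \<delta>"
        have q: "X + 2 < real p" "Y \<le> h (real p)" "frac (- h (real p)) < \<delta>" using p by auto
        note c = ceiling_in_B[OF \<psi> \<delta> q]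
        have "Y \<le> real (nat \<lceil>h (real p)\<rceil>)" using c(2) q(2) by linarith
        then show "nat \<lceil>h (real p)\<rceil> \<in> B" using B c(1) by blast
        have "0 < real (nat \<lceil>h (real p)\<rceil>)" using c(2) p by linarith
        then show "1 \<le> nat \<lceil>h (real p)\<rceil>" by linarith
        show "real (nat \<lceil>h (real p)\<rceil>) \<le> h (real p) + 1" by (rule c(3))
      qed simp
    next
      assume B: "\<forall>n. Y \<le> real n \<and> frac (- \<phi> (real n)) < \<psi> (real n) \<longrightarrow> n \<in> B"
      show ?thesis
      proof (rule exI[of _ "1"], rule exI[of _ "\<lambda>p. nat \<lfloor>h (real p)\<rfloor>"], intro conjI allI impI)
        fix p q :: nat assume pq: "X \<le> real p \<and> p < q"
        have "\<lfloor>h (real p)\<rfloor> < \<lfloor>h (real q)\<rfloor>" using sep[of p q] pq by linarith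
        moreover have "0 \<le> \<lfloor>h (real p)\<rfloor>" using h_pos[of "real p"] pq by simp
        ultimately show "nat \<lfloor>h (real p)\<rfloor> \<noteq> nat \<lfloor>h (real q)\<rfloor>" by linarith
      next
        fix p :: nat assume p: "X + 2 < real p \<and> \<bar>Y\<bar> + 2 \<le> h (real p) \<and> frac (1 * h (real p)) < \<delta>"
        have q: "X + 2 < real p" "Y + 1 \<le> h (real p)" "frac (h (real p)) < \<delta>" using p by auto
        note c = floor_in_B[OF \<psi> \<delta> q]
        have "Y \<le> real (nat \<lfloor>h (real p)\<rfloor>)" using c(2) q(2) by linarith
        then show "nat \<lfloor>h (real p)\<rfloor> \<in> B" using B c(1) by blast
        have "0 < real (nat \<lfloor>h (real p)\<rfloor>)" using c(2) p by linarith
        then show "1 \<le> nat \<lfloor>h (real p)\<rfloor>" by linarith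
        show "real (nat \<lfloor>h (real p)\<rfloor>) \<le> h (real p) + 1" using c(3) by linarith
      qed simp
    qed
  qed
  then obtain s g where s: "s = 1 \<or> s = (-1::real)" and g_inj: "\<And>p q. X \<le> real p \<Longrightarrow> p < q \<Longrightarrow> g p \<noteq> (g q :: nat)"
    and g: "\<And>p. X + 2 < real p \<Longrightarrow> \<bar>Y\<bar> + 2 \<le> h (real p) \<Longrightarrow> frac (s * h (real p)) < \<delta> \<Longrightarrow>
      g p \<in> B \<and> 1 \<le> g p \<and> real (g p) \<le> h (real p) + 1" by blast
  obtain k1 where k1: "\<And>k. k1 \<le> k \<Longrightarrow> X < 2 ^ k \<and>
      \<delta> / 2 * 2 ^ k \<le> real (card {p \<in> {2 ^ k..<2 * 2 ^ k::nat}. frac (s * h (real p)) < \<delta>})"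
    using frac_count[OF s \<delta>(1,2)] by blast
  obtain k2 :: nat where k2: "max (X + 2) (\<bar>Y\<bar> + 2) < 2 ^ k2" using real_arch_pow[of 2 "max (X + 2) (\<bar>Y\<bar> + 2)"] by auto
  define k0 where "k0 = max k1 k2"
  define N0 where "N0 = nat \<lceil>h (2 ^ Suc k0)\<rceil>"
  have X0: "X < 2 ^ k0" using k1[of k0] unfolding k0_def by simp
  show ?thesis
  proof (rule exI[of _ "\<delta> / 8"], intro conjI, use \<delta> in simp, rule exI[of _ N0], intro allI impI)
    fix N assume "N0 \<le> N"
    then have "h (2 ^ Suc k0) \<le> real N" unfolding N0_def by linarith
    moreover have Xk: "X \<le> 2 ^ Suc k0" using X0 X1 by simp
    ultimately have NX: "h X \<le> real N" and v: "2 ^ Suc k0 \<le> \<phi> (real N)"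
    proof -
      assume a: "h (2 ^ Suc k0) \<le> real N" "X \<le> 2 ^ Suc k0"
      show "h X \<le> real N" using h_le_iff[of X "2 ^ Suc k0"] a by simp
      then show "2 ^ Suc k0 \<le> \<phi> (real N)" using h_le_iff[of "2 ^ Suc k0" "\<phi> (real N)"] \<phi>_props a by simp
    qed
    have "1 \<le> \<phi> (real N)" using v one_le_power[of "2::real" "Suc k0"] by linarith
    then obtain K where K: "2 ^ K \<le> \<phi> (real N)" "\<phi> (real N) < 2 ^ Suc K" using power_of_2_bracket by blast
    have "(2::real) ^ Suc k0 < 2 ^ Suc K" using v K by linarith
    then have "k0 < K" by simp
    \<comment> \<open>The block below 2^K is used, so that p + 1 \<le> \<phi> N and the rounded
      value is at most h (p + 1) \<le> N. Since \<phi> N < 4 * 2^k, the proportion \<delta>/2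
      becomes \<delta>/8.\<close>
    then obtain k where k: "K = Suc k" "k0 \<le> k" by (metis less_imp_Suc_add less_Suc_eq_le le_add1)
    let ?S = "{p \<in> {2 ^ k..<2 * 2 ^ k::nat}. frac (s * h (real p)) < \<delta>}"
    have pb: "2 ^ k \<le> real p" "real p + 1 \<le> 2 ^ Suc k" if "p \<in> ?S" for p
    proof -
      have "2 ^ k \<le> p" "p + 1 \<le> 2 * 2 ^ k" using that by auto
      then have "real (2 ^ k) \<le> real p" "real (p + 1) \<le> real (2 * 2 ^ k)" by (simp_all only: of_nat_le_iff)
      then show "2 ^ k \<le> real p" "real p + 1 \<le> 2 ^ Suc k" by simp_all
    qed
    have big: "max (X + 2) (\<bar>Y\<bar> + 2) < real p" if "p \<in> ?S" for p
    proof -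
      have "(2::real) ^ k2 \<le> 2 ^ k" using k unfolding k0_def by (intro power_increasing) auto
      then show ?thesis using k2 pb[OF that] by linarith
    qed
    have "g ` ?S \<subseteq> B \<inter> {1..N}"
    proof
      fix n assume "n \<in> g ` ?S"
      then obtain p where p: "p \<in> ?S" "n = g p" by auto
      have pX: "X + 2 < real p" "\<bar>Y\<bar> + 2 \<le> h (real p)" "X \<le> real p"
        using big[OF p(1)] h_ge_self[of "real p"] by auto
      have gp: "g p \<in> B \<and> 1 \<le> g p \<and> real (g p) \<le> h (real p) + 1" using g pX p by auto
      have "h (real p) + 1 \<le> h (real p + 1)" using h_gap(1)[OF pX(3), of "real p + 1"] h'_ge_1[OF pX(3)] by simp
      also have "\<dots> \<le> h (\<phi> (real N))" 
        using h_le_iff[of "real p + 1" "\<phi> (real N)"] pX pb[OF p(1)] K k \<phi>_props[OF NX] by simp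
      finally have "real (g p) \<le> real N" using gp \<phi>_props[OF NX] by simp
      then show "n \<in> B \<inter> {1..N}" using gp p by simp
    qed
    then have "card (g ` ?S) \<le> card (B \<inter> {1..N})" by (intro card_mono) auto
    moreover have "card (g ` ?S) = card ?S"
    proof (rule card_image, rule linorder_inj_onI)
      fix p q assume "p < q" "p \<in> ?S" "q \<in> ?S"
      then show "g p \<noteq> g q" using g_inj[of p q] big[of p] by simp
    qed auto
    ultimately have "real (card ?S) \<le> real (card (B \<inter> {1..N}))" by simp
    moreover have "\<delta> / 2 * 2 ^ k \<le> real (card ?S)" using k1[of k] k unfolding k0_def by simp
    moreover have "\<delta> / 8 * \<phi> (real N) \<le> \<delta> / 8 * 2 ^ Suc K" using K \<delta> by (intro mult_left_mono) auto
    moreover have "\<delta> / 8 * 2 ^ Suc K = \<delta> / 2 * 2 ^ k" unfolding k by simp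
    ultimately show "\<delta> / 8 * \<phi> (real N) \<le> real (card (B \<inter> {1..N}))" by linarith
  qed
qed

end

section \<open>Weak type and strong type of the maximal function\<close>

text \<open>The level set is tested on finite subsets Z and the norm is replaced by a finite partial
  sum. In this form the estimate makes sense for every f, so interpolation can apply it to
  truncations of f directly.\<close>

definition finite_weak_type :: "nat set \<Rightarrow> real \<Rightarrow> bool" where
  "finite_weak_type B C \<longleftrightarrow> (\<forall>(f :: int \<Rightarrow> complex) \<mu> Z. 0 < \<mu> \<longrightarrow> finite Z \<longrightarrow>
     (\<forall>x\<in>Z. ennreal \<mu> < maximal_fun B f x) \<longrightarrow>
     (\<exists>S. finite S \<and> real (card Z) \<le> C / \<mu> * (\<Sum>y\<in>S. cmod (f y))))"

lemma finite_weak_typeD: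
  assumes "finite_weak_type B C" "0 < \<mu>" "finite Z" "\<And>x. x \<in> Z \<Longrightarrow> ennreal \<mu> < maximal_fun B f x"
  obtains S where "finite S" "real (card Z) \<le> C / \<mu> * (\<Sum>y\<in>S. cmod (f y))"
  using assms unfolding finite_weak_type_def by blast

lemma less_maximal_fun_iff:
  assumes "0 \<le> \<mu>"
  shows "ennreal \<mu> < maximal_fun B f x \<longleftrightarrow>
    (\<exists>N\<ge>1. B \<inter> {1..N} \<noteq> {} \<and> \<mu> < (\<Sum>n\<in>B \<inter> {1..N}. cmod (f (x - int n))) / real (card (B \<inter> {1..N})))"
  unfolding maximal_fun_def less_SUP_iff using assms by (auto simp: ennreal_less_iff)

lemma maximal_fun_le:
  assumes "\<And>y. cmod (f y) \<le> K"
  shows "maximal_fun B f x \<le> ennreal K"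
  unfolding maximal_fun_def
proof (rule SUP_least)
  fix N assume "N \<in> {N. 1 \<le> N \<and> B \<inter> {1..N} \<noteq> {}}"
  then have c: "0 < card (B \<inter> {1..N})" by (simp add: card_gt_0_iff)
  have "(\<Sum>n\<in>B \<inter> {1..N}. cmod (f (x - int n))) \<le> (\<Sum>n\<in>B \<inter> {1..N}. K)" by (intro sum_mono assms)
  then have "1 / real (card (B \<inter> {1..N})) * (\<Sum>n\<in>B \<inter> {1..N}. cmod (f (x - int n))) \<le> K"
    using c by (simp add: divide_le_eq mult.commute)
  then show "ennreal (1 / real (card (B \<inter> {1..N})) * (\<Sum>n\<in>B \<inter> {1..N}. cmod (f (x - int n)))) \<le> ennreal K"
    by (rule ennreal_leI)
qed

text \<open>Values of modulus at most \<mu> contribute at most \<mu> to any average, so the larger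
  values alone must produce the other half of 2 \<mu>.\<close>

lemma maximal_fun_truncate:
  assumes "0 \<le> \<mu>" "ennreal (2 * \<mu>) < maximal_fun B f x"
  shows "ennreal \<mu> < maximal_fun B (\<lambda>y. if \<mu> < cmod (f y) then f y else 0) x"
proof -
  let ?g = "\<lambda>y. if \<mu> < cmod (f y) then f y else 0"
  obtain N where N: "1 \<le> N" "B \<inter> {1..N} \<noteq> {}"
    "2 * \<mu> < (\<Sum>n\<in>B \<inter> {1..N}. cmod (f (x - int n))) / real (card (B \<inter> {1..N}))"
    using assms less_maximal_fun_iff[of "2 * \<mu>"] by auto
  have c: "0 < card (B \<inter> {1..N})" using N by (simp add: card_gt_0_iff)
  have "(\<Sum>n\<in>B \<inter> {1..N}. cmod (f (x - int n))) \<le> (\<Sum>n\<in>B \<inter> {1..N}. \<mu> + cmod (?g (x - int n)))"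
    using assms(1) by (intro sum_mono) auto
  also have "\<dots> = real (card (B \<inter> {1..N})) * \<mu> + (\<Sum>n\<in>B \<inter> {1..N}. cmod (?g (x - int n)))"
    by (simp add: sum.distrib)
  finally have "(\<Sum>n\<in>B \<inter> {1..N}. cmod (f (x - int n))) / real (card (B \<inter> {1..N})) \<le>
      \<mu> + (\<Sum>n\<in>B \<inter> {1..N}. cmod (?g (x - int n))) / real (card (B \<inter> {1..N}))"
    using c by (simp add: field_simps)
  then have "\<mu> < (\<Sum>n\<in>B \<inter> {1..N}. cmod (?g (x - int n))) / real (card (B \<inter> {1..N}))" using N(3) by linarith
  then show ?thesis using less_maximal_fun_iff[OF assms(1)] N by blast
qed

section \<open>Norms on the integers through finite sums\<close>

lemma nn_integral_count_space_int_le: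
  fixes g :: "int \<Rightarrow> ennreal"
  assumes "\<And>Z. finite Z \<Longrightarrow> (\<Sum>x\<in>Z. g x) \<le> K"
  shows "(\<integral>\<^sup>+ x. g x \<partial>count_space UNIV) \<le> K"
proof -
  have bij: "bij_betw (from_nat_into (UNIV :: int set)) UNIV UNIV"
    by (rule bij_betw_from_nat_into) (auto simp: infinite_UNIV_int)
  have "(\<integral>\<^sup>+ x. g x \<partial>count_space UNIV) = (\<Sum>n. g (from_nat_into UNIV n))"
    by (simp add: nn_integral_bij_count_space[OF bij, symmetric] nn_integral_count_space_nat)
  also have "\<dots> \<le> K"
  proof (rule suminf_le_const)
    fix n
    have "inj_on (from_nat_into (UNIV :: int set)) {..<n}" using bij by (auto simp: bij_betw_def intro: inj_on_subset)
    then have "(\<Sum>i<n. g (from_nat_into UNIV i)) = (\<Sum>x\<in>from_nat_into UNIV ` {..<n}. g x)"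
      by (simp add: sum.reindex)
    then show "(\<Sum>i<n. g (from_nat_into UNIV i)) \<le> K" using assms by simp
  qed (rule summableI)
  finally show ?thesis .
qed

lemma sum_le_nn_integral_count_space:
  fixes g :: "int \<Rightarrow> ennreal"
  assumes "finite Z"
  shows "(\<Sum>x\<in>Z. g x) \<le> (\<integral>\<^sup>+ x. g x \<partial>count_space UNIV)"
proof -
  have "(\<Sum>x\<in>Z. g x) = (\<integral>\<^sup>+ x. g x \<partial>count_space Z)" using assms by (simp add: nn_integral_count_space_finite)
  also have "\<dots> = (\<integral>\<^sup>+ x. g x * indicator Z x \<partial>count_space UNIV)" by (rule nn_integral_count_space_indicator) simp
  also have "\<dots> \<le> (\<integral>\<^sup>+ x. g x \<partial>count_space UNIV)" by (intro nn_integral_mono) (auto simp: indicator_def)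
  finally show ?thesis .
qed

lemma ennreal_powr_ennreal: "0 \<le> a \<Longrightarrow> ennreal_powr (ennreal a) s = ennreal (a powr s)"
  by (simp add: ennreal_powr_def)

lemma lp_norm_complex_finite:
  assumes p: "p \<noteq> \<infinity>" and f: "f \<in> lp_space p" and q: "0 < enn2real p"
  obtains T where "0 \<le> T" "lp_norm_complex p f = ennreal (T powr (1 / enn2real p))"
    "\<And>S. finite S \<Longrightarrow> (\<Sum>y\<in>S. cmod (f y) powr enn2real p) \<le> T"
proof -
  let ?q = "enn2real p"
  define I where "I = (\<integral>\<^sup>+ x. ennreal (cmod (f x) powr ?q) \<partial>count_space UNIV)"
  have nrm: "lp_norm_complex p f = ennreal_powr I (1 / ?q)"
    unfolding lp_norm_def I_def using p by (simp add: ennreal_powr_ennreal)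
  have "I \<noteq> \<infinity>" using f nrm unfolding lp_space_def by (auto simp: ennreal_powr_def)
  then have I: "I = ennreal (enn2real I)" by (simp add: less_top)
  show thesis
  proof (rule that[of "enn2real I"])
    show "0 \<le> enn2real I" by simp
    show "lp_norm_complex p f = ennreal (enn2real I powr (1 / ?q))"
      using nrm \<open>I \<noteq> \<infinity>\<close> by (simp add: ennreal_powr_def)
    fix S :: "int set" assume "finite S"
    then have "(\<Sum>y\<in>S. ennreal (cmod (f y) powr ?q)) \<le> I" unfolding I_def by (rule sum_le_nn_integral_count_space)
    then have "ennreal (\<Sum>y\<in>S. cmod (f y) powr ?q) \<le> ennreal (enn2real I)" using I by simp
    then show "(\<Sum>y\<in>S. cmod (f y) powr ?q) \<le> enn2real I" by (subst (asm) ennreal_le_iff) auto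
  qed
qed

lemma weak_type_1_1:
  assumes wt: "finite_weak_type B C" and C: "0 < C" and f: "f \<in> lp_space 1" and \<alpha>: "0 < \<alpha>"
  shows "emeasure (count_space UNIV) {x. maximal_fun B f x > ennreal \<alpha>} \<le> ennreal (C / \<alpha>) * lp_norm_complex 1 f"
proof -
  obtain T where T: "0 \<le> T" "lp_norm_complex 1 f = ennreal (T powr (1 / enn2real 1))"
    "\<And>S. finite S \<Longrightarrow> (\<Sum>y\<in>S. cmod (f y) powr enn2real 1) \<le> T"
    by (rule lp_norm_complex_finite[OF _ f]) auto
  have nrm: "lp_norm_complex 1 f = ennreal T" using T by simp
  let ?E = "{x. maximal_fun B f x > ennreal \<alpha>}"
  have bound: "real (card Z) \<le> C / \<alpha> * T" if Z: "finite Z" "Z \<subseteq> ?E" for Z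
  proof -
    obtain S where S: "finite S" "real (card Z) \<le> C / \<alpha> * (\<Sum>y\<in>S. cmod (f y))"
      by (rule finite_weak_typeD[OF wt \<alpha> Z(1), of f]) (use Z in auto)
    have "(\<Sum>y\<in>S. cmod (f y)) \<le> T" using T(3)[OF S(1)] by simp
    then have "C / \<alpha> * (\<Sum>y\<in>S. cmod (f y)) \<le> C / \<alpha> * T" using C \<alpha> by (intro mult_left_mono) auto
    then show ?thesis using S by linarith
  qed
  \<comment> \<open>The uniform bound on the cardinality of finite subsets forces the whole level
    set to be finite.\<close>
  have fin: "finite ?E"
  proof (rule ccontr)
    assume "infinite ?E"
    then obtain Z where "finite Z" "card Z = Suc (nat \<lceil>C / \<alpha> * T\<rceil>)" "Z \<subseteq> ?E"
      using infinite_arbitrarily_large by blast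
    then show False using bound[of Z] by linarith
  qed
  then have "emeasure (count_space UNIV) ?E = ennreal (real (card ?E))" by (simp add: ennreal_of_nat_eq_real_of_nat)
  also have "\<dots> \<le> ennreal (C / \<alpha> * T)" using bound[OF fin] by (intro ennreal_leI) auto
  also have "\<dots> = ennreal (C / \<alpha>) * lp_norm_complex 1 f" unfolding nrm
    by (rule ennreal_mult) (use C \<alpha> T in auto)
  finally show ?thesis .
qed

lemma sum_dyadic_powr_le:
  fixes s t :: real and J :: "int set"
  assumes J: "finite J" "\<And>i. i \<in> J \<Longrightarrow> 2 powr real_of_int i < t" and s: "0 < s" and t: "0 \<le> t"
  shows "(\<Sum>i\<in>J. (2 powr real_of_int i) powr s) \<le> t powr s * (1 / (1 - 2 powr (- s)))"
proof (cases "J = {}")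
  case False
  define m where "m = Max J"
  have m: "m \<in> J" "\<And>i. i \<in> J \<Longrightarrow> i \<le> m" using J False unfolding m_def by auto
  define r where "r = (2::real) powr (- s)"
  have r: "0 \<le> r" "r < 1" unfolding r_def using s powr_less_mono[of "- s" 0 "2::real"] by auto
  have "(2 powr real_of_int i) powr s = (2 powr real_of_int m) powr s * r ^ nat (m - i)" if "i \<in> J" for i
  proof -
    have "real_of_int i * s = real_of_int m * s + (- s) * real (nat (m - i))" using m(2)[OF that] by (simp add: algebra_simps)
    then have "(2::real) powr (real_of_int i * s) = 2 powr (real_of_int m * s) * 2 powr ((- s) * real (nat (m - i)))"
      by (simp only: powr_add)
    also have "(2::real) powr ((- s) * real (nat (m - i))) = r ^ nat (m - i)"
      unfolding r_def by (simp only: powr_powr[symmetric]) (simp add: powr_realpow)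
    finally show ?thesis by (simp add: powr_powr)
  qed
  then have "(\<Sum>i\<in>J. (2 powr real_of_int i) powr s) = (2 powr real_of_int m) powr s * (\<Sum>i\<in>J. r ^ nat (m - i))"
    by (simp add: sum_distrib_left)
  also have "(\<Sum>i\<in>J. r ^ nat (m - i)) = (\<Sum>j\<in>(\<lambda>i. nat (m - i)) ` J. r ^ j)"
    by (subst sum.reindex) (auto intro!: inj_onI dest!: m(2))
  also have "(2 powr real_of_int m) powr s * \<dots> \<le> t powr s * (1 / (1 - r))"
  proof (rule mult_mono)
    show "(2 powr real_of_int m) powr s \<le> t powr s"
      using J(2)[OF m(1)] s by (intro powr_mono2) auto
    show "(\<Sum>j\<in>(\<lambda>i. nat (m - i)) ` J. r ^ j) \<le> 1 / (1 - r)" using J(1) r by (intro sum_geometric_le) auto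
    show "0 \<le> (\<Sum>j\<in>(\<lambda>i. nat (m - i)) ` J. r ^ j)" using r by (intro sum_nonneg) auto
  qed simp
  finally show ?thesis unfolding r_def .
qed (use s t in \<open>simp add: powr_less_mono[of "- s" 0 "2::real", simplified] less_imp_le\<close>)

text \<open>Marcinkiewicz interpolation with the trivial bound on \<open>\<ell>\<^sup>\<infinity>\<close>, dyadic in the level.\<close>

lemma strong_type_finite:
  fixes f :: "int \<Rightarrow> complex"
  assumes wt: "finite_weak_type B C" and C: "0 < C" and q: "1 < q"
    and T: "\<And>S. finite S \<Longrightarrow> (\<Sum>y\<in>S. cmod (f y) powr q) \<le> T"
    and fin: "\<And>x. maximal_fun B f x < \<infinity>" and Z: "finite Z"
  shows "(\<Sum>x\<in>Z. enn2real (maximal_fun B f x) powr q) \<le> 4 powr q * C * (1 / (1 - 2 powr (- (q - 1)))) * T"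
proof -
  define F where "F = (\<lambda>x. enn2real (maximal_fun B f x))"
  have F: "0 \<le> F x" "maximal_fun B f x = ennreal (F x)" for x unfolding F_def using fin[of x] by (auto simp: less_top)
  define Z' where "Z' = {x \<in> Z. 0 < F x}"
  have Z': "finite Z'" unfolding Z'_def using Z by simp
  \<comment> \<open>The level is two steps below the size: 2^(lev + 1) < F \<le> 2^(lev + 2). The
    factor 2 on the left is what \<open>maximal_fun_truncate\<close> consumes.\<close>
  define lev where "lev = (\<lambda>x. \<lceil>log 2 (F x)\<rceil> - 2)"
  have lev: "2 * 2 powr real_of_int (lev x) < F x" "F x \<le> 4 * 2 powr real_of_int (lev x)" if "x \<in> Z'" for x
  proof -
    have Fx: "0 < F x" using that by (simp add: Z'_def)
    have "real_of_int (lev x) + 1 < log 2 (F x)" "log 2 (F x) \<le> real_of_int (lev x) + 2"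
      unfolding lev_def by linarith+
    then have "2 powr (real_of_int (lev x) + 1) < F x" "F x \<le> 2 powr (real_of_int (lev x) + 2)"
      using Fx by (simp_all add: less_log_iff log_le_iff)
    then show "2 * 2 powr real_of_int (lev x) < F x" "F x \<le> 4 * 2 powr real_of_int (lev x)"
      by (simp_all add: powr_add mult.commute)
  qed
  define I where "I = lev ` Z'"
  define Zi where "Zi = (\<lambda>i. {x \<in> Z'. lev x = i})"
  let ?l = "\<lambda>i::int. 2 powr real_of_int i"
  have "\<exists>S. finite S \<and> real (card (Zi i)) \<le> C / ?l i * (\<Sum>y\<in>S. cmod (if ?l i < cmod (f y) then f y else 0))" for i
  proof -
    have mem: "ennreal (?l i) < maximal_fun B (\<lambda>y. if ?l i < cmod (f y) then f y else 0) x" if x: "x \<in> Zi i" for x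
    proof (rule maximal_fun_truncate)
      have "2 * ?l i < F x" using lev(1)[of x] x by (auto simp: Zi_def)
      then show "ennreal (2 * ?l i) < maximal_fun B f x" unfolding F(2) by (simp add: ennreal_less_iff)
    qed simp
    have fz: "finite (Zi i)" unfolding Zi_def using Z' by simp
    obtain S where "finite S"
      "real (card (Zi i)) \<le> C / ?l i * (\<Sum>y\<in>S. cmod (if ?l i < cmod (f y) then f y else 0))"
      by (rule finite_weak_typeD[OF wt _ fz mem]) auto
    then show ?thesis by blast
  qed
  then have "\<forall>i. \<exists>S. finite S \<and> real (card (Zi i)) \<le> C / ?l i * (\<Sum>y\<in>S. cmod (if ?l i < cmod (f y) then f y else 0))" ..
  from choice[OF this] obtain Si where Si: "\<And>i. finite (Si i)"
    "\<And>i. real (card (Zi i)) \<le> C / ?l i * (\<Sum>y\<in>Si i. cmod (if ?l i < cmod (f y) then f y else 0))" by blast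
  define S where "S = (\<Union>i\<in>I. Si i)"
  have fS: "finite S" "finite I" unfolding S_def I_def using Si Z' by auto
  have card_Zi: "real (card (Zi i)) \<le> C / ?l i * (\<Sum>y\<in>S. of_bool (?l i < cmod (f y)) * cmod (f y))" if "i \<in> I" for i
  proof -
    have "(\<Sum>y\<in>Si i. cmod (if ?l i < cmod (f y) then f y else 0)) = (\<Sum>y\<in>Si i. of_bool (?l i < cmod (f y)) * cmod (f y))"
      by (intro sum.cong) auto
    also have "\<dots> \<le> (\<Sum>y\<in>S. of_bool (?l i < cmod (f y)) * cmod (f y))"
      using fS that unfolding S_def by (intro sum_mono2) auto
    finally have "C / ?l i * (\<Sum>y\<in>Si i. cmod (if ?l i < cmod (f y) then f y else 0)) \<le>
        C / ?l i * (\<Sum>y\<in>S. of_bool (?l i < cmod (f y)) * cmod (f y))"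
      using C by (intro mult_left_mono) auto
    then show ?thesis using Si(2)[of i] by linarith
  qed
  have "(\<Sum>x\<in>Z. F x powr q) = (\<Sum>x\<in>Z'. F x powr q)"
    using Z F(1) by (intro sum.mono_neutral_right) (auto simp: Z'_def less_le)
  also have "\<dots> = (\<Sum>i\<in>I. \<Sum>x\<in>Zi i. F x powr q)"
    unfolding I_def Zi_def by (rule sum.image_gen[OF Z'])
  also have "\<dots> \<le> (\<Sum>i\<in>I. \<Sum>x\<in>Zi i. 4 powr q * ?l i powr q)"
  proof (intro sum_mono)
    fix i x assume "x \<in> Zi i"
    then have x: "x \<in> Z'" "lev x = i" by (auto simp: Zi_def)
    have "F x powr q \<le> (4 * ?l i) powr q" using lev(2)[OF x(1)] x(2) F(1) q by (intro powr_mono2) auto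
    then show "F x powr q \<le> 4 powr q * ?l i powr q" by (simp add: powr_mult)
  qed
  also have "\<dots> = (\<Sum>i\<in>I. real (card (Zi i)) * (4 powr q * ?l i powr q))" by simp
  also have "\<dots> \<le> (\<Sum>i\<in>I. (C / ?l i * (\<Sum>y\<in>S. of_bool (?l i < cmod (f y)) * cmod (f y))) * (4 powr q * ?l i powr q))"
    using card_Zi by (intro sum_mono mult_right_mono) auto
  also have "\<dots> = (\<Sum>i\<in>I. \<Sum>y\<in>S. 4 powr q * C * (cmod (f y) * (of_bool (?l i < cmod (f y)) * ?l i powr (q - 1))))"
    by (intro sum.cong refl) (simp add: sum_distrib_left sum_distrib_right powr_diff mult_ac)
  also have "\<dots> = 4 powr q * C * (\<Sum>y\<in>S. cmod (f y) * (\<Sum>i\<in>I. of_bool (?l i < cmod (f y)) * ?l i powr (q - 1)))"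
    by (subst sum.swap) (simp add: sum_distrib_left)
  \<comment> \<open>For fixed y only levels below the modulus of f y occur. As q > 1, their powers
    of exponent q - 1 form a geometric series dominated by the top level.\<close>
  also have "\<dots> \<le> 4 powr q * C * (\<Sum>y\<in>S. (1 / (1 - 2 powr (- (q - 1)))) * cmod (f y) powr q)"
  proof (intro mult_left_mono sum_mono)
    fix y
    have "(\<Sum>i\<in>I. of_bool (?l i < cmod (f y)) * ?l i powr (q - 1)) = (\<Sum>i\<in>{i \<in> I. ?l i < cmod (f y)}. ?l i powr (q - 1))"
      using fS by (intro sum.mono_neutral_cong_right) auto
    also have "\<dots> \<le> cmod (f y) powr (q - 1) * (1 / (1 - 2 powr (- (q - 1))))"
      using fS q by (intro sum_dyadic_powr_le) auto
    finally have "cmod (f y) * (\<Sum>i\<in>I. of_bool (?l i < cmod (f y)) * ?l i powr (q - 1)) \<le>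
        cmod (f y) * (cmod (f y) powr (q - 1) * (1 / (1 - 2 powr (- (q - 1)))))" by (intro mult_left_mono) auto
    also have "\<dots> = (cmod (f y) * cmod (f y) powr (q - 1)) * (1 / (1 - 2 powr (- (q - 1))))" by simp
    also have "cmod (f y) * cmod (f y) powr (q - 1) = cmod (f y) powr q"
    proof (cases "f y = 0")
      case False
      then show ?thesis by (simp add: powr_diff)
    qed simp
    finally show "cmod (f y) * (\<Sum>i\<in>I. of_bool (?l i < cmod (f y)) * ?l i powr (q - 1)) \<le>
        1 / (1 - 2 powr (- (q - 1))) * cmod (f y) powr q" by (simp only: mult.commute)
  qed (use C in auto)
  also have "\<dots> = 4 powr q * C * (1 / (1 - 2 powr (- (q - 1)))) * (\<Sum>y\<in>S. cmod (f y) powr q)"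
    by (simp add: sum_distrib_left)
  also have "\<dots> \<le> 4 powr q * C * (1 / (1 - 2 powr (- (q - 1)))) * T"
  proof (rule mult_left_mono[OF T[OF fS(1)]])
    have "(2::real) powr (- (q - 1)) < 1" using powr_less_mono[of "- (q - 1)" 0 "2::real"] q by simp
    then show "0 \<le> 4 powr q * C * (1 / (1 - 2 powr (- (q - 1))))" using C by simp
  qed
  finally show ?thesis unfolding F_def .
qed

lemma strong_type:
  assumes wt: "finite_weak_type B C" and C: "0 < C" and p: "1 < p"
  shows "\<exists>C'>0. \<forall>f\<in>lp_space p. lp_norm p (maximal_fun B f) \<le> ennreal C' * lp_norm_complex p f"
proof (cases "p = \<infinity>")
  case True
  have "lp_norm p (maximal_fun B f) \<le> ennreal 1 * lp_norm_complex p f" if f: "f \<in> lp_space p" for f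
  proof -
    define s where "s = (SUP x. ennreal (cmod (f x)))"
    have s: "s < \<infinity>" using f True unfolding lp_space_def lp_norm_def s_def by simp
    then have se: "s = ennreal (enn2real s)" by (simp add: less_top)
    have "ennreal (cmod (f y)) \<le> ennreal (enn2real s)" for y
      unfolding se[symmetric] unfolding s_def by (rule SUP_upper) simp
    then have "cmod (f y) \<le> enn2real s" for y by (subst (asm) ennreal_le_iff) auto
    then have "maximal_fun B f x \<le> s" for x using maximal_fun_le se by metis
    then show ?thesis unfolding lp_norm_def using True s_def by (simp add: SUP_least)
  qed
  then show ?thesis by (intro exI[of _ 1]) auto
next
  case False
  define q where "q = enn2real p"
  have pq: "p = ennreal q" unfolding q_def using False by (simp add: less_top)
  have q: "1 < q" using p unfolding pq by (metis ennreal_1 ennreal_less_iff zero_le_one)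
  define K where "K = 4 powr q * C * (1 / (1 - 2 powr (- (q - 1))))"
  have K: "0 < K"
  proof -
    have "(2::real) powr (- (q - 1)) < 1" using powr_less_mono[of "- (q - 1)" 0 "2::real"] q by simp
    then show ?thesis unfolding K_def using C by simp
  qed
  have "lp_norm p (maximal_fun B f) \<le> ennreal (K powr (1 / q)) * lp_norm_complex p f" if f: "f \<in> lp_space p" for f
  proof -
    obtain T where T: "0 \<le> T" "lp_norm_complex p f = ennreal (T powr (1 / q))"
      "\<And>S. finite S \<Longrightarrow> (\<Sum>y\<in>S. cmod (f y) powr q) \<le> T"
      unfolding q_def by (rule lp_norm_complex_finite[OF False f]) (use q q_def in auto)
    \<comment> \<open>A function in \<open>lp_space p\<close> is bounded, hence its maximal function
      is finite everywhere and real powers of it make sense.\<close>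
    have "cmod (f y) \<le> T powr (1 / q)" for y
    proof -
      have "(cmod (f y) powr q) powr (1 / q) \<le> T powr (1 / q)" using T(3)[of "{y}"] q by (intro powr_mono2) auto
      then show ?thesis using q by (simp add: powr_powr)
    qed
    then have fin: "maximal_fun B f x < \<infinity>" for x using maximal_fun_le[of f "T powr (1 / q)" B x]
      by (metis ennreal_less_top infinity_ennreal_def le_less_trans)
    have "ennreal_powr (maximal_fun B f x) q = ennreal (enn2real (maximal_fun B f x) powr q)" for x
      using fin[of x] by (simp add: ennreal_powr_def)
    then have intB: "(\<integral>\<^sup>+ x. ennreal_powr (maximal_fun B f x) q \<partial>count_space UNIV) \<le> ennreal (K * T)"
      using strong_type_finite[OF wt C q T(3) fin] unfolding K_def
      by (intro nn_integral_count_space_int_le) (auto intro!: ennreal_leI)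
    define J where "J = enn2real (\<integral>\<^sup>+ x. ennreal_powr (maximal_fun B f x) q \<partial>count_space UNIV)"
    have "(\<integral>\<^sup>+ x. ennreal_powr (maximal_fun B f x) q \<partial>count_space UNIV) < \<infinity>"
      using intB by (rule le_less_trans) simp
    then have J: "(\<integral>\<^sup>+ x. ennreal_powr (maximal_fun B f x) q \<partial>count_space UNIV) = ennreal J" "0 \<le> J"
      unfolding J_def by (simp_all add: less_top)
    have "J \<le> K * T"
      using intB K T(1) unfolding J(1) by (subst (asm) ennreal_le_iff) auto
    have "lp_norm p (maximal_fun B f) = ennreal (J powr (1 / q))"
      unfolding lp_norm_def q_def[symmetric] using False J by (simp add: ennreal_powr_ennreal)
    also have "\<dots> \<le> ennreal ((K * T) powr (1 / q))" using J \<open>J \<le> K * T\<close> q by (intro ennreal_leI powr_mono2) auto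
    also have "\<dots> = ennreal (K powr (1 / q)) * lp_norm_complex p f"
      unfolding T(2) using K T(1) by (simp add: powr_mult ennreal_mult)
    finally show ?thesis .
  qed
  then show ?thesis using K by (intro exI[of _ "K powr (1 / q)"]) auto
qed

section \<open>Transfer from block averages to averages over \<open>B\<close>\<close>

context regvar begin

text \<open>An average over B up to N splits into the finitely many n \<le> N2, handled by single
  translates, and the rest, which \<open>near\<close> maps into shifts of block sums. The lower
  bound c0 \<phi> N for the number of elements turns the block sums, of length about \<phi> N, back
  into averages.\<close>

lemma finite_weak_type_B:
  fixes B :: "nat set" and J :: int and c0 :: real
  assumes near: "\<And>L. \<exists>N1. \<forall>n\<in>B. N1 < n \<longrightarrow> (\<exists>m::nat. L \<le> m \<and> real m \<le> \<phi> (real n) + 1 \<and> \<bar>int n - \<lfloor>h (real m)\<rfloor>\<bar> \<le> J)"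
    and J: "0 \<le> J" and c0: "0 < c0" and lower: "\<exists>N0. \<forall>N\<ge>N0. c0 * \<phi> (real N) \<le> real (card (B \<inter> {1..N}))"
  shows "\<exists>C>0. finite_weak_type B C"
proof -
  obtain C1 k0 where C1: "0 < C1" and block: "\<And>(f :: int \<Rightarrow> real) \<alpha> F. (\<forall>x. 0 \<le> f x) \<Longrightarrow> finite {x. f x \<noteq> 0} \<Longrightarrow> 0 < \<alpha> \<Longrightarrow> finite F \<Longrightarrow>
     (\<forall>n\<in>F. \<exists>k\<ge>k0. 6 * \<alpha> < block_avg h k 0 f n) \<Longrightarrow> real (card F) \<le> C1 / \<alpha> * (\<Sum>x | f x \<noteq> 0. f x)"
    using weak_type_block_avg by blast
  obtain N1 where N1: "\<And>n. n \<in> B \<Longrightarrow> N1 < n \<Longrightarrow>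
      \<exists>m::nat. 2 ^ k0 \<le> m \<and> real m \<le> \<phi> (real n) + 1 \<and> \<bar>int n - \<lfloor>h (real m)\<rfloor>\<bar> \<le> J"
    using near[of "2 ^ k0"] by blast
  obtain N0 where N0: "\<And>N. N0 \<le> N \<Longrightarrow> c0 * \<phi> (real N) \<le> real (card (B \<inter> {1..N}))" using lower by blast
  define N2 where "N2 = max (max N0 N1) (nat \<lceil>h (X + 2 ^ k0)\<rceil>)"
  have N2: "N0 \<le> N2" "N1 \<le> N2" "h (X + 2 ^ k0) \<le> real N2" unfolding N2_def by linarith+
  have big: "h X \<le> real N" "2 ^ k0 \<le> \<phi> (real N)" if "N2 \<le> N" for N
  proof -
    have a: "h (X + 2 ^ k0) \<le> real N" using N2 that by linarith
    moreover have "h X \<le> h (X + 2 ^ k0)" using h_le_iff by simp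
    ultimately show "h X \<le> real N" by linarith
    then have "X + 2 ^ k0 \<le> \<phi> (real N)" using h_le_iff[of "X + 2 ^ k0" "\<phi> (real N)"] \<phi>_props a by simp
    then show "2 ^ k0 \<le> \<phi> (real N)" using X1 by linarith
  qed
  define j1 where "j1 = real (card {- J..J})"
  have j1: "1 \<le> j1" unfolding j1_def using J by simp
  \<comment> \<open>The total bound for the sum will be A \<epsilon> \<phi> N: N2 + 1 single
    translates, and 24 for each of the \<open>j1\<close> shifts. Dividing by c0 \<phi> N gives A /
    c0, and \<open>C3\<close> exceeds both this and 1; the latter covers N \<le> N2.\<close>
  define A where "A = real N2 + 1 + 24 * j1"
  define C3 where "C3 = 2 + A / c0"
  have A: "0 < A" unfolding A_def using j1 by simp
  have C3: "0 < C3" "1 < C3" "A / c0 < C3" unfolding C3_def using A c0 by (auto simp: add_pos_pos)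
  define C where "C = C3 * ((real N2 + 1) + j1 * C1)"
  have C: "0 < C"
  proof -
    have "0 \<le> j1 * C1" using C1 j1 by simp
    then have "0 < real N2 + 1 + j1 * C1" by linarith
    then show ?thesis unfolding C_def using C3 by (intro mult_pos_pos)
  qed
  have "finite_weak_type B C" unfolding finite_weak_type_def
  proof (intro allI impI)
    fix f :: "int \<Rightarrow> complex" and \<mu> :: real and Z :: "int set"
    assume \<mu>: "0 < \<mu>" and Z: "finite Z" and big_max: "\<forall>x\<in>Z. ennreal \<mu> < maximal_fun B f x"
    have "\<forall>x\<in>Z. \<exists>N\<ge>1. B \<inter> {1..N} \<noteq> {} \<and> \<mu> < (\<Sum>n\<in>B \<inter> {1..N}. cmod (f (x - int n))) / real (card (B \<inter> {1..N}))"
      using big_max unfolding less_maximal_fun_iff[OF less_imp_le[OF \<mu>]] .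
    from bchoice[OF this] obtain Nx where Nx: "\<And>x. x \<in> Z \<Longrightarrow> B \<inter> {1..Nx x} \<noteq> {}"
      "\<And>x. x \<in> Z \<Longrightarrow> \<mu> < (\<Sum>n\<in>B \<inter> {1..Nx x}. cmod (f (x - int n))) / real (card (B \<inter> {1..Nx x}))"
      by blast
    \<comment> \<open>Only values of f seen from Z within the chosen ranges matter, so f may be
      replaced by a function of finite support, as \<open>block\<close> requires.\<close>
    define S where "S = (\<Union>x\<in>Z. (\<lambda>n. x - int n) ` {1..Nx x})"
    have S: "finite S" unfolding S_def using Z by auto
    define g where "g = (\<lambda>y. of_bool (y \<in> S) * cmod (f y))"
    have g0: "0 \<le> g y" for y unfolding g_def by simp
    define T where "T = (\<Sum>y\<in>S. cmod (f y))"
    have gT: "(\<Sum>y\<in>W. g y) \<le> T" if "finite W" for W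
    proof -
      have "(\<Sum>y\<in>W. g y) = (\<Sum>y\<in>W \<inter> S. cmod (f y))" using that unfolding g_def
        by (intro sum.mono_neutral_cong_right) auto
      also have "\<dots> \<le> T" unfolding T_def using S by (intro sum_mono2) auto
      finally show ?thesis .
    qed
    have gfin: "finite {x. g x \<noteq> 0}" by (rule finite_subset[OF _ S]) (auto simp: g_def)
    define \<epsilon> where "\<epsilon> = \<mu> / C3"
    have \<epsilon>: "0 < \<epsilon>" "\<mu> = C3 * \<epsilon>" unfolding \<epsilon>_def using \<mu> C3 by auto
    have dich: "(\<exists>i\<le>N2. \<epsilon> < g (x - int i)) \<or> (\<exists>j\<in>{- J..J}. \<exists>k\<ge>k0. 6 * \<epsilon> < block_avg h k 0 g (x - j))" if x: "x \<in> Z" for x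
    proof (rule ccontr)
      assume "\<not> ?thesis"
      then have sm: "\<And>i. i \<le> N2 \<Longrightarrow> g (x - int i) \<le> \<epsilon>"
        and bl: "\<And>j k. j \<in> {- J..J} \<Longrightarrow> k0 \<le> k \<Longrightarrow> block_avg h k 0 g (x - j) \<le> 6 * \<epsilon>" by (auto simp: not_less)
      define N where "N = Nx x"
      let ?BN = "B \<inter> {1..N}"
      have cpos: "0 < real (card ?BN)" using Nx(1)[OF x] unfolding N_def by (simp add: card_gt_0_iff)
      have eqg: "(\<Sum>n\<in>?BN. cmod (f (x - int n))) = (\<Sum>n\<in>?BN. g (x - int n))"
      proof (intro sum.cong refl)
        fix n assume "n \<in> ?BN"
        then have "x - int n \<in> (\<lambda>n. x - int n) ` {1..Nx x}" unfolding N_def by (intro imageI) simp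
        then have "x - int n \<in> S" unfolding S_def using x by blast
        then show "cmod (f (x - int n)) = g (x - int n)" unfolding g_def by simp
      qed
      have avg: "C3 * \<epsilon> * real (card ?BN) < (\<Sum>n\<in>?BN. g (x - int n))"
        using Nx(2)[OF x] cpos unfolding N_def[symmetric] eqg \<epsilon>(2) by (simp add: pos_less_divide_eq)
      show False
      proof (cases "N \<le> N2")
        case True
        have "(\<Sum>n\<in>?BN. g (x - int n)) \<le> (\<Sum>n\<in>?BN. \<epsilon>)" using True by (intro sum_mono sm) auto
        also have "\<dots> = 1 * \<epsilon> * real (card ?BN)" by simp
        also have "\<dots> \<le> C3 * \<epsilon> * real (card ?BN)" using C3 \<epsilon> by (intro mult_right_mono) auto
        finally show False using avg by simp
      next
        case False
        then have NN: "N2 \<le> N" by simp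
        have p1: "1 \<le> \<phi> (real N)" using big(2)[OF NN] one_le_power[of "2::real" k0] by linarith
        then have "1 \<le> \<phi> (real N) + 1" by simp
        then obtain K where K: "2 ^ K \<le> \<phi> (real N) + 1" "\<phi> (real N) + 1 < 2 ^ Suc K" using power_of_2_bracket by blast
        have "(2::real) ^ k0 < 2 ^ Suc K" using big(2)[OF NN] K by linarith
        then have "k0 < Suc K" by (simp only: power_strict_increasing_iff)
        then obtain d where d: "Suc K = k0 + d" using less_imp_add_positive by metis
        let ?B2 = "{n \<in> B. N2 < n \<and> n \<le> N}"
        have "\<exists>m::nat. 2 ^ k0 \<le> m \<and> real m \<le> \<phi> (real n) + 1 \<and> \<bar>int n - \<lfloor>h (real m)\<rfloor>\<bar> \<le> J" if "n \<in> ?B2" for n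
          using N1[of n] that N2 by auto
        then obtain m where m: "\<And>n. n \<in> ?B2 \<Longrightarrow> 2 ^ k0 \<le> m n \<and> real (m n) \<le> \<phi> (real n) + 1 \<and> \<bar>int n - \<lfloor>h (real (m n))\<rfloor>\<bar> \<le> J"
          by metis
        \<comment> \<open>Recording the deviation along with m makes the assignment injective, since
          n is recovered from the pair. Each block value is thus used at most once per shift
          j.\<close>
        define pr where "pr = (\<lambda>n. (int n - \<lfloor>h (real (m n))\<rfloor>, m n))"
        have pr_in: "pr n \<in> {- J..J} \<times> {2 ^ k0..<2 ^ (k0 + d)}" if n: "n \<in> ?B2" for n
        proof -
          have "h X \<le> real n" using big(1)[of n] n by simp
          then have "\<phi> (real n) \<le> \<phi> (real N)" using n by (intro \<phi>_mono) auto
          then have "real (m n) < 2 ^ Suc K" using m[OF n] K by linarith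
          then have "m n < 2 ^ Suc K" by (metis of_nat_less_numeral_power_cancel_iff)
          then show ?thesis using m[OF n] unfolding pr_def d by (auto simp: abs_le_iff)
        qed
        have inj: "inj_on pr ?B2" unfolding pr_def by (rule inj_onI) auto
        have "(\<Sum>n\<in>?B2. g (x - int n)) = (\<Sum>n\<in>?B2. (\<lambda>(j, m). g (x - j - \<lfloor>h (real m)\<rfloor>)) (pr n))"
          unfolding pr_def by (intro sum.cong) auto
        also have "\<dots> = (\<Sum>jm\<in>pr ` ?B2. (\<lambda>(j, m). g (x - j - \<lfloor>h (real m)\<rfloor>)) jm)"
          by (subst sum.reindex[OF inj]) simp
        also have "\<dots> \<le> (\<Sum>jm\<in>{- J..J} \<times> {2 ^ k0..<2 ^ (k0 + d)}. (\<lambda>(j, m). g (x - j - \<lfloor>h (real m)\<rfloor>)) jm)"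
        proof (rule sum_mono2)
          show "pr ` ?B2 \<subseteq> {- J..J} \<times> {2 ^ k0..<2 ^ (k0 + d)}" using pr_in by blast
        qed (use g0 in auto)
        also have "\<dots> = (\<Sum>j\<in>{- J..J}. \<Sum>m\<in>{2 ^ k0..<2 ^ (k0 + d)}. g (x - j - \<lfloor>h (real m)\<rfloor>))"
          by (simp add: sum.cartesian_product)
        also have "\<dots> \<le> (\<Sum>j\<in>{- J..J}. 24 * \<epsilon> * \<phi> (real N))"
        proof (rule sum_mono)
          fix j assume j: "j \<in> {- J..J}"
          have "(\<Sum>m\<in>{2 ^ k0..<2 ^ (k0 + d)}. g (x - j - \<lfloor>h (real m)\<rfloor>)) =
              (\<Sum>i<d. 2 ^ (k0 + i) * block_avg h (k0 + i) 0 g (x - j))"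
            unfolding sum_dyadic_blocks block_avg_def by simp
          also have "\<dots> \<le> (\<Sum>i<d. 2 ^ (k0 + i) * (6 * \<epsilon>))"
            by (intro sum_mono mult_left_mono bl[OF j]) auto
          also have "\<dots> = 6 * \<epsilon> * 2 ^ k0 * (\<Sum>i<d. 2 ^ i)" by (simp add: sum_distrib_left power_add mult_ac)
          also have "(\<Sum>i<d. (2::real) ^ i) = 2 ^ d - 1" by (induction d) auto
          also have "6 * \<epsilon> * 2 ^ k0 * (2 ^ d - 1) \<le> 6 * \<epsilon> * 2 ^ k0 * 2 ^ d" using \<epsilon> by (intro mult_left_mono) auto
          also have "\<dots> = 6 * \<epsilon> * 2 ^ Suc K" unfolding d by (simp add: power_add)
          \<comment> \<open>By the choice of K, 2^(K + 1) \<le> 2 (\<phi> N + 1), and this is at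
            most 4 \<phi> N because \<phi> N \<ge> 1.\<close>
          also have "\<dots> \<le> 6 * \<epsilon> * (4 * \<phi> (real N))" using K p1 \<epsilon> by (intro mult_left_mono) auto
          finally show "(\<Sum>m\<in>{2 ^ k0..<2 ^ (k0 + d)}. g (x - j - \<lfloor>h (real m)\<rfloor>)) \<le> 24 * \<epsilon> * \<phi> (real N)" by simp
        qed
        also have "\<dots> = j1 * (24 * \<epsilon> * \<phi> (real N))" unfolding j1_def by simp
        finally have far: "(\<Sum>n\<in>?B2. g (x - int n)) \<le> j1 * (24 * \<epsilon> * \<phi> (real N))" .
        have "(\<Sum>n\<in>?BN. g (x - int n)) \<le> (\<Sum>n\<in>{..N2} \<union> ?B2. g (x - int n))"
          using g0 by (intro sum_mono2) auto
        also have "\<dots> = (\<Sum>n\<in>{..N2}. g (x - int n)) + (\<Sum>n\<in>?B2. g (x - int n))"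
          by (intro sum.union_disjoint) auto
        also have "(\<Sum>n\<in>{..N2}. g (x - int n)) \<le> (\<Sum>n\<in>{..N2}. \<epsilon>)" by (intro sum_mono sm) auto
        also have "(\<Sum>n\<in>{..N2}. \<epsilon>) = (real N2 + 1) * \<epsilon>" by (simp add: algebra_simps)
        also have "\<dots> \<le> (real N2 + 1) * \<epsilon> * \<phi> (real N)" 
          using mult_left_mono[OF p1, of "(real N2 + 1) * \<epsilon>"] \<epsilon> by simp
        finally have "(\<Sum>n\<in>?BN. g (x - int n)) \<le> (real N2 + 1) * \<epsilon> * \<phi> (real N) + j1 * (24 * \<epsilon> * \<phi> (real N))" using far by simp
        also have "\<dots> = (A / c0) * \<epsilon> * (c0 * \<phi> (real N))" unfolding A_def using c0 by (simp add: field_simps)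
        also have "\<dots> \<le> C3 * \<epsilon> * real (card ?BN)"
        proof (intro mult_mono)
          show "c0 * \<phi> (real N) \<le> real (card ?BN)" using N0[of N] NN N2 by simp
        qed (use C3 \<epsilon> c0 p1 in auto)
        finally show False using avg by simp
      qed
    qed
    define Zs where "Zs = (\<lambda>i. {x \<in> Z. \<epsilon> < g (x - int i)})"
    define Zb where "Zb = (\<lambda>j. {x \<in> Z. \<exists>k\<ge>k0. 6 * \<epsilon> < block_avg h k 0 g (x - j)})"
    have "Z \<subseteq> (\<Union>i\<in>{..N2}. Zs i) \<union> (\<Union>j\<in>{- J..J}. Zb j)" unfolding Zs_def Zb_def using dich by fastforce
    then have "card Z \<le> card ((\<Union>i\<in>{..N2}. Zs i) \<union> (\<Union>j\<in>{- J..J}. Zb j))"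
      using Z by (intro card_mono) (auto simp: Zs_def Zb_def)
    also have "\<dots> \<le> card (\<Union>i\<in>{..N2}. Zs i) + card (\<Union>j\<in>{- J..J}. Zb j)" by (rule card_Un_le)
    also have "\<dots> \<le> (\<Sum>i\<in>{..N2}. card (Zs i)) + (\<Sum>j\<in>{- J..J}. card (Zb j))" by (intro add_mono card_UN_le) auto
    finally have "real (card Z) \<le> real ((\<Sum>i\<in>{..N2}. card (Zs i)) + (\<Sum>j\<in>{- J..J}. card (Zb j)))" by (rule of_nat_mono)
    also have "\<dots> = (\<Sum>i\<in>{..N2}. real (card (Zs i))) + (\<Sum>j\<in>{- J..J}. real (card (Zb j)))" by simp
    also have "\<dots> \<le> (\<Sum>i\<in>{..N2}. T / \<epsilon>) + (\<Sum>j\<in>{- J..J}. C1 / \<epsilon> * T)"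
    proof (intro add_mono sum_mono)
      fix i
      have "\<epsilon> * real (card (Zs i)) = (\<Sum>x\<in>Zs i. \<epsilon>)" by simp
      also have "\<dots> \<le> (\<Sum>x\<in>Zs i. g (x - int i))" by (intro sum_mono) (auto simp: Zs_def)
      also have "\<dots> = (\<Sum>y\<in>(\<lambda>x. x - int i) ` Zs i. g y)" by (subst sum.reindex) (auto intro: inj_onI)
      also have "\<dots> \<le> T" using Z by (intro gT) (auto simp: Zs_def)
      finally show "real (card (Zs i)) \<le> T / \<epsilon>" using \<epsilon> by (simp add: pos_le_divide_eq mult.commute)
    next
      fix j
      have "card (Zb j) = card ((\<lambda>x. x - j) ` Zb j)" by (rule card_image[symmetric]) (auto intro: inj_onI)
      also have "real \<dots> \<le> C1 / \<epsilon> * (\<Sum>x | g x \<noteq> 0. g x)"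
        using g0 gfin \<epsilon> Z by (intro block) (auto simp: Zb_def)
      also have "\<dots> \<le> C1 / \<epsilon> * T" using C1 \<epsilon> gT[OF gfin] by (intro mult_left_mono) auto
      finally show "real (card (Zb j)) \<le> C1 / \<epsilon> * T" .
    qed
    also have "\<dots> = (real N2 + 1) * (T / \<epsilon>) + j1 * (C1 / \<epsilon> * T)" unfolding j1_def by simp
    also have "\<dots> = C / \<mu> * T" unfolding C_def \<epsilon>_def using \<mu> C3 by (simp add: field_simps)
    finally show "\<exists>S. finite S \<and> real (card Z) \<le> C / \<mu> * (\<Sum>y\<in>S. cmod (f y))" using S unfolding T_def by blast
  qed
  then show ?thesis using C by blast
qed

end

text \<open>The decisive point is a two-sided bound for \<open>\<psi> y * h' (\<phi> y)\<close>:
  comparability of \<phi>1 and \<phi>2 transfers the size of the derivative of \<phi>2 to that of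
  \<phi>1. The upper bound feeds \<open>near_floor\<close>, the lower bound
  \<open>card_B_lower\<close>.\<close>

theorem theorem1p5:
  fixes x0 c1 c2 :: real
    and h1 h2 \<phi>1 \<phi>2 \<psi> \<psi>' \<psi>'' :: "real \<Rightarrow> real"
    and B :: "nat set"
  assumes "x0 \<ge> 1"
    and "1 < c1" and "c1 < 30 / 29"
    and "1 \<le> c2" and "c2 < 2"
    and "h1 \<in> class_R x0 c1" and "h2 \<in> class_R x0 c2"
    and "\<phi>1 = the_inv_into {x0..} h1" and "\<phi>2 = the_inv_into {x0..} h2"
    and "comparable_on (h1 ` {x0..} \<inter> h2 ` {x0..}) \<phi>1 \<phi>2"
    and "C2_from 1 \<psi> \<psi>' \<psi>''"
    and "\<forall>x\<ge>1. 0 < \<psi> x \<and> \<psi> x \<le> 1 / 2"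
    and "((\<lambda>x. \<psi> x / deriv \<phi>2 x) \<longlongrightarrow> 1) at_top"
    and "((\<lambda>x. \<psi>' x / deriv (deriv \<phi>2) x) \<longlongrightarrow> 1) at_top"
    and "((\<lambda>x. \<psi>'' x / deriv (deriv (deriv \<phi>2)) x) \<longlongrightarrow> 1) at_top"
    and "B = B_plus (h1 ` {x0..}) \<phi>1 \<psi> \<or> B = B_minus (h1 ` {x0..}) \<phi>1 \<psi>"
  shows "(\<exists>C>0. \<forall>f \<in> lp_space 1. \<forall>\<alpha>>0.
            emeasure (count_space UNIV) {x. maximal_fun B f x > ennreal \<alpha>}
              \<le> ennreal (C / \<alpha>) * lp_norm_complex 1 f)
       \<and> (\<forall>p::ennreal. p > 1 \<longrightarrow> (\<exists>C>0. \<forall>f \<in> lp_space p.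
            lp_norm p (maximal_fun B f) \<le> ennreal C * lp_norm_complex p f))"
proof -
  obtain h' h'' \<kappa>' X e C0 where rv: "regvar h1 h' h'' \<kappa>' X e c1 C0" and X: "x0 < X"
    using regvar_of_class_R[OF assms(1,6,2,3)] by blast
  interpret regvar h1 h' h'' \<kappa>' X e c1 C0 by (rule rv)
  have mono1: "strict_mono_on {x0..} h1" and mono2: "strict_mono_on {x0..} h2"
    using assms(6,7) unfolding class_R_def by auto
  have \<phi>1: "\<phi>1 y = \<phi> y" and mem1: "y \<in> h1 ` {x0..}" if "h1 X \<le> y" for y
  proof -
    have p: "X \<le> \<phi> y" "h1 (\<phi> y) = y" using \<phi>_props[OF that] by auto
    show "\<phi>1 y = \<phi> y" unfolding assms(8)
      by (rule the_inv_into_f_eq) (use p X strict_mono_on_imp_inj_on[OF mono1] in auto)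
    show "y \<in> h1 ` {x0..}" using p X by (auto intro!: image_eqI[of _ _ "\<phi> y"])
  qed
  obtain \<theta> where \<theta>: "(\<theta> \<longlongrightarrow> 0) at_top"
    and dh2: "\<And>x. x0 < x \<Longrightarrow> (h2 has_real_derivative h2 x / x * (c2 + \<theta> x)) (at x)"
    and h2l: "\<And>x. x0 \<le> x \<Longrightarrow> x powr c2 \<le> h2 x"
    using class_R_derivative[OF assms(1,7)] by blast
  \<comment> \<open>With c2 in [1,2) these bounds on \<theta> keep c2 + \<theta> between 1/2 and 3,
    so the derivative of h2 is comparable to h2 x / x.\<close>
  have "eventually (\<lambda>x. x0 < x \<and> -1/2 < \<theta> x \<and> \<theta> x < 1) at_top"
    by (intro eventually_conj eventually_gt_at_top order_tendstoD[OF \<theta>]) auto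
  then obtain X2 where X2: "\<And>x. X2 \<le> x \<Longrightarrow> x0 < x \<and> -1/2 < \<theta> x \<and> \<theta> x < 1"
    unfolding eventually_at_top_linorder by blast
  have h2_ge: "x \<le> h2 x" if "X2 \<le> x" for x
  proof -
    have "1 \<le> x" "x0 \<le> x" using X2[OF that] assms(1) by auto
    then have "x powr 1 \<le> x powr c2" using assms(4) by (intro powr_mono) auto
    then show ?thesis using h2l[of x] \<open>1 \<le> x\<close> \<open>x0 \<le> x\<close> by simp
  qed
  have \<phi>2: "X2 < \<phi>2 y" "h2 (\<phi>2 y) = y" "deriv \<phi>2 y = 1 / (h2 (\<phi>2 y) / \<phi>2 y * (c2 + \<theta> (\<phi>2 y)))" if "h2 X2 < y" for y
  proof -
    have d: "(h2 has_real_derivative h2 x / x * (c2 + \<theta> x)) (at x)" "0 < h2 x / x * (c2 + \<theta> x)" if "X2 \<le> x" for x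
    proof -
      show "(h2 has_real_derivative h2 x / x * (c2 + \<theta> x)) (at x)" using dh2 X2[OF that] by simp
      have "0 < x" "0 < h2 x" using X2[OF that] assms(1) h2_ge[OF that] by auto
      then show "0 < h2 x / x * (c2 + \<theta> x)" using X2[OF that] assms(4) by (intro mult_pos_pos divide_pos_pos) auto
    qed
    have x02: "x0 < X2" using X2[of X2] by simp
    show "X2 < \<phi>2 y" "h2 (\<phi>2 y) = y" "deriv \<phi>2 y = 1 / (h2 (\<phi>2 y) / \<phi>2 y * (c2 + \<theta> (\<phi>2 y)))"
      unfolding assms(9) using the_inv_into_deriv[OF mono2 x02 d h2_ge that] by simp_all
  qed
  obtain Ca Cb where Cab: "0 < Ca" "0 < Cb" "\<And>x. x \<in> h1 ` {x0..} \<inter> h2 ` {x0..} \<Longrightarrow> \<phi>1 x \<le> Ca * \<phi>2 x"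
    "\<And>x. x \<in> h1 ` {x0..} \<inter> h2 ` {x0..} \<Longrightarrow> \<phi>2 x \<le> Cb * \<phi>1 x"
    using assms(10) unfolding comparable_on_def by blast
  have "eventually (\<lambda>x. 1/2 < \<psi> x / deriv \<phi>2 x \<and> \<psi> x / deriv \<phi>2 x < 2) at_top"
    by (intro eventually_conj order_tendstoD[OF assms(13)]) auto
  then obtain X3 where X3: "\<And>x. X3 \<le> x \<Longrightarrow> 1/2 < \<psi> x / deriv \<phi>2 x \<and> \<psi> x / deriv \<phi>2 x < 2"
    unfolding eventually_at_top_linorder by blast
  define Y where "Y = max (h1 X) (max (h2 X2 + 1) X3)"
  \<comment> \<open>With u = \<phi> y and v = \<phi>2 y one gets v/(6 y) \<le> \<psi> y \<le> 4 v/y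
    and y/u \<le> h' u \<le> 2 y/u. The product lies between v/(6 u) and 8 v/u, and u \<le> Ca v, v
    \<le> Cb u give the constants.\<close>
  define \<delta>1 \<delta>2 where "\<delta>1 = 1 / (6 * Ca)" and "\<delta>2 = 8 * Cb"
  have \<psi>: "\<delta>1 \<le> \<psi> y * h' (\<phi> y)" "\<psi> y * h' (\<phi> y) \<le> \<delta>2" if y: "Y \<le> y" for y
  proof -
    have y1: "h1 X \<le> y" and y2: "h2 X2 < y" and y3: "X3 \<le> y" using y unfolding Y_def by auto
    define u v A where "u = \<phi> y" and "v = \<phi>2 y" and "A = c2 + \<theta> v"
    have u: "X \<le> u" "h1 u = y" unfolding u_def using \<phi>_props[OF y1] by auto
    have v: "X2 < v" "h2 v = y" "deriv \<phi>2 y = 1 / (y / v * A)" using \<phi>2[OF y2] unfolding v_def A_def by auto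
    have A: "1/2 \<le> A" "A \<le> 3" unfolding A_def using X2[of v] v assms(4,5) by auto
    have u0: "0 < u" using u X1 by linarith
    have v0: "0 < v" using v X2[of v] assms(1) by simp
    have y0: "0 < y" using h_pos[OF u(1)] u by simp
    have "y \<in> h2 ` {x0..}" by (rule image_eqI[where x = v]) (use v X2[of v] in auto)
    then have mem: "y \<in> h1 ` {x0..} \<inter> h2 ` {x0..}" using mem1[OF y1] by blast
    have uv: "u \<le> Ca * v" "v \<le> Cb * u" using Cab(3,4)[OF mem] \<phi>1[OF y1] unfolding u_def v_def by auto
    have dv: "deriv \<phi>2 y = v / (y * A)" unfolding v(3) using y0 v0 A by (simp add: field_simps)
    have dpos: "0 < v / (y * A)" using y0 v0 A by simp
    have "1/2 < \<psi> y / (v / (y * A))" "\<psi> y / (v / (y * A)) < 2" using X3[OF y3] unfolding dv by auto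
    then have ps: "1/2 * (v / (y * A)) \<le> \<psi> y" "\<psi> y \<le> 2 * (v / (y * A))"
      using dpos by (simp_all only: pos_less_divide_eq pos_divide_less_eq less_imp_le)
    have "v / (y * 3) \<le> v / (y * A)" using y0 v0 A by (intro divide_left_mono mult_left_mono) auto
    then have p1: "v / (6 * y) \<le> \<psi> y" using ps(1) by (simp add: field_simps)
    have "v / (y * A) \<le> v / (y * (1/2))" using y0 v0 A by (intro divide_left_mono mult_left_mono) auto
    then have "2 * (v / (y * A)) \<le> 2 * (v / (y * (1/2)))" by (rule mult_left_mono) simp
    also have "\<dots> = 4 * v / y" by simp
    finally have p2: "\<psi> y \<le> 4 * v / y" using ps(2) by (rule order_trans[rotated])
    have hu: "y / u \<le> h' u" "h' u \<le> 2 * y / u" using h'_ge[OF u(1)] h'_le[OF u(1)] u by auto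
    have "\<delta>1 \<le> v / (6 * u)" unfolding \<delta>1_def using uv(1) u0 Cab(1) by (simp add: field_simps)
    also have "\<dots> = v / (6 * y) * (y / u)" using y0 u0 by simp
    also have "\<dots> \<le> \<psi> y * h' u" using p1 hu y0 u0 v0 by (intro mult_mono) (auto intro: order_trans[OF _ p1])
    finally show "\<delta>1 \<le> \<psi> y * h' (\<phi> y)" unfolding u_def .
    have "0 \<le> h' u" using h'_ge_1[OF u(1)] by linarith
    then have "\<psi> y * h' u \<le> (4 * v / y) * (2 * y / u)" using p2 hu y0 v0 by (intro mult_mono) auto
    also have "\<dots> = 8 * v / u" using y0 by simp
    also have "\<dots> \<le> \<delta>2" unfolding \<delta>2_def using uv(2) u0 by (simp add: field_simps)
    finally show "\<psi> y * h' (\<phi> y) \<le> \<delta>2" unfolding u_def .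
  qed
  have pos: "0 < \<delta>1" "0 \<le> \<delta>2" unfolding \<delta>1_def \<delta>2_def using Cab by auto
  have YX: "h1 X \<le> Y" unfolding Y_def by simp
  \<comment> \<open>The deviation bound is the same for every \<open>L\<close>; only the threshold
    beyond which it applies depends on it. This lets \<open>finite_weak_type_B\<close> choose its
    starting block afterwards.\<close>
  have near: "\<exists>N1. \<forall>n\<in>B. N1 < n \<longrightarrow> (\<exists>m::nat. L \<le> m \<and> real m \<le> \<phi> (real n) + 1 \<and> \<bar>int n - \<lfloor>h1 (real m)\<rfloor>\<bar> \<le> \<lfloor>4 * \<delta>2\<rfloor> + 2)" for L
  proof (rule exI[of _ "nat \<lceil>max Y (h1 (X + real L + 2))\<rceil>"], intro ballI impI)
    fix n assume n: "n \<in> B" "nat \<lceil>max Y (h1 (X + real L + 2))\<rceil> < n"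
    then have nY: "Y \<le> real n" "h1 (X + real L + 2) \<le> real n" by linarith+
    have "frac (\<phi> (real n)) < \<psi> (real n) \<or> frac (- \<phi> (real n)) < \<psi> (real n)"
      using n(1) assms(16) \<phi>1[of "real n"] nY YX unfolding B_plus_def B_minus_def by auto
    then show "\<exists>m::nat. L \<le> m \<and> real m \<le> \<phi> (real n) + 1 \<and> \<bar>int n - \<lfloor>h1 (real m)\<rfloor>\<bar> \<le> \<lfloor>4 * \<delta>2\<rfloor> + 2"
      using near_floor[OF \<psi>(2) pos(2) nY] by blast
  qed
  have hX1: "1 \<le> h1 X" using h_ge_self[of X] X1 by simp
  have Bmem: "(\<forall>n. Y \<le> real n \<and> frac (\<phi> (real n)) < \<psi> (real n) \<longrightarrow> n \<in> B) \<or>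
      (\<forall>n. Y \<le> real n \<and> frac (- \<phi> (real n)) < \<psi> (real n) \<longrightarrow> n \<in> B)"
  proof -
    have "1 \<le> n \<and> real n \<in> h1 ` {x0..} \<and> \<phi>1 (real n) = \<phi> (real n)" if "Y \<le> real n" for n
      using that YX hX1 \<phi>1[of "real n"] mem1[of "real n"] by auto
    then show ?thesis using assms(16) unfolding B_plus_def B_minus_def by auto
  qed
  obtain c0 where c0: "0 < c0" "\<exists>N0. \<forall>N\<ge>N0. c0 * \<phi> (real N) \<le> real (card (B \<inter> {1..N}))"
    using card_B_lower[OF \<psi>(1) pos(1) Bmem] by blast
  have "0 \<le> \<lfloor>4 * \<delta>2\<rfloor> + 2" using pos(2) by simp
  then obtain C where C: "0 < C" "finite_weak_type B C"
    using finite_weak_type_B[OF near _ c0] by blast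
  show ?thesis
    using weak_type_1_1[OF C(2,1)] strong_type[OF C(2,1)] C(1) by blast
qed

end
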